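(* The bicategory $\mathcal Q\mathrm{tld}$ of small quantaloids, modules and module homomorphisms is a cyclic $*$-autonomous bicategory.
   Context: $\mathcal Q\mathrm{tld}$: 0-cells are small quantaloids, i.e. small categories enriched in the category $\mathrm{Sup}$ of suplattices (complete lattices and sup-preserving maps); composition is written $\otimes$ in diagrammatic order with identities $\top_q$. A 1-cell $A\colon\mathcal Q\nrightarrow\mathcal R$ is a $(\mathcal Q,\mathcal R)$-module: suplattices $A(q,r)$ for $q\in\mathrm{ob}\,\mathcal Q$, $r\in\mathrm{ob}\,\mathcal R$, with actions $\star\colon\mathcal Q(q,q')\times A(q',r)\to A(q,r)$ and $\cdot\colon A(q,r)\times\mathcal R(r,r')\to A(q,r')$, preserving suprema in each variable, such that $\top_q\star a=a$, $(f\otimes g)\star a=f\star(g\star a)$, $a\cdot\top_r=a$, $a\cdot(h\otimes k)=(a\cdot h)\cdot k$ and $(f\star a)\cdot h=f\star(a\cdot h)$ whenever these make sense. A 2-cell $A\to B$ is a family of sup-preserving maps $\varphi_{q,r}\colon A(q,r)\to B(q,r)$ with $\varphi_{q,r}(f\star a')=f\star\varphi_{q',r}(a')$ and $\varphi_{q,r'}(a\cdot h)=\varphi_{q,r}(a)\cdot h$. Equivalently it is $\mathrm{Sup}\text{-}\mathcal P\mathrm{rof}$, the bicategory of small $\mathrm{Sup}$-categories, $\mathrm{Sup}$-profunctors and $\mathrm{Sup}$-transformations; composition is the coend $(A\otimes_{\mathcal R}B)(q,s)=\int^{r}A(q,r)\otimes B(r,s)$ in $\mathrm{Sup}$ and the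 identity on $\mathcal Q$ is $\mathcal Q(-,-)$. Composition in bicategories is written $\otimes$ in diagrammatic order, with identities $\top_X$. A right extension of $B\colon X\to Z$ along $A\colon X\to Y$ is a 1-cell $A\rhd B\colon Y\to Z$ with a 2-cell $A\otimes(A\rhd B)\to B$ inducing bijections between 2-cells $C\to A\rhd B$ and $A\otimes C\to B$ for all $C\colon Y\to Z$. A right lifting of $C\colon Z\to Y$ through $A\colon X\to Y$ is a 1-cell $C\lhd A\colon Z\to X$ with a 2-cell $(C\lhd A)\otimes A\to C$ inducing bijections between 2-cells $B\to C\lhd A$ and $B\otimes A\to C$ for all $B\colon Z\to X$. A bicategory is biclosed if it has all of these. A family $\{\bot_X\colon X\to X\}$ of 1-cells, one for each 0-cell of a biclosed bicategory, is dualizing if the canonical 2-cells $\delta_{A,Y}\colon A\to(\bot_Y\lhd A)\rhd\bot_Y$ and $\delta_{X,A}\colon A\to\bot_X\lhd(A\rhd\bot_X)$ are invertible for all $A\colon X\to Y$. It is cyclic dualizing if moreover there are invertible 2-cells $\theta_A\colon\bot_Y\lhd A\to A\rhd\bot_X$, natural in $A\colon X\to Y$, such that $\theta_{\bot_Y\lhd A}\circ(\bot_X\lhd\theta_A)\circ\delta_{X,A}=\delta_{A,Y}$. A cyclic $*$-autonomous bicategory is (equivalently to the definition via an adjoint equivalence $(-)^*\colon\mathcal B(X,Y)\to\mathcal B(Y,X)^{op}$ with $A^*$ naturally the right extension of $\top_X^*$ along $A$) a biclosed bicategory admitting a cyclic dualizing family. *)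

theory Defs
  imports "HOL-Algebra.Complete_Lattice" "HOL-Library.Nat_Bijection"
begin

section \<open>Bicategories\<close>

text \<open>
  Composition of 1-cells \<open>A \<otimes> C\<close> and horizontal composition of 2-cells \<open>\<phi> \<odot> \<psi>\<close> are in
  diagrammatic order; vertical composition \<open>\<psi> \<cdot> \<phi>\<close> is in function order.  The operations are
  only constrained where source and target match.
\<close>

record ('o, 'm, 't) bicat =
  ob :: "'o set"
  arr1 :: "'m set"
  src1 :: "'m \<Rightarrow> 'o"
  trg1 :: "'m \<Rightarrow> 'o"
  arr2 :: "'t set"
  src2 :: "'t \<Rightarrow> 'm"
  trg2 :: "'t \<Rightarrow> 'm"
  vid :: "'m \<Rightarrow> 't"
  vcomp :: "'t \<Rightarrow> 't \<Rightarrow> 't"  (infixl \<open>\<cdot>\<index>\<close> 60)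
  hid :: "'o \<Rightarrow> 'm"  (\<open>\<top>\<index>\<close>)
  hcomp1 :: "'m \<Rightarrow> 'm \<Rightarrow> 'm"  (infixl \<open>\<otimes>\<index>\<close> 70)
  hcomp2 :: "'t \<Rightarrow> 't \<Rightarrow> 't"  (infixl \<open>\<odot>\<index>\<close> 65)
  assoc :: "'m \<Rightarrow> 'm \<Rightarrow> 'm \<Rightarrow> 't"
  lunit :: "'m \<Rightarrow> 't"
  runit :: "'m \<Rightarrow> 't"

definition hom1 :: "('o, 'm, 't) bicat \<Rightarrow> 'o \<Rightarrow> 'o \<Rightarrow> 'm set" where
  "hom1 B X Y = {A \<in> arr1 B. src1 B A = X \<and> trg1 B A = Y}"

definition hom2 :: "('o, 'm, 't) bicat \<Rightarrow> 'm \<Rightarrow> 'm \<Rightarrow> 't set" where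
  "hom2 B A A' = {\<phi> \<in> arr2 B. src2 B \<phi> = A \<and> trg2 B \<phi> = A'}"

definition iso2 :: "('o, 'm, 't) bicat \<Rightarrow> 'm \<Rightarrow> 'm \<Rightarrow> 't set" where
  "iso2 B A A' = {\<phi> \<in> hom2 B A A'. \<exists>\<psi> \<in> hom2 B A' A.
     \<psi> \<cdot>\<^bsub>B\<^esub> \<phi> = vid B A \<and> \<phi> \<cdot>\<^bsub>B\<^esub> \<psi> = vid B A'}"

locale bicategory =
  fixes B :: "('o, 'm, 't) bicat" (structure)
  assumes arr1_ob: "A \<in> arr1 B \<Longrightarrow> src1 B A \<in> ob B \<and> trg1 B A \<in> ob B"
    and arr2_arr1: "\<phi> \<in> arr2 B \<Longrightarrow> src2 B \<phi> \<in> arr1 B \<and> trg2 B \<phi> \<in> arr1 B"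
    and arr2_parallel: "\<phi> \<in> arr2 B \<Longrightarrow>
      src1 B (src2 B \<phi>) = src1 B (trg2 B \<phi>) \<and> trg1 B (src2 B \<phi>) = trg1 B (trg2 B \<phi>)"
    and vid_hom: "A \<in> arr1 B \<Longrightarrow> vid B A \<in> hom2 B A A"
    and vcomp_hom: "\<lbrakk>\<phi> \<in> hom2 B A A'; \<psi> \<in> hom2 B A' A''\<rbrakk> \<Longrightarrow> \<psi> \<cdot> \<phi> \<in> hom2 B A A''"
    and vcomp_vid: "\<phi> \<in> hom2 B A A' \<Longrightarrow> \<phi> \<cdot> vid B A = \<phi> \<and> vid B A' \<cdot> \<phi> = \<phi>"
    and vcomp_assoc: "\<lbrakk>\<phi> \<in> hom2 B A A'; \<psi> \<in> hom2 B A' A''; \<chi> \<in> hom2 B A'' A'''\<rbrakk>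
      \<Longrightarrow> \<chi> \<cdot> (\<psi> \<cdot> \<phi>) = \<chi> \<cdot> \<psi> \<cdot> \<phi>"
    and hid_hom: "X \<in> ob B \<Longrightarrow> hid B X \<in> hom1 B X X"
    and hcomp1_hom: "\<lbrakk>A \<in> hom1 B X Y; C \<in> hom1 B Y Z\<rbrakk> \<Longrightarrow> A \<otimes> C \<in> hom1 B X Z"
    and hcomp2_hom: "\<lbrakk>A \<in> hom1 B X Y; C \<in> hom1 B Y Z; \<phi> \<in> hom2 B A A'; \<psi> \<in> hom2 B C C'\<rbrakk>
      \<Longrightarrow> \<phi> \<odot> \<psi> \<in> hom2 B (A \<otimes> C) (A' \<otimes> C')"
    and hcomp2_vid: "\<lbrakk>A \<in> hom1 B X Y; C \<in> hom1 B Y Z\<rbrakk> \<Longrightarrow> vid B A \<odot> vid B C = vid B (A \<otimes> C)"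
    and interchange: "\<lbrakk>A \<in> hom1 B X Y; C \<in> hom1 B Y Z; \<phi> \<in> hom2 B A A'; \<phi>' \<in> hom2 B A' A'';
        \<psi> \<in> hom2 B C C'; \<psi>' \<in> hom2 B C' C''\<rbrakk>
      \<Longrightarrow> (\<phi>' \<cdot> \<phi>) \<odot> (\<psi>' \<cdot> \<psi>) = (\<phi>' \<odot> \<psi>') \<cdot> (\<phi> \<odot> \<psi>)"
    and assoc_iso: "\<lbrakk>A \<in> hom1 B W X; C \<in> hom1 B X Y; D \<in> hom1 B Y Z\<rbrakk>
      \<Longrightarrow> assoc B A C D \<in> iso2 B (A \<otimes> C \<otimes> D) (A \<otimes> (C \<otimes> D))"
    and assoc_natural: "\<lbrakk>A \<in> hom1 B W X; C \<in> hom1 B X Y; D \<in> hom1 B Y Z;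
        \<phi> \<in> hom2 B A A'; \<psi> \<in> hom2 B C C'; \<chi> \<in> hom2 B D D'\<rbrakk>
      \<Longrightarrow> assoc B A' C' D' \<cdot> ((\<phi> \<odot> \<psi>) \<odot> \<chi>) = (\<phi> \<odot> (\<psi> \<odot> \<chi>)) \<cdot> assoc B A C D"
    and lunit_iso: "A \<in> hom1 B X Y \<Longrightarrow> lunit B A \<in> iso2 B (hid B X \<otimes> A) A"
    and lunit_natural: "\<lbrakk>A \<in> hom1 B X Y; \<phi> \<in> hom2 B A A'\<rbrakk>
      \<Longrightarrow> lunit B A' \<cdot> (vid B (hid B X) \<odot> \<phi>) = \<phi> \<cdot> lunit B A"
    and runit_iso: "A \<in> hom1 B X Y \<Longrightarrow> runit B A \<in> iso2 B (A \<otimes> hid B Y) A"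
    and runit_natural: "\<lbrakk>A \<in> hom1 B X Y; \<phi> \<in> hom2 B A A'\<rbrakk>
      \<Longrightarrow> runit B A' \<cdot> (\<phi> \<odot> vid B (hid B Y)) = \<phi> \<cdot> runit B A"
    and pentagon: "\<lbrakk>A \<in> hom1 B V W; C \<in> hom1 B W X; D \<in> hom1 B X Y; E \<in> hom1 B Y Z\<rbrakk>
      \<Longrightarrow> assoc B A C (D \<otimes> E) \<cdot> assoc B (A \<otimes> C) D E
        = (vid B A \<odot> assoc B C D E) \<cdot> assoc B A (C \<otimes> D) E \<cdot> (assoc B A C D \<odot> vid B E)"
    and triangle: "\<lbrakk>A \<in> hom1 B X Y; C \<in> hom1 B Y Z\<rbrakk>
      \<Longrightarrow> (vid B A \<odot> lunit B C) \<cdot> assoc B A (hid B Y) C = runit B A \<odot> vid B C"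


section \<open>Biclosed and cyclic $*$-autonomous bicategories\<close>

definition is_right_extension ::
  "('o, 'm, 't) bicat \<Rightarrow> 'o \<Rightarrow> 'o \<Rightarrow> 'o \<Rightarrow> 'm \<Rightarrow> 'm \<Rightarrow> 'm \<Rightarrow> 't \<Rightarrow> bool" where
  "is_right_extension B X Y Z A D E \<epsilon> \<longleftrightarrow>
     E \<in> hom1 B Y Z \<and> \<epsilon> \<in> hom2 B (A \<otimes>\<^bsub>B\<^esub> E) D \<and>
     (\<forall>C \<in> hom1 B Y Z. bij_betw (\<lambda>\<phi>. \<epsilon> \<cdot>\<^bsub>B\<^esub> (vid B A \<odot>\<^bsub>B\<^esub> \<phi>)) (hom2 B C E) (hom2 B (A \<otimes>\<^bsub>B\<^esub> C) D))"

definition is_right_lifting ::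
  "('o, 'm, 't) bicat \<Rightarrow> 'o \<Rightarrow> 'o \<Rightarrow> 'o \<Rightarrow> 'm \<Rightarrow> 'm \<Rightarrow> 'm \<Rightarrow> 't \<Rightarrow> bool" where
  "is_right_lifting B X Y Z A C L \<epsilon> \<longleftrightarrow>
     L \<in> hom1 B Z X \<and> \<epsilon> \<in> hom2 B (L \<otimes>\<^bsub>B\<^esub> A) C \<and>
     (\<forall>D \<in> hom1 B Z X. bij_betw (\<lambda>\<phi>. \<epsilon> \<cdot>\<^bsub>B\<^esub> (\<phi> \<odot>\<^bsub>B\<^esub> vid B A)) (hom2 B D L) (hom2 B (D \<otimes>\<^bsub>B\<^esub> A) C))"

text \<open>
  A biclosed bicategory comes with a choice of right extensions \<open>A \<rhd> D\<close> and right liftings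
  \<open>C \<lhd> A\<close>, with universal 2-cells \<open>ev_ext A D\<close> and \<open>ev_lift C A\<close>.  They are unique up to unique
  isomorphism, so nothing below depends on the choice.
\<close>

locale biclosed_bicategory = bicategory B
  for B :: "('o, 'm, 't) bicat" (structure) +
  fixes ext :: "'m \<Rightarrow> 'm \<Rightarrow> 'm"  (infixr \<open>\<rhd>\<close> 68)
    and ev_ext :: "'m \<Rightarrow> 'm \<Rightarrow> 't"
    and lift :: "'m \<Rightarrow> 'm \<Rightarrow> 'm"  (infixl \<open>\<lhd>\<close> 68)
    and ev_lift :: "'m \<Rightarrow> 'm \<Rightarrow> 't"
  assumes right_ext: "\<lbrakk>A \<in> hom1 B X Y; D \<in> hom1 B X Z\<rbrakk>
      \<Longrightarrow> is_right_extension B X Y Z A D (A \<rhd> D) (ev_ext A D)"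
    and right_lift: "\<lbrakk>A \<in> hom1 B X Y; C \<in> hom1 B Z Y\<rbrakk>
      \<Longrightarrow> is_right_lifting B X Y Z A C (C \<lhd> A) (ev_lift C A)"
begin

text \<open>The 2-cell \<open>C \<rightarrow> A \<rhd> D\<close> corresponding to \<open>\<psi> : A \<otimes> C \<rightarrow> D\<close>, and dually.\<close>

definition ext_transpose :: "'m \<Rightarrow> 'm \<Rightarrow> 'm \<Rightarrow> 't \<Rightarrow> 't" where
  "ext_transpose A D C \<psi> =
     (THE \<phi>. \<phi> \<in> hom2 B C (A \<rhd> D) \<and> ev_ext A D \<cdot> (vid B A \<odot> \<phi>) = \<psi>)"

definition lift_transpose :: "'m \<Rightarrow> 'm \<Rightarrow> 'm \<Rightarrow> 't \<Rightarrow> 't" where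
  "lift_transpose A C D \<psi> =
     (THE \<phi>. \<phi> \<in> hom2 B D (C \<lhd> A) \<and> ev_lift C A \<cdot> (\<phi> \<odot> vid B A) = \<psi>)"

text \<open>For \<open>f : A \<rightarrow> A'\<close>, the induced 2-cells \<open>f \<rhd> D : A' \<rhd> D \<rightarrow> A \<rhd> D\<close> and
  \<open>C \<lhd> f : C \<lhd> A' \<rightarrow> C \<lhd> A\<close>.\<close>

definition ext_map :: "'t \<Rightarrow> 'm \<Rightarrow> 't" where
  "ext_map f D = (let A = src2 B f; A' = trg2 B f in
     ext_transpose A D (A' \<rhd> D) (ev_ext A' D \<cdot> (f \<odot> vid B (A' \<rhd> D))))"

definition lift_map :: "'m \<Rightarrow> 't \<Rightarrow> 't" where
  "lift_map C f = (let A = src2 B f; A' = trg2 B f in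
     lift_transpose A C (C \<lhd> A') (ev_lift C A' \<cdot> (vid B (C \<lhd> A') \<odot> f)))"

text \<open>For \<open>A : X \<rightarrow> Y\<close>, the 2-cells \<open>\<delta>\<^bsub>A,Y\<^esub> : A \<rightarrow> (\<bottom>\<^sub>Y \<lhd> A) \<rhd> \<bottom>\<^sub>Y\<close> and
  \<open>\<delta>\<^bsub>X,A\<^esub> : A \<rightarrow> \<bottom>\<^sub>X \<lhd> (A \<rhd> \<bottom>\<^sub>X)\<close>.\<close>

definition delta_trg :: "('o \<Rightarrow> 'm) \<Rightarrow> 'm \<Rightarrow> 'o \<Rightarrow> 't" where
  "delta_trg \<beta> A Y = ext_transpose (\<beta> Y \<lhd> A) (\<beta> Y) A (ev_lift (\<beta> Y) A)"

definition delta_src :: "('o \<Rightarrow> 'm) \<Rightarrow> 'o \<Rightarrow> 'm \<Rightarrow> 't" where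
  "delta_src \<beta> X A = lift_transpose (A \<rhd> \<beta> X) (\<beta> X) A (ev_ext A (\<beta> X))"

definition dualizing :: "('o \<Rightarrow> 'm) \<Rightarrow> bool" where
  "dualizing \<beta> \<longleftrightarrow>
     (\<forall>X \<in> ob B. \<beta> X \<in> hom1 B X X) \<and>
     (\<forall>X \<in> ob B. \<forall>Y \<in> ob B. \<forall>A \<in> hom1 B X Y.
        delta_trg \<beta> A Y \<in> iso2 B A ((\<beta> Y \<lhd> A) \<rhd> \<beta> Y) \<and>
        delta_src \<beta> X A \<in> iso2 B A (\<beta> X \<lhd> (A \<rhd> \<beta> X)))"

definition cyclic_dualizing :: "('o \<Rightarrow> 'm) \<Rightarrow> bool" where
  "cyclic_dualizing \<beta> \<longleftrightarrow>
     dualizing \<beta> \<and>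
     (\<exists>\<theta> :: 'm \<Rightarrow> 't.
        (\<forall>X \<in> ob B. \<forall>Y \<in> ob B. \<forall>A \<in> hom1 B X Y. \<theta> A \<in> iso2 B (\<beta> Y \<lhd> A) (A \<rhd> \<beta> X)) \<and>
        (\<forall>X \<in> ob B. \<forall>Y \<in> ob B. \<forall>A \<in> hom1 B X Y. \<forall>A' \<in> hom1 B X Y. \<forall>f \<in> hom2 B A A'.
           \<theta> A \<cdot> lift_map (\<beta> Y) f = ext_map f (\<beta> X) \<cdot> \<theta> A') \<and>
        (\<forall>X \<in> ob B. \<forall>Y \<in> ob B. \<forall>A \<in> hom1 B X Y.
           \<theta> (\<beta> Y \<lhd> A) \<cdot> lift_map (\<beta> X) (\<theta> A) \<cdot> delta_src \<beta> X A = delta_trg \<beta> A Y))"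

end

definition cyclic_star_autonomous :: "('o, 'm, 't) bicat \<Rightarrow> bool" where
  "cyclic_star_autonomous B \<longleftrightarrow>
     (\<exists>ext ev_ext lift ev_lift. biclosed_bicategory B ext ev_ext lift ev_lift \<and>
        (\<exists>\<beta>. biclosed_bicategory.cyclic_dualizing B ext ev_ext lift ev_lift \<beta>))"


section \<open>Universes of sets\<close>

text \<open>
  Smallness is relative to a universe of sets \<open>'u\<close>: \<open>elts x\<close> is the set of elements of \<open>x\<close>, and
  the sets in the range of \<open>elts\<close> are the small ones.  Foundation and infinity are not required,
  so the instances include the models of ZF in which separation and replacement hold for all HOL
  predicates and functions (such as the type \<open>V\<close> of ZFC in HOL) and the hereditarily finite sets.
\<close>

locale set_universe =
  fixes elts :: "'u \<Rightarrow> 'u set"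
  assumes extensional: "inj elts"
    and separation: "Y \<subseteq> elts x \<Longrightarrow> Y \<in> range elts"
    and union: "\<Union> (elts ` elts x) \<in> range elts"
    and powerset: "{y. elts y \<subseteq> elts x} \<in> range elts"
    and replacement: "f ` elts x \<in> range elts"

text \<open>Hereditarily finite sets, in Ackermann's coding.\<close>

lemma set_universe_set_decode: "set_universe set_decode"
proof -
  have r: "A \<in> range set_decode" if "finite A" for A
    using set_encode_inverse[OF that] by (metis rangeI)
  have fin: "finite {y. set_decode y \<subseteq> set_decode x}" for x
    by (rule finite_subset[where B = "{..x}"]) (auto dest: subset_decode_imp_le)
  show ?thesis
  proof
    show "inj set_decode" by (rule inj_on_inverseI[where g = set_encode]) simp
    show "Y \<in> range set_decode" if "Y \<subseteq> set_decode x" for Y x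
      using that finite_subset finite_set_decode by (intro r) blast
    show "\<Union> (set_decode ` set_decode x) \<in> range set_decode" for x by (rule r) simp
    show "{y. set_decode y \<subseteq> set_decode x} \<in> range set_decode" for x by (rule r[OF fin])
    show "f ` set_decode x \<in> range set_decode" for f x by (rule r) simp
  qed
qed

context set_universe
begin

definition small :: "'u set \<Rightarrow> bool" where
  "small S \<longleftrightarrow> S \<in> range elts"

definition vset :: "'u set \<Rightarrow> 'u" where
  "vset S = inv elts S"

definition vpair :: "'u \<Rightarrow> 'u \<Rightarrow> 'u" where
  "vpair a b = vset {vset {a}, vset {a, b}}"

text \<open>Small sets of triples as elements of the universe.\<close>

definition vtriple :: "'u \<times> 'u \<times> 'u \<Rightarrow> 'u" where
  "vtriple = (\<lambda>(r, a, b). vpair r (vpair a b))"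

definition enc :: "('u \<times> 'u \<times> 'u) set \<Rightarrow> 'u" where
  "enc S = vset (vtriple ` S)"

definition dec :: "'u \<Rightarrow> ('u \<times> 'u \<times> 'u) set" where
  "dec v = {t. vtriple t \<in> elts v}"

end


section \<open>Small quantaloids, modules and their homomorphisms\<close>

text \<open>A suplattice is a \<^locale>\<open>complete_lattice\<close> of HOL-Algebra; its morphisms are:\<close>

definition sup_map :: "'u gorder \<Rightarrow> 'u gorder \<Rightarrow> ('u \<Rightarrow> 'u) \<Rightarrow> bool" where
  "sup_map L M f \<longleftrightarrow> f \<in> carrier L \<rightarrow> carrier M \<and>
     (\<forall>S \<subseteq> carrier L. f (\<Squnion>\<^bsub>L\<^esub> S) = \<Squnion>\<^bsub>M\<^esub> (f ` S))"

definition sup_bimap :: "'u gorder \<Rightarrow> 'u gorder \<Rightarrow> 'u gorder \<Rightarrow> ('u \<Rightarrow> 'u \<Rightarrow> 'u) \<Rightarrow> bool" where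
  "sup_bimap L L' M f \<longleftrightarrow>
     (\<forall>a \<in> carrier L. sup_map L' M (f a)) \<and> (\<forall>b \<in> carrier L'. sup_map L M (\<lambda>a. f a b))"

text \<open>
  The homs of a quantaloid need not be disjoint, hence the object arguments of the operations:
  \<open>qcomp Q p q r f g\<close> is \<open>f \<otimes> g\<close> for \<open>f \<in> Q(p, q)\<close>, \<open>g \<in> Q(q, r)\<close>;
  \<open>lact A q q' r f a\<close> is \<open>f \<star> a\<close> for \<open>f \<in> Q(q, q')\<close>, \<open>a \<in> A(q', r)\<close>;
  \<open>ract A q r r' a h\<close> is \<open>a \<cdot> h\<close> for \<open>a \<in> A(q, r)\<close>, \<open>h \<in> R(r, r')\<close>.
\<close>

record 'u quantaloid =
  Ob :: "'u set"
  Hom :: "'u \<Rightarrow> 'u \<Rightarrow> 'u gorder"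
  qcomp :: "'u \<Rightarrow> 'u \<Rightarrow> 'u \<Rightarrow> 'u \<Rightarrow> 'u \<Rightarrow> 'u"
  qid :: "'u \<Rightarrow> 'u"

record 'u qmodule =
  Src :: "'u quantaloid"
  Trg :: "'u quantaloid"
  At :: "'u \<Rightarrow> 'u \<Rightarrow> 'u gorder"
  lact :: "'u \<Rightarrow> 'u \<Rightarrow> 'u \<Rightarrow> 'u \<Rightarrow> 'u \<Rightarrow> 'u"
  ract :: "'u \<Rightarrow> 'u \<Rightarrow> 'u \<Rightarrow> 'u \<Rightarrow> 'u \<Rightarrow> 'u"

record 'u qmodhom =
  Dom :: "'u qmodule"
  Cod :: "'u qmodule"
  app :: "'u \<Rightarrow> 'u \<Rightarrow> 'u \<Rightarrow> 'u"

context set_universe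
begin

definition small_suplattice :: "'u gorder \<Rightarrow> bool" where
  "small_suplattice L \<longleftrightarrow> complete_lattice L \<and> small (carrier L)"

definition small_quantaloid :: "'u quantaloid \<Rightarrow> bool" where
  "small_quantaloid Q \<longleftrightarrow>
     small (Ob Q) \<and>
     (\<forall>p \<in> Ob Q. \<forall>q \<in> Ob Q. small_suplattice (Hom Q p q)) \<and>
     (\<forall>p \<in> Ob Q. \<forall>q \<in> Ob Q. \<forall>r \<in> Ob Q.
        sup_bimap (Hom Q p q) (Hom Q q r) (Hom Q p r) (qcomp Q p q r)) \<and>
     (\<forall>q \<in> Ob Q. qid Q q \<in> carrier (Hom Q q q)) \<and>
     (\<forall>p \<in> Ob Q. \<forall>q \<in> Ob Q. \<forall>f \<in> carrier (Hom Q p q).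
        qcomp Q p p q (qid Q p) f = f \<and> qcomp Q p q q f (qid Q q) = f) \<and>
     (\<forall>p \<in> Ob Q. \<forall>q \<in> Ob Q. \<forall>r \<in> Ob Q. \<forall>s \<in> Ob Q.
        \<forall>f \<in> carrier (Hom Q p q). \<forall>g \<in> carrier (Hom Q q r). \<forall>h \<in> carrier (Hom Q r s).
        qcomp Q p r s (qcomp Q p q r f g) h = qcomp Q p q s f (qcomp Q q r s g h))"

definition is_module :: "'u qmodule \<Rightarrow> bool" where
  "is_module A \<longleftrightarrow> (let Q = Src A; R = Trg A in
     small_quantaloid Q \<and> small_quantaloid R \<and>
     (\<forall>q \<in> Ob Q. \<forall>r \<in> Ob R. small_suplattice (At A q r)) \<and>
     (\<forall>q \<in> Ob Q. \<forall>q' \<in> Ob Q. \<forall>r \<in> Ob R.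
        sup_bimap (Hom Q q q') (At A q' r) (At A q r) (lact A q q' r)) \<and>
     (\<forall>q \<in> Ob Q. \<forall>r \<in> Ob R. \<forall>r' \<in> Ob R.
        sup_bimap (At A q r) (Hom R r r') (At A q r') (ract A q r r')) \<and>
     (\<forall>q \<in> Ob Q. \<forall>r \<in> Ob R. \<forall>a \<in> carrier (At A q r).
        lact A q q r (qid Q q) a = a \<and> ract A q r r a (qid R r) = a) \<and>
     (\<forall>q \<in> Ob Q. \<forall>q' \<in> Ob Q. \<forall>q'' \<in> Ob Q. \<forall>r \<in> Ob R.
        \<forall>f \<in> carrier (Hom Q q q'). \<forall>g \<in> carrier (Hom Q q' q''). \<forall>a \<in> carrier (At A q'' r).
        lact A q q'' r (qcomp Q q q' q'' f g) a = lact A q q' r f (lact A q' q'' r g a)) \<and>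
     (\<forall>q \<in> Ob Q. \<forall>r \<in> Ob R. \<forall>r' \<in> Ob R. \<forall>r'' \<in> Ob R.
        \<forall>a \<in> carrier (At A q r). \<forall>h \<in> carrier (Hom R r r'). \<forall>k \<in> carrier (Hom R r' r'').
        ract A q r r'' a (qcomp R r r' r'' h k) = ract A q r' r'' (ract A q r r' a h) k) \<and>
     (\<forall>q \<in> Ob Q. \<forall>q' \<in> Ob Q. \<forall>r \<in> Ob R. \<forall>r' \<in> Ob R.
        \<forall>f \<in> carrier (Hom Q q q'). \<forall>a \<in> carrier (At A q' r). \<forall>h \<in> carrier (Hom R r r').
        ract A q r r' (lact A q q' r f a) h = lact A q q' r' f (ract A q' r r' a h)))"

definition extend_hom ::
  "'u qmodule \<Rightarrow> 'u qmodule \<Rightarrow> ('u \<Rightarrow> 'u \<Rightarrow> 'u \<Rightarrow> 'u) \<Rightarrow> 'u qmodhom" where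
  "extend_hom A A' \<phi> = \<lparr> Dom = A, Cod = A',
     app = (\<lambda>q r a. if q \<in> Ob (Src A) \<and> r \<in> Ob (Trg A) \<and> a \<in> carrier (At A q r)
                    then \<phi> q r a else undefined) \<rparr>"

text \<open>The last condition makes a homomorphism determined by its values on the carriers.\<close>

definition is_modhom :: "'u qmodhom \<Rightarrow> bool" where
  "is_modhom \<phi> \<longleftrightarrow> (let A = Dom \<phi>; A' = Cod \<phi>; Q = Src A; R = Trg A in
     is_module A \<and> is_module A' \<and> Src A' = Q \<and> Trg A' = R \<and>
     (\<forall>q \<in> Ob Q. \<forall>r \<in> Ob R. sup_map (At A q r) (At A' q r) (app \<phi> q r)) \<and>
     (\<forall>q \<in> Ob Q. \<forall>q' \<in> Ob Q. \<forall>r \<in> Ob R.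
        \<forall>f \<in> carrier (Hom Q q q'). \<forall>a \<in> carrier (At A q' r).
        app \<phi> q r (lact A q q' r f a) = lact A' q q' r f (app \<phi> q' r a)) \<and>
     (\<forall>q \<in> Ob Q. \<forall>r \<in> Ob R. \<forall>r' \<in> Ob R.
        \<forall>a \<in> carrier (At A q r). \<forall>h \<in> carrier (Hom R r r').
        app \<phi> q r' (ract A q r r' a h) = ract A' q r r' (app \<phi> q r a) h) \<and>
     \<phi> = extend_hom A A' (app \<phi>))"

definition id_module :: "'u quantaloid \<Rightarrow> 'u qmodule" where
  "id_module Q = \<lparr> Src = Q, Trg = Q, At = Hom Q, lact = qcomp Q, ract = qcomp Q \<rparr>"


subsection \<open>Composition of modules\<close>

text \<open>
  The suplattice \<open>(A \<otimes> C)(q, s) = \<integral>\<^sup>r A(q, r) \<otimes> C(r, s)\<close> is generated by symbols \<open>a \<otimes> c\<close>, for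
  \<open>a \<in> A(q, r)\<close> and \<open>c \<in> C(r, s)\<close>, subject to \<open>\<Squnion>X \<otimes> c = \<Squnion>\<^bsub>a\<in>X\<^esub> a \<otimes> c\<close>,
  \<open>a \<otimes> \<Squnion>X = \<Squnion>\<^bsub>c\<in>X\<^esub> a \<otimes> c\<close> and \<open>(a \<cdot> h) \<otimes> c = a \<otimes> (h \<star> c)\<close>.  An element is represented by
  the set of all \<open>(r, a, c)\<close> with \<open>a \<otimes> c\<close> below it; the sets arising are those closed
  under the relations, ordered by inclusion.
\<close>

definition gens :: "'u qmodule \<Rightarrow> 'u qmodule \<Rightarrow> 'u \<Rightarrow> 'u \<Rightarrow> ('u \<times> 'u \<times> 'u) set" where
  "gens A C q s = {(r, a, c). r \<in> Ob (Trg A) \<and> a \<in> carrier (At A q r) \<and> c \<in> carrier (At C r s)}"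

definition saturated ::
  "'u qmodule \<Rightarrow> 'u qmodule \<Rightarrow> 'u \<Rightarrow> 'u \<Rightarrow> ('u \<times> 'u \<times> 'u) set \<Rightarrow> bool" where
  "saturated A C q s S \<longleftrightarrow> (let R = Trg A in
     S \<subseteq> gens A C q s \<and>
     (\<forall>r \<in> Ob R. \<forall>X \<subseteq> carrier (At A q r). \<forall>c \<in> carrier (At C r s).
        (r, \<Squnion>\<^bsub>At A q r\<^esub> X, c) \<in> S \<longleftrightarrow> (\<forall>a \<in> X. (r, a, c) \<in> S)) \<and>
     (\<forall>r \<in> Ob R. \<forall>a \<in> carrier (At A q r). \<forall>X \<subseteq> carrier (At C r s).
        (r, a, \<Squnion>\<^bsub>At C r s\<^esub> X) \<in> S \<longleftrightarrow> (\<forall>c \<in> X. (r, a, c) \<in> S)) \<and>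
     (\<forall>r \<in> Ob R. \<forall>r' \<in> Ob R.
        \<forall>a \<in> carrier (At A q r). \<forall>h \<in> carrier (Hom R r r'). \<forall>c \<in> carrier (At C r' s).
        (r', ract A q r r' a h, c) \<in> S \<longleftrightarrow> (r, a, lact C r r' s h c) \<in> S))"

text \<open>\<open>tensor_join A C q s S\<close> is the supremum of the \<open>a \<otimes> c\<close> with \<open>(r, a, c) \<in> S\<close>.\<close>

definition tensor_join ::
  "'u qmodule \<Rightarrow> 'u qmodule \<Rightarrow> 'u \<Rightarrow> 'u \<Rightarrow> ('u \<times> 'u \<times> 'u) set \<Rightarrow> 'u" where
  "tensor_join A C q s S = enc (\<Inter> {T. saturated A C q s T \<and> S \<subseteq> T})"

definition tensor_at :: "'u qmodule \<Rightarrow> 'u qmodule \<Rightarrow> 'u \<Rightarrow> 'u \<Rightarrow> 'u gorder" where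
  "tensor_at A C q s = \<lparr> carrier = enc ` {S. saturated A C q s S}, eq = (=),
     le = (\<lambda>v w. dec v \<subseteq> dec w) \<rparr>"

definition tensor :: "'u qmodule \<Rightarrow> 'u qmodule \<Rightarrow> 'u qmodule" where
  "tensor A C = \<lparr> Src = Src A, Trg = Trg C, At = tensor_at A C,
     lact = (\<lambda>q q' s f v. tensor_join A C q s {(r, lact A q q' r f a, c) | r a c. (r, a, c) \<in> dec v}),
     ract = (\<lambda>q s s' v h. tensor_join A C q s' {(r, a, ract C r s s' c h) | r a c. (r, a, c) \<in> dec v}) \<rparr>"

definition tensor_hom :: "'u qmodhom \<Rightarrow> 'u qmodhom \<Rightarrow> 'u qmodhom" where
  "tensor_hom \<phi> \<psi> = extend_hom (tensor (Dom \<phi>) (Dom \<psi>)) (tensor (Cod \<phi>) (Cod \<psi>))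
     (\<lambda>q s v. tensor_join (Cod \<phi>) (Cod \<psi>) q s {(r, app \<phi> q r a, app \<psi> r s c) | r a c. (r, a, c) \<in> dec v})"

text \<open>\<open>(a \<otimes> c) \<otimes> d \<mapsto> a \<otimes> (c \<otimes> d)\<close>\<close>

definition assoc_hom :: "'u qmodule \<Rightarrow> 'u qmodule \<Rightarrow> 'u qmodule \<Rightarrow> 'u qmodhom" where
  "assoc_hom A C D = extend_hom (tensor (tensor A C) D) (tensor A (tensor C D))
     (\<lambda>q t v. tensor_join A (tensor C D) q t
        {(r, a, tensor_join C D r t {(s, c, d)}) | r a s c d. \<exists>w. (s, w, d) \<in> dec v \<and> (r, a, c) \<in> dec w})"

text \<open>\<open>f \<otimes> a \<mapsto> f \<star> a\<close> and \<open>a \<otimes> h \<mapsto> a \<cdot> h\<close>\<close>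

definition lunit_hom :: "'u qmodule \<Rightarrow> 'u qmodhom" where
  "lunit_hom A = extend_hom (tensor (id_module (Src A)) A) A
     (\<lambda>q r v. \<Squnion>\<^bsub>At A q r\<^esub> {lact A q q' r f a | q' f a. (q', f, a) \<in> dec v})"

definition runit_hom :: "'u qmodule \<Rightarrow> 'u qmodhom" where
  "runit_hom A = extend_hom (tensor A (id_module (Trg A))) A
     (\<lambda>q r v. \<Squnion>\<^bsub>At A q r\<^esub> {ract A q r' r a h | r' a h. (r', a, h) \<in> dec v})"

definition Qtld :: "('u quantaloid, 'u qmodule, 'u qmodhom) bicat" where
  "Qtld = \<lparr>
     ob = {Q. small_quantaloid Q},
     arr1 = {A. is_module A}, src1 = Src, trg1 = Trg,
     arr2 = {\<phi>. is_modhom \<phi>}, src2 = Dom, trg2 = Cod,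
     vid = (\<lambda>A. extend_hom A A (\<lambda>q r a. a)),
     vcomp = (\<lambda>\<psi> \<phi>. extend_hom (Dom \<phi>) (Cod \<psi>) (\<lambda>q r a. app \<psi> q r (app \<phi> q r a))),
     hid = id_module, hcomp1 = tensor, hcomp2 = tensor_hom,
     assoc = assoc_hom, lunit = lunit_hom, runit = runit_hom \<rparr>"

end


section \<open>Composition of modules is the coend\<close>

text \<open>
  \<open>(A \<otimes> C)(q, s)\<close> is a small suplattice (\<open>complete_T\<close>, \<open>small_T\<close>), the elements
  \<open>a \<otimes> c\<close>, written \<open>el r a c\<close> below, preserve suprema in each variable and are balanced over
  the middle quantaloid (\<open>el_bimap\<close>, \<open>el_balanced\<close>), and they are universal with these
  properties (\<open>universal\<close>).
\<close>

lemma sup_le_iff: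
  assumes L: "complete_lattice L" and S: "S \<subseteq> carrier L"
  shows "\<Squnion>\<^bsub>L\<^esub> S \<in> carrier L"
    and "m \<in> carrier L \<Longrightarrow> \<Squnion>\<^bsub>L\<^esub> S \<sqsubseteq>\<^bsub>L\<^esub> m \<longleftrightarrow> (\<forall>x \<in> S. x \<sqsubseteq>\<^bsub>L\<^esub> m)"
proof -
  interpret complete_lattice L by (rule L)
  show c: "\<Squnion>\<^bsub>L\<^esub> S \<in> carrier L" by (rule sup_closed[OF S])
  show "\<Squnion>\<^bsub>L\<^esub> S \<sqsubseteq>\<^bsub>L\<^esub> m \<longleftrightarrow> (\<forall>x \<in> S. x \<sqsubseteq>\<^bsub>L\<^esub> m)" if m: "m \<in> carrier L"
    using sup_upper[OF S] sup_least[OF S m] le_trans S c m by (meson subsetD)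
qed

lemma sup_eqI:
  assumes L: "complete_lattice L" and S: "S \<subseteq> carrier L" and x: "x \<in> carrier L"
    and le: "\<And>m. m \<in> carrier L \<Longrightarrow> x \<sqsubseteq>\<^bsub>L\<^esub> m \<longleftrightarrow> (\<forall>y \<in> S. y \<sqsubseteq>\<^bsub>L\<^esub> m)"
  shows "\<Squnion>\<^bsub>L\<^esub> S = x"
proof -
  interpret complete_lattice L by (rule L)
  note u = sup_le_iff[OF L S]
  have "\<Squnion>\<^bsub>L\<^esub> S \<sqsubseteq>\<^bsub>L\<^esub> x" using u(2)[OF x] le[OF x] le_refl[OF x] by blast
  moreover have "x \<sqsubseteq>\<^bsub>L\<^esub> \<Squnion>\<^bsub>L\<^esub> S" using u(2)[OF u(1)] le[OF u(1)] le_refl[OF u(1)] by blast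
  ultimately show ?thesis using u(1) x by (rule le_antisym)
qed

context set_universe
begin

lemma small_subset: "small T \<Longrightarrow> S \<subseteq> T \<Longrightarrow> small S"
  using separation unfolding small_def by blast

lemma small_image: "small S \<Longrightarrow> small (f ` S)"
  using replacement unfolding small_def by blast

lemma elts_vset: "small S \<Longrightarrow> elts (vset S) = S"
  unfolding small_def vset_def by (simp add: f_inv_into_f)

lemma small_UN:
  assumes "small I" and "\<And>i. i \<in> I \<Longrightarrow> small (F i)"
  shows "small (\<Union>i\<in>I. F i)"
proof -
  obtain y where y: "elts y = (\<lambda>i. vset (F i)) ` I"
    using small_image[OF assms(1)] elts_vset by blast
  have "(\<Union>i\<in>I. F i) = \<Union> (elts ` elts y)"
    using assms(2) by (auto simp: y elts_vset)
  then show ?thesis using union unfolding small_def by metis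
qed

lemma small_pair: "small {a, b}"
proof -
  have e: "small {}" using separation[of "{}"] unfolding small_def by blast
  define z where "z = vset {}"
  have z: "elts z = {}" unfolding z_def by (rule elts_vset[OF e])
  define o1 where "o1 = vset {y. elts y \<subseteq> elts z}"
  have o1: "elts o1 = {y. elts y \<subseteq> elts z}"
    unfolding o1_def using powerset elts_vset small_def by blast
  have "z \<in> elts o1" using o1 by auto
  then have ne: "z \<noteq> o1" using z by auto
  have "z \<in> {y. elts y \<subseteq> elts o1}" "o1 \<in> {y. elts y \<subseteq> elts o1}" using z by auto
  moreover have "small {y. elts y \<subseteq> elts o1}" using powerset small_def by blast
  ultimately have "small {z, o1}" by (meson empty_subsetI insert_subset small_subset)
  from small_image[OF this, of "\<lambda>x. if x = z then a else b"] show ?thesis using ne by (simp add: insert_commute)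
qed

lemma small_singleton: "small {a}"
  using small_pair[of a a] by simp

lemma vpair_inject: "vpair a b = vpair c d \<longleftrightarrow> a = c \<and> b = d"
proof
  assume "vpair a b = vpair c d"
  then have "{vset {a}, vset {a, b}} = {vset {c}, vset {c, d}}"
    unfolding vpair_def by (metis elts_vset small_pair)
  moreover have "vset S = vset S' \<longleftrightarrow> S = S'" if "small S" "small S'" for S S'
    using that elts_vset by metis
  ultimately show "a = c \<and> b = d"
    by (auto simp: doubleton_eq_iff small_pair small_singleton)
qed simp

lemma inj_vtriple: "inj vtriple"
  by (auto simp: inj_on_def vtriple_def vpair_inject)

lemma dec_enc: "small (vtriple ` S) \<Longrightarrow> dec (enc S) = S"
  unfolding dec_def enc_def using inj_vtriple by (auto simp: elts_vset inj_image_mem_iff)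

end

locale composable = set_universe +
  fixes A C :: "'a qmodule" and q s :: 'a
  assumes A: "is_module A" and C: "is_module C" and AC: "Trg A = Src C"
    and q: "q \<in> Ob (Src A)" and s: "s \<in> Ob (Trg C)"
begin

abbreviation "R \<equiv> Trg A"
abbreviation "G \<equiv> gens A C q s"
abbreviation "sat \<equiv> saturated A C q s"
abbreviation "T \<equiv> tensor_at A C q s"
definition "cl S = \<Inter> {I. sat I \<and> S \<subseteq> I}"

lemma suplat:
  assumes "r \<in> Ob R"
  shows "complete_lattice (At A q r)" "small (carrier (At A q r))"
    "complete_lattice (At C r s)" "small (carrier (At C r s))"
  using A C AC assms q s by (auto simp: is_module_def Let_def small_suplattice_def)

lemma ract_in: "\<lbrakk>r \<in> Ob R; r' \<in> Ob R; a \<in> carrier (At A q r); h \<in> carrier (Hom R r r')\<rbrakk>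
    \<Longrightarrow> ract A q r r' a h \<in> carrier (At A q r')"
proof -
  assume *: "r \<in> Ob R" "r' \<in> Ob R" "a \<in> carrier (At A q r)" "h \<in> carrier (Hom R r r')"
  then have "sup_bimap (At A q r) (Hom R r r') (At A q r') (ract A q r r')"
    using A q by (simp add: is_module_def Let_def)
  then show ?thesis using * unfolding sup_bimap_def sup_map_def by blast
qed

lemma lact_in: "\<lbrakk>r \<in> Ob R; r' \<in> Ob R; c \<in> carrier (At C r' s); h \<in> carrier (Hom R r r')\<rbrakk>
    \<Longrightarrow> lact C r r' s h c \<in> carrier (At C r s)"
proof -
  assume *: "r \<in> Ob R" "r' \<in> Ob R" "c \<in> carrier (At C r' s)" "h \<in> carrier (Hom R r r')"
  then have "sup_bimap (Hom R r r') (At C r' s) (At C r s) (lact C r r' s)"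
    using C s by (simp add: is_module_def Let_def AC)
  then show ?thesis using * unfolding sup_bimap_def sup_map_def by blast
qed

lemma small_gens: "small (vtriple ` G)"
proof -
  have "small (\<Union>r\<in>Ob R. \<Union>a\<in>carrier (At A q r). (\<lambda>c. vtriple (r, a, c)) ` carrier (At C r s))"
    using A suplat
    by (intro small_UN small_image) (auto simp: is_module_def Let_def small_quantaloid_def)
  moreover have "vtriple ` G =
      (\<Union>r\<in>Ob R. \<Union>a\<in>carrier (At A q r). (\<lambda>c. vtriple (r, a, c)) ` carrier (At C r s))"
    by (force simp: gens_def)
  ultimately show ?thesis by simp
qed

lemma dec_enc_sub: "S \<subseteq> G \<Longrightarrow> dec (enc S) = S"
  by (rule dec_enc[OF small_subset[OF small_gens]]) auto

lemma sat_sub: "sat S \<Longrightarrow> S \<subseteq> G"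
  by (simp add: saturated_def Let_def)

lemma sat_gens: "sat G"
  unfolding saturated_def Let_def
proof (intro conjI ballI allI impI)
  fix r X c assume "r \<in> Ob R" "X \<subseteq> carrier (At A q r)" "c \<in> carrier (At C r s)"
  then show "((r, \<Squnion>\<^bsub>At A q r\<^esub> X, c) \<in> G) = (\<forall>a \<in> X. (r, a, c) \<in> G)"
    using sup_le_iff(1)[OF suplat(1)] unfolding gens_def by auto
next
  fix r a X assume "r \<in> Ob R" "a \<in> carrier (At A q r)" "X \<subseteq> carrier (At C r s)"
  then show "((r, a, \<Squnion>\<^bsub>At C r s\<^esub> X) \<in> G) = (\<forall>c \<in> X. (r, a, c) \<in> G)"
    using sup_le_iff(1)[OF suplat(3)] unfolding gens_def by auto
qed (simp_all add: gens_def ract_in lact_in)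

lemma sat_sup1:
  assumes "sat I" "r \<in> Ob R" "X \<subseteq> carrier (At A q r)" "c \<in> carrier (At C r s)"
  shows "(r, \<Squnion>\<^bsub>At A q r\<^esub> X, c) \<in> I \<longleftrightarrow> (\<forall>a \<in> X. (r, a, c) \<in> I)"
  using assms by (simp add: saturated_def Let_def)

lemma sat_sup2:
  assumes "sat I" "r \<in> Ob R" "a \<in> carrier (At A q r)" "X \<subseteq> carrier (At C r s)"
  shows "(r, a, \<Squnion>\<^bsub>At C r s\<^esub> X) \<in> I \<longleftrightarrow> (\<forall>c \<in> X. (r, a, c) \<in> I)"
  using assms by (simp add: saturated_def Let_def)

lemma sat_bal:
  assumes "sat I" "r \<in> Ob R" "r' \<in> Ob R" "a \<in> carrier (At A q r)" "h \<in> carrier (Hom R r r')"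
    "c \<in> carrier (At C r' s)"
  shows "(r', ract A q r r' a h, c) \<in> I \<longleftrightarrow> (r, a, lact C r r' s h c) \<in> I"
  using assms by (simp add: saturated_def Let_def)

lemma sat_Inter: "F \<noteq> {} \<Longrightarrow> (\<And>I. I \<in> F \<Longrightarrow> sat I) \<Longrightarrow> sat (\<Inter>F)"
proof -
  assume F: "F \<noteq> {}" and I: "\<And>I. I \<in> F \<Longrightarrow> sat I"
  show "sat (\<Inter>F)"
    unfolding saturated_def Let_def
  proof (intro conjI ballI allI impI)
    show "\<Inter>F \<subseteq> G" using F I sat_sub by blast
  next
    fix r X c assume "r \<in> Ob R" "X \<subseteq> carrier (At A q r)" "c \<in> carrier (At C r s)"
    then have "\<And>J. J \<in> F \<Longrightarrow> (r, \<Squnion>\<^bsub>At A q r\<^esub> X, c) \<in> J \<longleftrightarrow> (\<forall>a \<in> X. (r, a, c) \<in> J)"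
      using I sat_sup1 by simp
    then show "((r, \<Squnion>\<^bsub>At A q r\<^esub> X, c) \<in> \<Inter>F) = (\<forall>a \<in> X. (r, a, c) \<in> \<Inter>F)" by blast
  next
    fix r a X assume "r \<in> Ob R" "a \<in> carrier (At A q r)" "X \<subseteq> carrier (At C r s)"
    then have "\<And>J. J \<in> F \<Longrightarrow> (r, a, \<Squnion>\<^bsub>At C r s\<^esub> X) \<in> J \<longleftrightarrow> (\<forall>c \<in> X. (r, a, c) \<in> J)"
      using I sat_sup2 by simp
    then show "((r, a, \<Squnion>\<^bsub>At C r s\<^esub> X) \<in> \<Inter>F) = (\<forall>c \<in> X. (r, a, c) \<in> \<Inter>F)" by blast
  next
    fix r r' a h c assume *: "r \<in> Ob R" "r' \<in> Ob R" "a \<in> carrier (At A q r)"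
      "h \<in> carrier (Hom R r r')" "c \<in> carrier (At C r' s)"
    have "(r', ract A q r r' a h, c) \<in> J \<longleftrightarrow> (r, a, lact C r r' s h c) \<in> J" if "J \<in> F" for J
      by (rule sat_bal[OF I[OF that] *])
    then show "((r', ract A q r r' a h, c) \<in> \<Inter>F) = ((r, a, lact C r r' s h c) \<in> \<Inter>F)" by blast
  qed
qed

lemma sat_cl: "S \<subseteq> G \<Longrightarrow> sat (cl S)"
  unfolding cl_def by (rule sat_Inter) (use sat_gens in auto)

lemma cl_le_iff: "sat I \<Longrightarrow> cl S \<subseteq> I \<longleftrightarrow> S \<subseteq> I"
  unfolding cl_def by blast

lemma cl_sat: "sat I \<Longrightarrow> cl I = I"
  unfolding cl_def by blast

lemma join_eq: "tensor_join A C q s S = enc (cl S)"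
  by (simp add: tensor_join_def cl_def)

lemma dec_join: "S \<subseteq> G \<Longrightarrow> dec (tensor_join A C q s S) = cl S"
  by (simp add: join_eq dec_enc_sub sat_cl sat_sub)

lemma carrier_iff: "v \<in> carrier T \<longleftrightarrow> sat (dec v) \<and> v = enc (dec v)"
  unfolding tensor_at_def by (auto simp: dec_enc_sub sat_sub)

lemma carrier_dest: "v \<in> carrier T \<Longrightarrow> sat (dec v)"
  using carrier_iff by blast

lemma join_in: "S \<subseteq> G \<Longrightarrow> tensor_join A C q s S \<in> carrier T"
  unfolding tensor_at_def by (simp add: join_eq sat_cl)

lemma le_T: "v \<sqsubseteq>\<^bsub>T\<^esub> w \<longleftrightarrow> dec v \<subseteq> dec w"
  by (simp add: tensor_at_def)

lemma po_T: "partial_order T"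
proof
  show "(.=\<^bsub>T\<^esub>) = (=)" by (simp add: tensor_at_def)
  show "x .=\<^bsub>T\<^esub> y" if "x \<sqsubseteq>\<^bsub>T\<^esub> y" "y \<sqsubseteq>\<^bsub>T\<^esub> x" "x \<in> carrier T" "y \<in> carrier T" for x y
  proof -
    have "dec x = dec y" using that le_T by auto
    then have "x = y" using that carrier_iff by metis
    then show ?thesis by (simp add: tensor_at_def)
  qed
qed (auto simp: tensor_at_def)

lemma lub_T:
  assumes "V \<subseteq> carrier T"
  shows "least T (tensor_join A C q s (\<Union> (dec ` V))) (Upper T V)"
proof -
  have sub: "\<Union> (dec ` V) \<subseteq> G" using assms carrier_iff sat_sub by blast
  have "\<Union> (dec ` V) \<subseteq> cl (\<Union> (dec ` V))" unfolding cl_def by blast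
  then show ?thesis
    using assms sub
    by (auto simp: least_def Upper_def le_T dec_join join_in cl_le_iff carrier_dest)
qed

lemma glb_T:
  assumes "V \<subseteq> carrier T"
  shows "greatest T (enc (G \<inter> \<Inter> (dec ` V))) (Lower T V)"
proof -
  have "sat (\<Inter> (insert G (dec ` V)))"
    by (rule sat_Inter) (use assms carrier_dest sat_gens in auto)
  then have s: "sat (G \<inter> \<Inter> (dec ` V))" by simp
  then have "enc (G \<inter> \<Inter> (dec ` V)) \<in> carrier T" by (auto simp: tensor_at_def)
  moreover have "dec w \<subseteq> G" if "w \<in> carrier T" for w using that carrier_iff sat_sub by blast
  ultimately show ?thesis
    using dec_enc_sub[OF sat_sub[OF s]] assms by (auto simp: greatest_def Lower_def le_T)
qed

lemma complete_T: "complete_lattice T"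
  by (rule partial_order.complete_latticeI[OF po_T]) (use lub_T glb_T in blast)+

lemma small_T: "small (carrier T)"
proof -
  have "carrier T \<subseteq> {y. elts y \<subseteq> elts (vset (vtriple ` G))}"
    using sat_sub small_gens small_subset elts_vset
    unfolding tensor_at_def enc_def by auto (metis image_mono subsetD)
  then show ?thesis using powerset small_subset small_def by metis
qed

lemma sup_T:
  assumes V: "V \<subseteq> carrier T"
  shows "\<Squnion>\<^bsub>T\<^esub> V = tensor_join A C q s (\<Union> (dec ` V))"
proof (rule sup_eqI[OF complete_T V])
  have VG: "\<Union> (dec ` V) \<subseteq> G" using V carrier_iff sat_sub by blast
  show "tensor_join A C q s (\<Union> (dec ` V)) \<in> carrier T" by (rule join_in[OF VG])
  show "tensor_join A C q s (\<Union> (dec ` V)) \<sqsubseteq>\<^bsub>T\<^esub> v \<longleftrightarrow> (\<forall>y \<in> V. y \<sqsubseteq>\<^bsub>T\<^esub> v)"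
    if v: "v \<in> carrier T" for v
    using v carrier_dest by (simp add: le_T dec_join[OF VG] cl_le_iff UN_subset_iff)
qed

definition "el r a c = tensor_join A C q s {(r, a, c)}"

lemma el_in: "(r, a, c) \<in> G \<Longrightarrow> el r a c \<in> carrier T"
  unfolding el_def by (rule join_in) simp

lemma el_le: "(r, a, c) \<in> G \<Longrightarrow> v \<in> carrier T \<Longrightarrow> el r a c \<sqsubseteq>\<^bsub>T\<^esub> v \<longleftrightarrow> (r, a, c) \<in> dec v"
  by (simp add: el_def le_T dec_join cl_le_iff carrier_dest)

lemma el_bimap:
  assumes r: "r \<in> Ob R"
  shows "sup_bimap (At A q r) (At C r s) T (el r)"
  unfolding sup_bimap_def
proof (intro conjI ballI)
  fix a assume a: "a \<in> carrier (At A q r)"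
  have G: "(r, a, c) \<in> G" if "c \<in> carrier (At C r s)" for c using a r that by (simp add: gens_def)
  have "\<Squnion>\<^bsub>T\<^esub> (el r a ` X) = el r a (\<Squnion>\<^bsub>At C r s\<^esub> X)" if X: "X \<subseteq> carrier (At C r s)" for X
  proof (rule sup_eqI[OF complete_T])
    have X': "\<Squnion>\<^bsub>At C r s\<^esub> X \<in> carrier (At C r s)" by (rule sup_le_iff(1)[OF suplat(3)[OF r] X])
    show "el r a ` X \<subseteq> carrier T" using X G el_in by blast
    show "el r a (\<Squnion>\<^bsub>At C r s\<^esub> X) \<in> carrier T" by (rule el_in[OF G[OF X']])
    show "el r a (\<Squnion>\<^bsub>At C r s\<^esub> X) \<sqsubseteq>\<^bsub>T\<^esub> v \<longleftrightarrow> (\<forall>y \<in> el r a ` X. y \<sqsubseteq>\<^bsub>T\<^esub> v)" if v: "v \<in> carrier T" for v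
      unfolding el_le[OF G[OF X'] v] sat_sup2[OF carrier_dest[OF v] r a X] using el_le[OF G _] v X by blast
  qed
  then show "sup_map (At C r s) T (el r a)" unfolding sup_map_def using el_in[OF G] by auto
next
  fix c assume c: "c \<in> carrier (At C r s)"
  have G: "(r, a, c) \<in> G" if "a \<in> carrier (At A q r)" for a using c r that by (simp add: gens_def)
  have "\<Squnion>\<^bsub>T\<^esub> ((\<lambda>a. el r a c) ` X) = el r (\<Squnion>\<^bsub>At A q r\<^esub> X) c" if X: "X \<subseteq> carrier (At A q r)" for X
  proof (rule sup_eqI[OF complete_T])
    have X': "\<Squnion>\<^bsub>At A q r\<^esub> X \<in> carrier (At A q r)" by (rule sup_le_iff(1)[OF suplat(1)[OF r] X])
    show "(\<lambda>a. el r a c) ` X \<subseteq> carrier T" using X G el_in by blast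
    show "el r (\<Squnion>\<^bsub>At A q r\<^esub> X) c \<in> carrier T" by (rule el_in[OF G[OF X']])
    show "el r (\<Squnion>\<^bsub>At A q r\<^esub> X) c \<sqsubseteq>\<^bsub>T\<^esub> v \<longleftrightarrow> (\<forall>y \<in> (\<lambda>a. el r a c) ` X. y \<sqsubseteq>\<^bsub>T\<^esub> v)" if v: "v \<in> carrier T" for v
      unfolding el_le[OF G[OF X'] v] sat_sup1[OF carrier_dest[OF v] r X c] using el_le[OF G _] v X by blast
  qed
  then show "sup_map (At A q r) T (\<lambda>a. el r a c)" unfolding sup_map_def using el_in[OF G] by auto
qed

lemma el_balanced:
  assumes "r \<in> Ob R" "r' \<in> Ob R" "a \<in> carrier (At A q r)" "h \<in> carrier (Hom R r r')"
    "c \<in> carrier (At C r' s)"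
  shows "el r' (ract A q r r' a h) c = el r a (lact C r r' s h c)"
proof -
  have g: "(r', ract A q r r' a h, c) \<in> G" "(r, a, lact C r r' s h c) \<in> G"
    using assms ract_in lact_in by (auto simp: gens_def)
  have "sat I \<Longrightarrow> (r', ract A q r r' a h, c) \<in> I \<longleftrightarrow> (r, a, lact C r r' s h c) \<in> I" for I
    using sat_bal assms by blast
  then have "cl {(r', ract A q r r' a h, c)} = cl {(r, a, lact C r r' s h c)}"
    unfolding cl_def by (intro arg_cong[of _ _ Inter]) auto
  then show ?thesis by (simp add: el_def join_eq)
qed

lemma sup_el:
  assumes "v \<in> carrier T"
  shows "\<Squnion>\<^bsub>T\<^esub> {el r a c | r a c. (r, a, c) \<in> dec v} = v"
proof -
  have d: "dec v \<subseteq> G" using assms carrier_iff sat_sub by blast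
  show ?thesis
  proof (rule sup_eqI[OF complete_T _ assms])
    show "{el r a c | r a c. (r, a, c) \<in> dec v} \<subseteq> carrier T" using d el_in by blast
    show "v \<sqsubseteq>\<^bsub>T\<^esub> w \<longleftrightarrow> (\<forall>y \<in> {el r a c | r a c. (r, a, c) \<in> dec v}. y \<sqsubseteq>\<^bsub>T\<^esub> w)"
      if w: "w \<in> carrier T" for w
    proof -
      have "(\<forall>y \<in> {el r a c | r a c. (r, a, c) \<in> dec v}. y \<sqsubseteq>\<^bsub>T\<^esub> w)
          \<longleftrightarrow> (\<forall>r a c. (r, a, c) \<in> dec v \<longrightarrow> el r a c \<sqsubseteq>\<^bsub>T\<^esub> w)" by blast
      also have "\<dots> \<longleftrightarrow> (\<forall>r a c. (r, a, c) \<in> dec v \<longrightarrow> (r, a, c) \<in> dec w)"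
        using d el_le w by (meson subsetD)
      also have "\<dots> \<longleftrightarrow> v \<sqsubseteq>\<^bsub>T\<^esub> w" by (auto simp: le_T)
      finally show ?thesis by simp
    qed
  qed
qed

lemma universal:
  assumes M: "complete_lattice M"
    and bi: "\<And>r. r \<in> Ob R \<Longrightarrow> sup_bimap (At A q r) (At C r s) M (\<beta> r)"
    and bal: "\<And>r r' a h c. \<lbrakk>r \<in> Ob R; r' \<in> Ob R; a \<in> carrier (At A q r); h \<in> carrier (Hom R r r');
      c \<in> carrier (At C r' s)\<rbrakk> \<Longrightarrow> \<beta> r' (ract A q r r' a h) c = \<beta> r a (lact C r r' s h c)"
  shows "\<exists>g. sup_map T M g \<and> (\<forall>(r, a, c) \<in> G. g (el r a c) = \<beta> r a c)"
    and "\<lbrakk>sup_map T M g; sup_map T M g'; \<forall>(r, a, c) \<in> G. g (el r a c) = g' (el r a c); v \<in> carrier T\<rbrakk>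
      \<Longrightarrow> g v = g' v"
proof -
  have \<beta>_in: "\<beta> r a c \<in> carrier M" if "(r, a, c) \<in> G" for r a c
    using that bi by (auto simp: gens_def sup_bimap_def sup_map_def)
  define I where "I m = {(r, a, c) \<in> G. \<beta> r a c \<sqsubseteq>\<^bsub>M\<^esub> m}" for m
  have I: "sat (I m)" if m: "m \<in> carrier M" for m
    unfolding saturated_def Let_def
  proof (intro conjI ballI allI impI)
    show "I m \<subseteq> G" by (auto simp: I_def)
  next
    fix r X c assume r: "r \<in> Ob R" and X: "X \<subseteq> carrier (At A q r)" and c: "c \<in> carrier (At C r s)"
    have "\<beta> r (\<Squnion>\<^bsub>At A q r\<^esub> X) c = \<Squnion>\<^bsub>M\<^esub> ((\<lambda>a. \<beta> r a c) ` X)"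
      using bi[OF r] c X by (auto simp: sup_bimap_def sup_map_def)
    moreover have "(\<lambda>a. \<beta> r a c) ` X \<subseteq> carrier M"
      using r X c \<beta>_in by (auto simp: gens_def)
    moreover have "\<Squnion>\<^bsub>At A q r\<^esub> X \<in> carrier (At A q r)" using X r suplat sup_le_iff(1) by blast
    ultimately show "((r, \<Squnion>\<^bsub>At A q r\<^esub> X, c) \<in> I m) = (\<forall>a \<in> X. (r, a, c) \<in> I m)"
      using r X c m sup_le_iff(2)[OF M] by (auto simp: I_def gens_def)
  next
    fix r a X assume r: "r \<in> Ob R" and a: "a \<in> carrier (At A q r)" and X: "X \<subseteq> carrier (At C r s)"
    have "\<beta> r a (\<Squnion>\<^bsub>At C r s\<^esub> X) = \<Squnion>\<^bsub>M\<^esub> (\<beta> r a ` X)"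
      using bi[OF r] a X by (auto simp: sup_bimap_def sup_map_def)
    moreover have "\<beta> r a ` X \<subseteq> carrier M"
      using r X a \<beta>_in by (auto simp: gens_def)
    moreover have "\<Squnion>\<^bsub>At C r s\<^esub> X \<in> carrier (At C r s)" using X r suplat sup_le_iff(1) by blast
    ultimately show "((r, a, \<Squnion>\<^bsub>At C r s\<^esub> X) \<in> I m) = (\<forall>c \<in> X. (r, a, c) \<in> I m)"
      using r X a m sup_le_iff(2)[OF M] by (auto simp: I_def gens_def)
  next
    fix r r' a h c assume *: "r \<in> Ob R" "r' \<in> Ob R" "a \<in> carrier (At A q r)"
      "h \<in> carrier (Hom R r r')" "c \<in> carrier (At C r' s)"
    then show "((r', ract A q r r' a h, c) \<in> I m) = ((r, a, lact C r r' s h c) \<in> I m)"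
      using bal[OF *] ract_in lact_in by (auto simp: I_def gens_def)
  qed
  define g where "g v = \<Squnion>\<^bsub>M\<^esub> {\<beta> r a c | r a c. (r, a, c) \<in> dec v}" for v
  have sub: "{\<beta> r a c | r a c. (r, a, c) \<in> dec v} \<subseteq> carrier M" if "v \<in> carrier T" for v
    using that \<beta>_in carrier_iff sat_sub by blast
  have g_in: "g v \<in> carrier M" if "v \<in> carrier T" for v
    unfolding g_def using sub[OF that] sup_le_iff(1)[OF M] by blast
  have g_le: "g v \<sqsubseteq>\<^bsub>M\<^esub> m \<longleftrightarrow> dec v \<subseteq> I m" if "v \<in> carrier T" "m \<in> carrier M" for v m
    unfolding g_def sup_le_iff(2)[OF M sub[OF that(1)] that(2)]
    using that(1) carrier_iff sat_sub by (force simp: I_def)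
  have "sup_map T M g"
    unfolding sup_map_def
  proof (intro conjI allI impI)
    show "g \<in> carrier T \<rightarrow> carrier M" using g_in by blast
    fix V assume V: "V \<subseteq> carrier T"
    then have VG: "\<Union> (dec ` V) \<subseteq> G" using carrier_iff sat_sub by blast
    show "g (\<Squnion>\<^bsub>T\<^esub> V) = \<Squnion>\<^bsub>M\<^esub> (g ` V)"
    proof (rule sym, rule sup_eqI[OF M])
      show "g ` V \<subseteq> carrier M" using V g_in by blast
      show "g (\<Squnion>\<^bsub>T\<^esub> V) \<in> carrier M" using V VG g_in by (simp add: sup_T join_in)
      show "g (\<Squnion>\<^bsub>T\<^esub> V) \<sqsubseteq>\<^bsub>M\<^esub> m \<longleftrightarrow> (\<forall>y \<in> g ` V. y \<sqsubseteq>\<^bsub>M\<^esub> m)" if m: "m \<in> carrier M" for m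
      proof -
        have "g (\<Squnion>\<^bsub>T\<^esub> V) \<sqsubseteq>\<^bsub>M\<^esub> m \<longleftrightarrow> \<Union> (dec ` V) \<subseteq> I m"
          using V VG m by (simp add: sup_T g_le join_in dec_join cl_le_iff I)
        also have "\<dots> \<longleftrightarrow> (\<forall>y \<in> g ` V. y \<sqsubseteq>\<^bsub>M\<^esub> m)"
          using V g_le m unfolding UN_subset_iff ball_simps by (intro ball_cong) auto
        finally show ?thesis .
      qed
    qed
  qed
  moreover have "g (el r a c) = \<beta> r a c" if t: "(r, a, c) \<in> G" for r a c
  proof -
    interpret M: complete_lattice M by (rule M)
    have "g (el r a c) \<sqsubseteq>\<^bsub>M\<^esub> m \<longleftrightarrow> \<beta> r a c \<sqsubseteq>\<^bsub>M\<^esub> m" if m: "m \<in> carrier M" for m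
    proof -
      have "g (el r a c) \<sqsubseteq>\<^bsub>M\<^esub> m \<longleftrightarrow> cl {(r, a, c)} \<subseteq> I m"
        using g_le[OF el_in[OF t] m] t by (simp add: el_def dec_join)
      also have "\<dots> \<longleftrightarrow> (r, a, c) \<in> I m" by (simp add: cl_le_iff I[OF m])
      also have "\<dots> \<longleftrightarrow> \<beta> r a c \<sqsubseteq>\<^bsub>M\<^esub> m" using t by (simp add: I_def)
      finally show ?thesis .
    qed
    note * = this[OF g_in[OF el_in[OF t]]] this[OF \<beta>_in[OF t]]
    show ?thesis
      using * M.le_refl g_in[OF el_in[OF t]] \<beta>_in[OF t] by (intro M.le_antisym) simp_all
  qed
  ultimately show "\<exists>g. sup_map T M g \<and> (\<forall>(r, a, c) \<in> G. g (el r a c) = \<beta> r a c)" by blast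
next
  assume g: "sup_map T M g" and g': "sup_map T M g'"
    and eq: "\<forall>(r, a, c) \<in> G. g (el r a c) = g' (el r a c)" and v: "v \<in> carrier T"
  let ?E = "{el r a c | r a c. (r, a, c) \<in> dec v}"
  have d: "dec v \<subseteq> G" using v carrier_iff sat_sub by blast
  then have E: "?E \<subseteq> carrier T" using el_in by blast
  have *: "g ` ?E = g' ` ?E" using eq d by (intro image_cong) auto
  have "h (\<Squnion>\<^bsub>T\<^esub> ?E) = \<Squnion>\<^bsub>M\<^esub> (h ` ?E)" if "sup_map T M h" for h
    using conjunct2[OF that[unfolded sup_map_def], rule_format, OF E] .
  from this[OF g] this[OF g'] have "g (\<Squnion>\<^bsub>T\<^esub> ?E) = g' (\<Squnion>\<^bsub>T\<^esub> ?E)" using * by simp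
  then show "g v = g' v" using sup_el[OF v] by simp
qed

end

end

theory Submission
  imports Defs
begin

text \<open>
  For a module \<open>A\<close> let \<open>A*(r, q)\<close> be the suplattice \<open>A(q, r)\<close> with the opposite order, on which the
  quantaloids act by the residuals of their actions on \<open>A\<close>; then \<open>A** = A\<close> up to the identity on
  elements.  The dualizing 1-cells are \<open>Q(-, -)*\<close>.  A 2-cell \<open>f : A \<otimes> C \<rightarrow> Q(-, -)*\<close> is determined
  by the relation \<open>\<top>\<^sub>q \<le> f(a \<otimes> c)\<close>, since \<open>g \<le> f(a \<otimes> c)\<close> iff \<open>\<top>\<^sub>q \<le> f((g \<star> a) \<otimes> c)\<close>; the same
  relation, read as \<open>a \<le> \<phi>(c)\<close>, is a 2-cell \<open>\<phi> : C \<rightarrow> A*\<close>.  So \<open>A*\<close> is a right extension of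
  \<open>Q(-, -)*\<close> along \<open>A\<close>, and all other right extensions and liftings are \<open>(D* \<otimes> A)*\<close> and
  \<open>(A \<otimes> D*)*\<close>.
\<close>


section \<open>Suplattices\<close>

text \<open>Only right extensions into the dualizing 1-cells are built by hand. The passage to right
  liftings is formal: dualising a 2-cell \<open>C \<rightarrow> dual A\<close> and composing with
  the map from \<open>A\<close> to its double dual gives a 2-cell
  \<open>A \<rightarrow> dual C\<close>, and this is a bijection because the double-dual map is
  natural and satisfies a triangle identity. Hence the same 1-cell \<open>dual A\<close> serves on
  both sides. That is the origin of cyclicity: extensions and liftings into the dualizing 1-cells
  can be chosen literally equal, \<open>\<theta>\<close> can be the identity, and the cyclic
  equation says only that the two canonical 2-cells from \<open>A\<close> to its double dual
  coincide. On the concrete side the obstacle is that composites consist of coded closed sets of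
  triples. Structure maps are therefore rewritten as sup-maps induced by balanced bimaps, and
  equations are tested on elementary tensors. Equations between residuals are proved by comparing
  lower bounds, which turns each law of a dual module into a law of the module itself.\<close>

lemma complete_lattice_eqI_below:
  assumes "complete_lattice L" "x \<in> carrier L" "y \<in> carrier L"
    and "\<And>m. m \<in> carrier L \<Longrightarrow> m \<sqsubseteq>\<^bsub>L\<^esub> x \<longleftrightarrow> m \<sqsubseteq>\<^bsub>L\<^esub> y"
  shows "x = y"
proof -
  interpret complete_lattice L by fact
  show ?thesis using assms(4)[OF assms(2)] assms(4)[OF assms(3)] assms(2,3) by (auto intro: le_antisym)
qed

lemma complete_lattice_eqI_above:
  assumes "complete_lattice L" "x \<in> carrier L" "y \<in> carrier L"
    and "\<And>m. m \<in> carrier L \<Longrightarrow> x \<sqsubseteq>\<^bsub>L\<^esub> m \<longleftrightarrow> y \<sqsubseteq>\<^bsub>L\<^esub> m"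
  shows "x = y"
proof -
  interpret complete_lattice L by fact
  show ?thesis using assms(4)[OF assms(2)] assms(4)[OF assms(3)] assms(2,3) by (auto intro: le_antisym)
qed

lemma complete_lattice_refl: "complete_lattice L \<Longrightarrow> x \<in> carrier L \<Longrightarrow> x \<sqsubseteq>\<^bsub>L\<^esub> x"
  by (simp add: complete_lattice_def partial_order_def weak_partial_order.le_refl)

lemma complete_lattice_trans:
  "\<lbrakk>complete_lattice L; x \<sqsubseteq>\<^bsub>L\<^esub> y; y \<sqsubseteq>\<^bsub>L\<^esub> z; x \<in> carrier L; y \<in> carrier L; z \<in> carrier L\<rbrakk> \<Longrightarrow> x \<sqsubseteq>\<^bsub>L\<^esub> z"
  by (meson complete_lattice_def partial_order_def weak_partial_order.le_trans)

text \<open>Testing against upper bounds replaces the computation of the supremum of the image; for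
  maps given by adjunctions the condition becomes a chain of equivalences.\<close>

lemma sup_mapI:
  assumes L: "complete_lattice L" and M: "complete_lattice M"
    and f: "\<And>a. a \<in> carrier L \<Longrightarrow> f a \<in> carrier M"
    and le: "\<And>S m. \<lbrakk>S \<subseteq> carrier L; m \<in> carrier M\<rbrakk> \<Longrightarrow> f (\<Squnion>\<^bsub>L\<^esub> S) \<sqsubseteq>\<^bsub>M\<^esub> m \<longleftrightarrow> (\<forall>x \<in> S. f x \<sqsubseteq>\<^bsub>M\<^esub> m)"
  shows "sup_map L M f"
  unfolding sup_map_def
proof (intro conjI allI impI)
  show "f \<in> carrier L \<rightarrow> carrier M" using f by blast
  show "f (\<Squnion>\<^bsub>L\<^esub> S) = \<Squnion>\<^bsub>M\<^esub> (f ` S)" if S: "S \<subseteq> carrier L" for S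
    by (rule sup_eqI[OF M, symmetric]) (use S f le[OF S] sup_le_iff(1)[OF L S] in auto)
qed

lemma sup_map_in: "sup_map L M f \<Longrightarrow> a \<in> carrier L \<Longrightarrow> f a \<in> carrier M"
  by (auto simp: sup_map_def)

lemma sup_map_image: "sup_map L M f \<Longrightarrow> S \<subseteq> carrier L \<Longrightarrow> f ` S \<subseteq> carrier M"
  by (auto simp: sup_map_def)

lemma sup_map_Sup: "sup_map L M f \<Longrightarrow> S \<subseteq> carrier L \<Longrightarrow> f (\<Squnion>\<^bsub>L\<^esub> S) = \<Squnion>\<^bsub>M\<^esub> (f ` S)"
  by (simp add: sup_map_def)

lemma sup_map_le_iff:
  assumes "complete_lattice M" "sup_map L M f" "S \<subseteq> carrier L" "m \<in> carrier M"
  shows "f (\<Squnion>\<^bsub>L\<^esub> S) \<sqsubseteq>\<^bsub>M\<^esub> m \<longleftrightarrow> (\<forall>x \<in> S. f x \<sqsubseteq>\<^bsub>M\<^esub> m)"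
proof -
  show ?thesis
    using sup_le_iff(2)[OF assms(1) sup_map_image[OF assms(2,3)] assms(4)]
      by (simp add: sup_map_Sup[OF assms(2,3)])
qed

lemma sup_map_id: "complete_lattice L \<Longrightarrow> sup_map L L (\<lambda>a. a)"
  by (rule sup_mapI) (simp_all add: sup_le_iff)

lemma sup_map_comp:
  assumes f: "sup_map L M f" and g: "sup_map M N g"
  shows "sup_map L N (\<lambda>a. g (f a))"
  unfolding sup_map_def
proof (intro conjI allI impI)
  show "(\<lambda>a. g (f a)) \<in> carrier L \<rightarrow> carrier N" using f g by (auto simp: sup_map_def)
  fix S assume S: "S \<subseteq> carrier L"
  show "g (f (\<Squnion>\<^bsub>L\<^esub> S)) = \<Squnion>\<^bsub>N\<^esub> ((\<lambda>a. g (f a)) ` S)"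
    by (simp add: sup_map_Sup[OF f S] sup_map_Sup[OF g sup_map_image[OF f S]] image_image)
qed

text \<open>Completeness keeps suprema inside the carrier, where the two functions agree. This
  permits exchanging the truncated maps produced by \<open>extend_hom\<close>, and the formulas of
  the definitions, for more convenient ones.\<close>

lemma sup_map_cong:
  assumes L: "complete_lattice L" and eq: "\<And>a. a \<in> carrier L \<Longrightarrow> f a = g a"
  shows "sup_map L M f \<longleftrightarrow> sup_map L M g"
proof -
  have "f ` S = g ` S" "f (\<Squnion>\<^bsub>L\<^esub> S) = g (\<Squnion>\<^bsub>L\<^esub> S)" if "S \<subseteq> carrier L" for S
    using that eq sup_le_iff(1)[OF L that] by (auto intro!: image_cong)
  then show ?thesis using eq by (auto simp: sup_map_def Pi_iff)
qed

lemma sup_bimap_in: "sup_bimap L L' M f \<Longrightarrow> a \<in> carrier L \<Longrightarrow> b \<in> carrier L' \<Longrightarrow> f a b \<in> carrier M"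
  by (auto simp: sup_bimap_def sup_map_def)

lemma sup_bimap1: "sup_bimap L L' M f \<Longrightarrow> b \<in> carrier L' \<Longrightarrow> sup_map L M (\<lambda>a. f a b)"
  by (simp add: sup_bimap_def)

lemma sup_bimap2: "sup_bimap L L' M f \<Longrightarrow> a \<in> carrier L \<Longrightarrow> sup_map L' M (f a)"
  by (simp add: sup_bimap_def)

lemma sup_bimap_flip: "sup_bimap L L' M f \<Longrightarrow> sup_bimap L' L M (\<lambda>b a. f a b)"
  by (simp add: sup_bimap_def)

lemma sup_bimap_comp:
  "sup_map K L f \<Longrightarrow> sup_map K' L' f' \<Longrightarrow> sup_bimap L L' M g \<Longrightarrow> sup_bimap K K' M (\<lambda>a b. g (f a) (f' b))"
  unfolding sup_bimap_def
proof (intro conjI ballI)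
  assume f: "sup_map K L f" and f': "sup_map K' L' f'"
    and g: "(\<forall>a \<in> carrier L. sup_map L' M (g a)) \<and> (\<forall>b \<in> carrier L'. sup_map L M (\<lambda>a. g a b))"
  show "sup_map K' M (\<lambda>b. g (f a) (f' b))" if "a \<in> carrier K" for a
    using sup_map_comp[OF f'] g sup_map_in[OF f that] by blast
  show "sup_map K M (\<lambda>a. g (f a) (f' b))" if "b \<in> carrier K'" for b
    using sup_map_comp[OF f] g sup_map_in[OF f' that] by blast
qed


subsection \<open>Opposites and adjoints\<close>

text \<open>A constant of its own keeps the reversed order folded in goals. Since reversing twice
  gives back the same record, a double dual has literally the lattices of the original
  module.\<close>

definition opposite :: "'u gorder \<Rightarrow> 'u gorder" where
  "opposite L = inv_gorder L"

lemma opposite_simps [simp]: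
  "carrier (opposite L) = carrier L" "x \<sqsubseteq>\<^bsub>opposite L\<^esub> y \<longleftrightarrow> y \<sqsubseteq>\<^bsub>L\<^esub> x" "opposite (opposite L) = L"
  by (simp_all add: opposite_def)

lemma complete_lattice_opposite:
  assumes "complete_lattice L"
  shows "complete_lattice (opposite L)"
proof -
  interpret complete_lattice L by fact
  show ?thesis
    unfolding opposite_def
    by (rule partial_order.complete_latticeI[OF dual_order]) (simp_all add: inf_exists sup_exists)
qed

text \<open>The formula of the adjoint functor theorem for suplattices. All residuals below, and the
  duals of 2-cells, are instances.\<close>

definition right_adjoint :: "'u gorder \<Rightarrow> 'u gorder \<Rightarrow> ('u \<Rightarrow> 'u) \<Rightarrow> 'u \<Rightarrow> 'u" where
  "right_adjoint L M f b = \<Squnion>\<^bsub>L\<^esub> {a \<in> carrier L. f a \<sqsubseteq>\<^bsub>M\<^esub> b}"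

lemma right_adjoint_in: "complete_lattice L \<Longrightarrow> right_adjoint L M f b \<in> carrier L"
  unfolding right_adjoint_def by (rule sup_le_iff(1)) auto

lemma le_right_adjoint_iff:
  assumes L: "complete_lattice L" and M: "complete_lattice M" and f: "sup_map L M f"
    and a: "a \<in> carrier L" and b: "b \<in> carrier M"
  shows "a \<sqsubseteq>\<^bsub>L\<^esub> right_adjoint L M f b \<longleftrightarrow> f a \<sqsubseteq>\<^bsub>M\<^esub> b"
proof
  let ?S = "{a \<in> carrier L. f a \<sqsubseteq>\<^bsub>M\<^esub> b}" and ?r = "right_adjoint L M f b"
  have r: "?r \<in> carrier L" by (rule right_adjoint_in[OF L])
  have S: "?S \<subseteq> carrier L" by blast
  show "a \<sqsubseteq>\<^bsub>L\<^esub> ?r" if "f a \<sqsubseteq>\<^bsub>M\<^esub> b"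
    using sup_le_iff(2)[OF L S r] complete_lattice_refl[OF L r] that a
    unfolding right_adjoint_def by blast
  assume le: "a \<sqsubseteq>\<^bsub>L\<^esub> ?r"
  \<comment> \<open>Monotonicity of \<open>f\<close> is not part of \<open>sup_map\<close>; it is
    read off from the supremum of the comparable pair \<open>a\<close>, \<open>?r\<close>.\<close>
  have "\<Squnion>\<^bsub>L\<^esub> {a, ?r} = ?r"
    by (rule sup_eqI[OF L]) (use a r le complete_lattice_trans[OF L le] in auto)
  then have "f ?r \<sqsubseteq>\<^bsub>M\<^esub> f ?r \<longleftrightarrow> (\<forall>x \<in> {a, ?r}. f x \<sqsubseteq>\<^bsub>M\<^esub> f ?r)"
    using sup_map_le_iff[OF M f, of "{a, ?r}" "f ?r"] a r sup_map_in[OF f r] by auto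
  then have "f a \<sqsubseteq>\<^bsub>M\<^esub> f ?r" using complete_lattice_refl[OF M sup_map_in[OF f r]] by simp
  moreover have "f ?r \<sqsubseteq>\<^bsub>M\<^esub> b"
    using sup_map_le_iff[OF M f S b] by (simp add: right_adjoint_def)
  ultimately show "f a \<sqsubseteq>\<^bsub>M\<^esub> b"
    using complete_lattice_trans[OF M, of "f a" "f ?r" b] a r b sup_map_in[OF f] by blast
qed

text \<open>Residuation turns suprema in \<open>a\<close> and infima in the other argument into
  infima, which are suprema in the reversed order. One statement thus covers both actions on a dual,
  the evaluation and the transposes into a dual.\<close>

lemma sup_bimap_right_adjoint:
  assumes L: "complete_lattice L" and L': "complete_lattice L'" and M: "complete_lattice M"
    and f: "sup_bimap L L' M f"
  shows "sup_bimap L (opposite M) (opposite L') (\<lambda>a. right_adjoint L' M (f a))"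
  unfolding sup_bimap_def
proof (intro conjI ballI)
  note f2 = sup_bimap2[OF f] and f1 = sup_bimap1[OF f]
  note iff = le_right_adjoint_iff[OF L' M f2]
  show "sup_map (opposite M) (opposite L') (right_adjoint L' M (f a))" if a: "a \<in> carrier L" for a
  proof (rule sup_mapI)
    fix S m assume S: "S \<subseteq> carrier (opposite M)" and m: "m \<in> carrier (opposite L')"
    have "\<Squnion>\<^bsub>opposite M\<^esub> S \<in> carrier M"
      using sup_le_iff(1)[OF complete_lattice_opposite[OF M] S] by simp
    then show "right_adjoint L' M (f a) (\<Squnion>\<^bsub>opposite M\<^esub> S) \<sqsubseteq>\<^bsub>opposite L'\<^esub> m \<longleftrightarrow>
        (\<forall>x \<in> S. right_adjoint L' M (f a) x \<sqsubseteq>\<^bsub>opposite L'\<^esub> m)"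
      using S m iff[OF a] sup_le_iff(2)[OF complete_lattice_opposite[OF M] S, of
        "f a m"] sup_map_in[OF f2[OF a]]
      by (simp add: subset_iff)
  qed (simp_all add: L' M complete_lattice_opposite right_adjoint_in)
  show "sup_map L (opposite L') (\<lambda>a. right_adjoint L' M (f a) b)" if b: "b \<in> carrier (opposite M)" for b
  proof (rule sup_mapI)
    fix S m assume S: "S \<subseteq> carrier L" and m: "m \<in> carrier (opposite L')"
    show "right_adjoint L' M (f (\<Squnion>\<^bsub>L\<^esub> S)) b \<sqsubseteq>\<^bsub>opposite L'\<^esub> m \<longleftrightarrow>
        (\<forall>x \<in> S. right_adjoint L' M (f x) b \<sqsubseteq>\<^bsub>opposite L'\<^esub> m)"
      using S m b iff sup_map_le_iff[OF M f1[of m] S] sup_le_iff(1)[OF L S] by (simp add: subset_iff)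
  qed (simp_all add: L L' complete_lattice_opposite right_adjoint_in)
qed

lemma sup_map_right_adjoint:
  assumes L: "complete_lattice L" and M: "complete_lattice M" and f: "sup_map L M f"
  shows "sup_map (opposite M) (opposite L) (right_adjoint L M f)"
proof (rule sup_mapI)
  fix S m assume S: "S \<subseteq> carrier (opposite M)" and m: "m \<in> carrier (opposite L)"
  have "\<Squnion>\<^bsub>opposite M\<^esub> S \<in> carrier M"
    using sup_le_iff(1)[OF complete_lattice_opposite[OF M] S] by simp
  then show "right_adjoint L M f (\<Squnion>\<^bsub>opposite M\<^esub> S) \<sqsubseteq>\<^bsub>opposite L\<^esub> m \<longleftrightarrow>
      (\<forall>x \<in> S. right_adjoint L M f x \<sqsubseteq>\<^bsub>opposite L\<^esub> m)"
    using S m le_right_adjoint_iff[OF L M f] sup_le_iff(2)[OF complete_lattice_opposite[OF M] S, of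
      "f m"] sup_map_in[OF f]
    by (simp add: subset_iff)
qed (simp_all add: L M complete_lattice_opposite right_adjoint_in)

lemma right_adjoint_eqI:
  assumes L: "complete_lattice L" and M: "complete_lattice M" and f: "sup_map L M f"
    and b: "b \<in> carrier M" and x: "x \<in> carrier L"
    and iff: "\<And>a. a \<in> carrier L \<Longrightarrow> a \<sqsubseteq>\<^bsub>L\<^esub> x \<longleftrightarrow> f a \<sqsubseteq>\<^bsub>M\<^esub> b"
  shows "right_adjoint L M f b = x"
  by (rule complete_lattice_eqI_below[OF L])
    (simp_all add: right_adjoint_in L x iff le_right_adjoint_iff[OF L M f _ b])

text \<open>\<open>f\<close> is left adjoint to its right adjoint, and reversing the orders
  exchanges left and right. This is why double duals give back the actions and the 2-cells.\<close>

lemma right_adjoint_right_adjoint: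
  assumes L: "complete_lattice L" and M: "complete_lattice M" and f: "sup_map L M f"
    and a: "a \<in> carrier L"
  shows "right_adjoint (opposite M) (opposite L) (right_adjoint L M f) a = f a"
  by (rule right_adjoint_eqI)
    (use le_right_adjoint_iff[OF L M f a] sup_map_in[OF f a] a in
      \<open>simp_all add: L M f complete_lattice_opposite sup_map_right_adjoint\<close>)


context set_universe
begin

section \<open>Modules and homomorphisms\<close>

lemma quantaloid_facts:
  assumes "small_quantaloid Q"
  shows hom_lattice: "p \<in> Ob Q \<Longrightarrow> q \<in> Ob Q \<Longrightarrow> complete_lattice (Hom Q p q)"
    and hom_small: "p \<in> Ob Q \<Longrightarrow> q \<in> Ob Q \<Longrightarrow> small (carrier (Hom Q p q))"
    and qcomp_bimap: "\<lbrakk>p \<in> Ob Q; q \<in> Ob Q; r \<in> Ob Q\<rbrakk>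
      \<Longrightarrow> sup_bimap (Hom Q p q) (Hom Q q r) (Hom Q p r) (qcomp Q p q r)"
    and qid_in: "q \<in> Ob Q \<Longrightarrow> qid Q q \<in> carrier (Hom Q q q)"
    and qcomp_qid_left: "\<lbrakk>p \<in> Ob Q; q \<in> Ob Q; f \<in> carrier (Hom Q p q)\<rbrakk> \<Longrightarrow> qcomp Q p p q (qid Q p) f = f"
    and qcomp_qid_right: "\<lbrakk>p \<in> Ob Q; q \<in> Ob Q; f \<in> carrier (Hom Q p q)\<rbrakk> \<Longrightarrow> qcomp Q p q q f (qid Q q) = f"
    and qcomp_assoc: "\<lbrakk>p \<in> Ob Q; q \<in> Ob Q; r \<in> Ob Q; s \<in> Ob Q; f \<in> carrier (Hom Q p q);
        g \<in> carrier (Hom Q q r); h \<in> carrier (Hom Q r s)\<rbrakk>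
      \<Longrightarrow> qcomp Q p r s (qcomp Q p q r f g) h = qcomp Q p q s f (qcomp Q q r s g h)"
  using assms by (auto simp: small_quantaloid_def small_suplattice_def)

lemma qcomp_in:
  "\<lbrakk>small_quantaloid Q; p \<in> Ob Q; q \<in> Ob Q; r \<in> Ob Q; f \<in> carrier (Hom Q p q); g \<in> carrier (Hom Q q r)\<rbrakk>
    \<Longrightarrow> qcomp Q p q r f g \<in> carrier (Hom Q p r)"
  by (rule sup_bimap_in[OF qcomp_bimap])

lemma module_facts:
  assumes "is_module A" "Src A = Q" "Trg A = R"
  shows module_Src: "small_quantaloid Q" and module_Trg: "small_quantaloid R"
    and at_lattice: "q \<in> Ob Q \<Longrightarrow> r \<in> Ob R \<Longrightarrow> complete_lattice (At A q r)"
    and at_small: "q \<in> Ob Q \<Longrightarrow> r \<in> Ob R \<Longrightarrow> small (carrier (At A q r))"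
    and lact_bimap: "\<lbrakk>q \<in> Ob Q; q' \<in> Ob Q; r \<in> Ob R\<rbrakk>
      \<Longrightarrow> sup_bimap (Hom Q q q') (At A q' r) (At A q r) (lact A q q' r)"
    and ract_bimap: "\<lbrakk>q \<in> Ob Q; r \<in> Ob R; r' \<in> Ob R\<rbrakk>
      \<Longrightarrow> sup_bimap (At A q r) (Hom R r r') (At A q r') (ract A q r r')"
    and lact_qid: "\<lbrakk>q \<in> Ob Q; r \<in> Ob R; a \<in> carrier (At A q r)\<rbrakk> \<Longrightarrow> lact A q q r (qid Q q) a = a"
    and ract_qid: "\<lbrakk>q \<in> Ob Q; r \<in> Ob R; a \<in> carrier (At A q r)\<rbrakk> \<Longrightarrow> ract A q r r a (qid R r) = a"
    and lact_qcomp: "\<lbrakk>q \<in> Ob Q; q' \<in> Ob Q; q'' \<in> Ob Q; r \<in> Ob R; f \<in> carrier (Hom Q q q');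
        g \<in> carrier (Hom Q q' q''); a \<in> carrier (At A q'' r)\<rbrakk>
      \<Longrightarrow> lact A q q'' r (qcomp Q q q' q'' f g) a = lact A q q' r f (lact A q' q'' r g a)"
    and ract_qcomp: "\<lbrakk>q \<in> Ob Q; r \<in> Ob R; r' \<in> Ob R; r'' \<in> Ob R; a \<in> carrier (At A q r);
        h \<in> carrier (Hom R r r'); k \<in> carrier (Hom R r' r'')\<rbrakk>
      \<Longrightarrow> ract A q r r'' a (qcomp R r r' r'' h k) = ract A q r' r'' (ract A q r r' a h) k"
    and ract_lact: "\<lbrakk>q \<in> Ob Q; q' \<in> Ob Q; r \<in> Ob R; r' \<in> Ob R; f \<in> carrier (Hom Q q q');
        a \<in> carrier (At A q' r); h \<in> carrier (Hom R r r')\<rbrakk>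
      \<Longrightarrow> ract A q r r' (lact A q q' r f a) h = lact A q q' r' f (ract A q' r r' a h)"
  using assms by (auto simp: is_module_def Let_def small_suplattice_def)

lemma lact_in:
  "\<lbrakk>is_module A; Src A = Q; Trg A = R; q \<in> Ob Q; q' \<in> Ob Q; r \<in> Ob R; f \<in> carrier (Hom Q q q');
    a \<in> carrier (At A q' r)\<rbrakk> \<Longrightarrow> lact A q q' r f a \<in> carrier (At A q r)"
  by (rule sup_bimap_in[OF lact_bimap])

lemma ract_in:
  "\<lbrakk>is_module A; Src A = Q; Trg A = R; q \<in> Ob Q; r \<in> Ob R; r' \<in> Ob R; a \<in> carrier (At A q r);
    h \<in> carrier (Hom R r r')\<rbrakk> \<Longrightarrow> ract A q r r' a h \<in> carrier (At A q r')"
  by (rule sup_bimap_in[OF ract_bimap])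

lemma is_moduleI:
  assumes "small_quantaloid Q" "small_quantaloid R" "Src A = Q" "Trg A = R"
    and "\<And>q r. \<lbrakk>q \<in> Ob Q; r \<in> Ob R\<rbrakk> \<Longrightarrow> complete_lattice (At A q r)"
    and "\<And>q r. \<lbrakk>q \<in> Ob Q; r \<in> Ob R\<rbrakk> \<Longrightarrow> small (carrier (At A q r))"
    and "\<And>q q' r. \<lbrakk>q \<in> Ob Q; q' \<in> Ob Q; r \<in> Ob R\<rbrakk>
      \<Longrightarrow> sup_bimap (Hom Q q q') (At A q' r) (At A q r) (lact A q q' r)"
    and "\<And>q r r'. \<lbrakk>q \<in> Ob Q; r \<in> Ob R; r' \<in> Ob R\<rbrakk>
      \<Longrightarrow> sup_bimap (At A q r) (Hom R r r') (At A q r') (ract A q r r')"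
    and "\<And>q r a. \<lbrakk>q \<in> Ob Q; r \<in> Ob R; a \<in> carrier (At A q r)\<rbrakk> \<Longrightarrow> lact A q q r (qid Q q) a = a"
    and "\<And>q r a. \<lbrakk>q \<in> Ob Q; r \<in> Ob R; a \<in> carrier (At A q r)\<rbrakk> \<Longrightarrow> ract A q r r a (qid R r) = a"
    and "\<And>q q' q'' r f g a. \<lbrakk>q \<in> Ob Q; q' \<in> Ob Q; q'' \<in> Ob Q; r \<in> Ob R; f \<in> carrier (Hom Q q q');
        g \<in> carrier (Hom Q q' q''); a \<in> carrier (At A q'' r)\<rbrakk>
      \<Longrightarrow> lact A q q'' r (qcomp Q q q' q'' f g) a = lact A q q' r f (lact A q' q'' r g a)"
    and "\<And>q r r' r'' a h k. \<lbrakk>q \<in> Ob Q; r \<in> Ob R; r' \<in> Ob R; r'' \<in> Ob R; a \<in> carrier (At A q r);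
        h \<in> carrier (Hom R r r'); k \<in> carrier (Hom R r' r'')\<rbrakk>
      \<Longrightarrow> ract A q r r'' a (qcomp R r r' r'' h k) = ract A q r' r'' (ract A q r r' a h) k"
    and "\<And>q q' r r' f a h. \<lbrakk>q \<in> Ob Q; q' \<in> Ob Q; r \<in> Ob R; r' \<in> Ob R; f \<in> carrier (Hom Q q q');
        a \<in> carrier (At A q' r); h \<in> carrier (Hom R r r')\<rbrakk>
      \<Longrightarrow> ract A q r r' (lact A q q' r f a) h = lact A q q' r' f (ract A q' r r' a h)"
  shows "is_module A"
  unfolding is_module_def Let_def small_suplattice_def assms(3,4)
  by (intro conjI ballI) (rule assms(1,2,5-); assumption)+

lemma id_module_simps [simp]:
  "Src (id_module Q) = Q" "Trg (id_module Q) = Q" "At (id_module Q) = Hom Q"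
  "lact (id_module Q) = qcomp Q" "ract (id_module Q) = qcomp Q"
  by (simp_all add: id_module_def)

lemma is_module_id_module:
  assumes Q: "small_quantaloid Q"
  shows "is_module (id_module Q)"
  by (rule is_moduleI[of Q Q])
    (simp_all add: Q hom_lattice hom_small qcomp_bimap qcomp_qid_left qcomp_qid_right qcomp_assoc)

lemma modhom_facts:
  assumes "is_modhom \<phi>" "Dom \<phi> = A" "Cod \<phi> = A'" "Src A = Q" "Trg A = R"
  shows modhom_Dom: "is_module A" and modhom_Cod: "is_module A'"
    and modhom_Src: "Src A' = Q" and modhom_Trg: "Trg A' = R"
    and app_sup_map: "\<lbrakk>q \<in> Ob Q; r \<in> Ob R\<rbrakk> \<Longrightarrow> sup_map (At A q r) (At A' q r) (app \<phi> q r)"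
    and app_lact: "\<lbrakk>q \<in> Ob Q; q' \<in> Ob Q; r \<in> Ob R; f \<in> carrier (Hom Q q q'); a \<in> carrier (At A q' r)\<rbrakk>
      \<Longrightarrow> app \<phi> q r (lact A q q' r f a) = lact A' q q' r f (app \<phi> q' r a)"
    and app_ract: "\<lbrakk>q \<in> Ob Q; r \<in> Ob R; r' \<in> Ob R; a \<in> carrier (At A q r); h \<in> carrier (Hom R r r')\<rbrakk>
      \<Longrightarrow> app \<phi> q r' (ract A q r r' a h) = ract A' q r r' (app \<phi> q r a) h"
    and modhom_extend: "\<phi> = extend_hom A A' (app \<phi>)"
  using assms by (auto simp: is_modhom_def Let_def)

lemma app_in:
  "\<lbrakk>is_modhom \<phi>; Dom \<phi> = A; Cod \<phi> = A'; Src A = Q; Trg A = R; q \<in> Ob Q; r \<in> Ob R;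
    a \<in> carrier (At A q r)\<rbrakk> \<Longrightarrow> app \<phi> q r a \<in> carrier (At A' q r)"
  by (rule sup_map_in[OF app_sup_map])

lemma extend_hom_simps [simp]: "Dom (extend_hom A A' \<phi>) = A" "Cod (extend_hom A A' \<phi>) = A'"
  by (simp_all add: extend_hom_def)

lemma app_extend_hom:
  "\<lbrakk>q \<in> Ob (Src A); r \<in> Ob (Trg A); a \<in> carrier (At A q r)\<rbrakk> \<Longrightarrow> app (extend_hom A A' \<phi>) q r a = \<phi> q r a"
  by (simp add: extend_hom_def)

text \<open>The laws are required on the carriers only, and the actions stay inside the carriers;
  the normal-form clause of \<open>is_modhom\<close> holds because truncating twice is the same as
  truncating once.\<close>

lemma is_modhom_extend_hom:
  assumes A: "is_module A" "Src A = Q" "Trg A = R" and A': "is_module A'" "Src A' = Q" "Trg A' = R"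
    and sup: "\<And>q r. \<lbrakk>q \<in> Ob Q; r \<in> Ob R\<rbrakk> \<Longrightarrow> sup_map (At A q r) (At A' q r) (\<phi> q r)"
    and l: "\<And>q q' r f a. \<lbrakk>q \<in> Ob Q; q' \<in> Ob Q; r \<in> Ob R; f \<in> carrier (Hom Q q q'); a \<in> carrier (At A q' r)\<rbrakk>
      \<Longrightarrow> \<phi> q r (lact A q q' r f a) = lact A' q q' r f (\<phi> q' r a)"
    and r: "\<And>q r r' a h. \<lbrakk>q \<in> Ob Q; r \<in> Ob R; r' \<in> Ob R; a \<in> carrier (At A q r); h \<in> carrier (Hom R r r')\<rbrakk>
      \<Longrightarrow> \<phi> q r' (ract A q r r' a h) = ract A' q r r' (\<phi> q r a) h"
  shows "is_modhom (extend_hom A A' \<phi>)"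
proof -
  have "app (extend_hom A A' \<phi>) q r a = \<phi> q r a" if "q \<in> Ob Q" "r \<in> Ob R" "a \<in> carrier (At A q r)" for q r a
    using that A by (simp add: app_extend_hom)
  moreover have "sup_map (At A q r) (At A' q r) (app (extend_hom A A' \<phi>) q r)" if "q \<in> Ob Q" "r \<in> Ob R"
    for q r
    using sup[OF that] sup_map_cong[OF at_lattice[OF A that]] calculation[OF that] by metis
  moreover have "extend_hom A A' \<phi> = extend_hom A A' (app (extend_hom A A' \<phi>))"
    by (auto simp: extend_hom_def fun_eq_iff)
  ultimately show ?thesis
    using A A' l r lact_in[OF A] ract_in[OF A] by (simp add: is_modhom_def Let_def)
qed

lemma modhom_eqI:
  assumes \<phi>: "is_modhom \<phi>" "Dom \<phi> = A" "Cod \<phi> = A'" and \<psi>: "is_modhom \<psi>" "Dom \<psi> = A" "Cod \<psi> = A'"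
    and eq: "\<And>q r a. \<lbrakk>q \<in> Ob (Src A); r \<in> Ob (Trg A); a \<in> carrier (At A q r)\<rbrakk> \<Longrightarrow> app \<phi> q r a = app \<psi> q r a"
  shows "\<phi> = \<psi>"
proof -
  have "extend_hom A A' (app \<phi>) = extend_hom A A' (app \<psi>)"
    using eq by (auto simp: extend_hom_def fun_eq_iff)
  then show ?thesis
    using modhom_extend[OF \<phi> refl refl] modhom_extend[OF \<psi> refl refl] by simp
qed


section \<open>Elementary tensors\<close>

text \<open>The element \<open>el\<close> of the locale \<open>composable\<close>, with all
  parameters explicit because several composites occur side by side.\<close>

definition tens :: "'u qmodule \<Rightarrow> 'u qmodule \<Rightarrow> 'u \<Rightarrow> 'u \<Rightarrow> 'u \<Rightarrow> 'u \<Rightarrow> 'u \<Rightarrow> 'u" where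
  "tens A C q s r a c = tensor_join A C q s {(r, a, c)}"

text \<open>The sup-map on \<open>(A \<otimes> C)(q, s)\<close> induced by a balanced family of bimaps.\<close>

definition ind :: "'u gorder \<Rightarrow> ('u \<Rightarrow> 'u \<Rightarrow> 'u \<Rightarrow> 'u) \<Rightarrow> 'u \<Rightarrow> 'u" where
  "ind M \<beta> v = \<Squnion>\<^bsub>M\<^esub> {\<beta> r a c | r a c. (r, a, c) \<in> dec v}"

context
  fixes A C :: "'u qmodule" and Q R S :: "'u quantaloid"
  assumes mA: "is_module A" "Src A = Q" "Trg A = R" and mC: "is_module C" "Src C = R" "Trg C = S"
begin

lemma composableI: "q \<in> Ob Q \<Longrightarrow> s \<in> Ob S \<Longrightarrow> composable elts A C q s"
  using set_universe_axioms mA mC by (simp add: composable_def composable_axioms_def)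

lemma tens_eq_el: "q \<in> Ob Q \<Longrightarrow> s \<in> Ob S \<Longrightarrow> composable.el elts A C q s = tens A C q s"
  by (rule ext)+ (simp add: composable.el_def[OF composableI] tens_def)

lemma tensor_lattice: "q \<in> Ob Q \<Longrightarrow> s \<in> Ob S \<Longrightarrow> complete_lattice (tensor_at A C q s)"
  by (rule composable.complete_T[OF composableI])

lemma tens_in:
  "\<lbrakk>q \<in> Ob Q; s \<in> Ob S; r \<in> Ob R; a \<in> carrier (At A q r); c \<in> carrier (At C r s)\<rbrakk>
    \<Longrightarrow> tens A C q s r a c \<in> carrier (tensor_at A C q s)"
  using composable.el_in[OF composableI] mA by (simp add: tens_eq_el gens_def)

lemma tens_bimap:
  "\<lbrakk>q \<in> Ob Q; s \<in> Ob S; r \<in> Ob R\<rbrakk>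
    \<Longrightarrow> sup_bimap (At A q r) (At C r s) (tensor_at A C q s) (tens A C q s r)"
  using composable.el_bimap[OF composableI] mA by (simp add: tens_eq_el)

lemma tens_balanced:
  "\<lbrakk>q \<in> Ob Q; s \<in> Ob S; r \<in> Ob R; r' \<in> Ob R; a \<in> carrier (At A q r); h \<in> carrier (Hom R r r');
    c \<in> carrier (At C r' s)\<rbrakk> \<Longrightarrow> tens A C q s r' (ract A q r r' a h) c = tens A C q s r a (lact C r r' s h c)"
  using composable.el_balanced[OF composableI] mA by (simp add: tens_eq_el)

lemma dec_tensor:
  assumes "q \<in> Ob Q" "s \<in> Ob S" "v \<in> carrier (tensor_at A C q s)" "(r, a, c) \<in> dec v"
  shows "r \<in> Ob R \<and> a \<in> carrier (At A q r) \<and> c \<in> carrier (At C r s)"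
proof -
  interpret composable elts A C q s by (rule composableI[OF assms(1,2)])
  show ?thesis using sat_sub[OF carrier_dest[OF assms(3)]] assms(4) mA(3) by (auto simp: gens_def)
qed

lemma Sup_tens:
  assumes "q \<in> Ob Q" "s \<in> Ob S" "v \<in> carrier (tensor_at A C q s)"
  shows "\<Squnion>\<^bsub>tensor_at A C q s\<^esub> {tens A C q s r a c | r a c. (r, a, c) \<in> dec v} = v"
  using composable.sup_el[OF composableI assms(3)] assms by (simp add: tens_eq_el)

text \<open>Closures are traded for suprema: \<open>dec m\<close> is itself closed, so it contains
  the closure of \<open>J\<close> exactly when it contains \<open>J\<close>, that is, when
  \<open>m\<close> lies above every elementary tensor of \<open>J\<close>.\<close>

lemma tensor_join_eq_Sup:
  assumes qQ: "q \<in> Ob Q" and sS: "s \<in> Ob S"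
    and J: "\<And>r a c. (r, a, c) \<in> J \<Longrightarrow> r \<in> Ob R \<and> a \<in> carrier (At A q r) \<and> c \<in> carrier (At C r s)"
  shows "tensor_join A C q s J = \<Squnion>\<^bsub>tensor_at A C q s\<^esub> {tens A C q s r a c | r a c. (r, a, c) \<in> J}"
proof -
  interpret composable elts A C q s by (rule composableI[OF qQ sS])
  have JG: "J \<subseteq> G" using J mA(3) by (auto simp: gens_def)
  show ?thesis
  proof (rule sup_eqI[OF complete_T _ join_in[OF JG], symmetric])
    show "{tens A C q s r a c | r a c. (r, a, c) \<in> J} \<subseteq> carrier T"
      using JG el_in tens_eq_el[OF qQ sS] by auto
    show "tensor_join A C q s J \<sqsubseteq>\<^bsub>T\<^esub> m \<longleftrightarrow> (\<forall>y \<in> {tens A C q s r a c | r a c. (r, a, c) \<in> J}. y \<sqsubseteq>\<^bsub>T\<^esub> m)"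
      if m: "m \<in> carrier T" for m
    proof -
      have "tensor_join A C q s J \<sqsubseteq>\<^bsub>T\<^esub> m \<longleftrightarrow> (\<forall>r a c. (r, a, c) \<in> J \<longrightarrow> (r, a, c) \<in> dec m)"
        by (auto simp: le_T dec_join[OF JG] cl_le_iff[OF carrier_dest[OF m]])
      also have "\<dots> \<longleftrightarrow> (\<forall>r a c. (r, a, c) \<in> J \<longrightarrow> el r a c \<sqsubseteq>\<^bsub>T\<^esub> m)"
        using el_le[OF _ m] JG by blast
      finally show ?thesis unfolding tens_eq_el[OF qQ sS] by auto
    qed
  qed
qed

text \<open>Elementary tensors are join-dense by \<open>Sup_tens\<close>. Equations between maps out
  of a composite are reduced to generators through this.\<close>

lemma tensor_ext:
  assumes q: "q \<in> Ob Q" and s: "s \<in> Ob S"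
    and f: "sup_map (tensor_at A C q s) M f" and g: "sup_map (tensor_at A C q s) M g"
    and eq: "\<And>r a c. \<lbrakk>r \<in> Ob R; a \<in> carrier (At A q r); c \<in> carrier (At C r s)\<rbrakk>
      \<Longrightarrow> f (tens A C q s r a c) = g (tens A C q s r a c)"
    and v: "v \<in> carrier (tensor_at A C q s)"
  shows "f v = g v"
proof -
  let ?E = "{tens A C q s r a c | r a c. (r, a, c) \<in> dec v}"
  have E: "?E \<subseteq> carrier (tensor_at A C q s)" using dec_tensor[OF q s v] tens_in[OF q s] by blast
  have "f ` ?E = g ` ?E" using dec_tensor[OF q s v] eq by (intro image_cong) auto
  then have "f (\<Squnion>\<^bsub>tensor_at A C q s\<^esub> ?E) = g (\<Squnion>\<^bsub>tensor_at A C q s\<^esub> ?E)"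
    by (simp only: sup_map_Sup[OF f E] sup_map_Sup[OF g E])
  then show ?thesis by (simp only: Sup_tens[OF q s v])
qed

context
  fixes q s :: 'u and M :: "'u gorder" and \<beta> :: "'u \<Rightarrow> 'u \<Rightarrow> 'u \<Rightarrow> 'u"
  assumes q: "q \<in> Ob Q" and s: "s \<in> Ob S" and M: "complete_lattice M"
    and \<beta>_in: "\<And>r a c. \<lbrakk>r \<in> Ob R; a \<in> carrier (At A q r); c \<in> carrier (At C r s)\<rbrakk> \<Longrightarrow> \<beta> r a c \<in> carrier M"
begin

lemma ind_in:
  assumes v: "v \<in> carrier (tensor_at A C q s)"
  shows "ind M \<beta> v \<in> carrier M"
  unfolding ind_def by (rule sup_le_iff(1)[OF M]) (use dec_tensor[OF q s v] \<beta>_in in blast)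

lemma ind_le_iff:
  assumes v: "v \<in> carrier (tensor_at A C q s)" and m: "m \<in> carrier M"
  shows "ind M \<beta> v \<sqsubseteq>\<^bsub>M\<^esub> m \<longleftrightarrow> (\<forall>r a c. (r, a, c) \<in> dec v \<longrightarrow> \<beta> r a c \<sqsubseteq>\<^bsub>M\<^esub> m)"
proof -
  have "{\<beta> r a c | r a c. (r, a, c) \<in> dec v} \<subseteq> carrier M" using dec_tensor[OF q s v] \<beta>_in by blast
  from sup_le_iff(2)[OF M this m] show ?thesis unfolding ind_def by auto
qed

end

text \<open>The universal property only provides some map \<open>g\<close>. Since every
  \<open>v\<close> is the supremum of its elementary tensors, \<open>g\<close> has to be given by
  the formula \<open>ind\<close>, which is the shape in which the structure maps of the bicategory
  can be written.\<close>

lemma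
  assumes q: "q \<in> Ob Q" and s: "s \<in> Ob S" and M: "complete_lattice M"
    and bi: "\<And>r. r \<in> Ob R \<Longrightarrow> sup_bimap (At A q r) (At C r s) M (\<beta> r)"
    and bal: "\<And>r r' a h c. \<lbrakk>r \<in> Ob R; r' \<in> Ob R; a \<in> carrier (At A q r); h \<in> carrier (Hom R r r');
      c \<in> carrier (At C r' s)\<rbrakk> \<Longrightarrow> \<beta> r' (ract A q r r' a h) c = \<beta> r a (lact C r r' s h c)"
  shows ind_sup_map: "sup_map (tensor_at A C q s) M (ind M \<beta>)"
    and ind_tens: "\<And>r a c. \<lbrakk>r \<in> Ob R; a \<in> carrier (At A q r); c \<in> carrier (At C r s)\<rbrakk>
      \<Longrightarrow> ind M \<beta> (tens A C q s r a c) = \<beta> r a c"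
proof -
  obtain g where g: "sup_map (tensor_at A C q s) M g" and eq:
    "\<forall>(r, a, c) \<in> gens A C q s. g (tens A C q s r a c) = \<beta> r a c"
  proof -
    have "\<exists>g. sup_map (tensor_at A C q s) M g \<and>
        (\<forall>(r, a, c) \<in> gens A C q s. g (composable.el elts A C q s r a c) = \<beta> r a c)"
      by (rule composable.universal(1)[OF composableI[OF q s] M]) (use bi bal mA in simp_all)
    then show ?thesis using that by (auto simp: tens_eq_el[OF q s])
  qed
  have eq: "g (tens A C q s r a c) = \<beta> r a c" if "r \<in> Ob R" "a \<in> carrier (At A q r)"
    "c \<in> carrier (At C r s)" for r a c
    using eq that mA by (auto simp: gens_def)
  have ind_g: "ind M \<beta> v = g v" if v: "v \<in> carrier (tensor_at A C q s)" for v
  proof -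
    let ?E = "{tens A C q s r a c | r a c. (r, a, c) \<in> dec v}"
    have E: "?E \<subseteq> carrier (tensor_at A C q s)" using dec_tensor[OF q s v] tens_in[OF q s] by blast
    have \<beta>: "g (tens A C q s r a c) = \<beta> r a c" if "(r, a, c) \<in> dec v" for r a c
      using eq dec_tensor[OF q s v that] by simp
    have "g ` ?E = {g (tens A C q s r a c) | r a c. (r, a, c) \<in> dec v}" by auto
    also have "\<dots> = {\<beta> r a c | r a c. (r, a, c) \<in> dec v}"
      by (intro Collect_cong ex_cong1) (auto simp: \<beta>)
    finally show ?thesis
      unfolding ind_def using sup_map_Sup[OF g E] by (simp only: Sup_tens[OF q s v])
  qed
  show "sup_map (tensor_at A C q s) M (ind M \<beta>)"
    by (rule iffD2[OF sup_map_cong[OF tensor_lattice[OF q s], of "ind M \<beta>" g M] g]) (rule ind_g)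
  show "ind M \<beta> (tens A C q s r a c) = \<beta> r a c"
    if "r \<in> Ob R" "a \<in> carrier (At A q r)" "c \<in> carrier (At C r s)" for r a c
    using ind_g[OF tens_in[OF q s that]] eq[OF that] by simp
qed

text \<open>The index set \<open>dec v\<close> does not depend on \<open>x\<close>, so the supremum
  over \<open>dec v\<close> commutes with suprema in the parameter. This supplies preservation of
  suprema in the variable that \<open>ind_sup_map\<close> does not see: the scalar of an action, or
  the outer factor of an associator.\<close>

lemma ind_param_sup_map:
  assumes q: "q \<in> Ob Q" and s: "s \<in> Ob S" and M: "complete_lattice M" and L: "complete_lattice L"
    and sup: "\<And>r a c. \<lbrakk>r \<in> Ob R; a \<in> carrier (At A q r); c \<in> carrier (At C r s)\<rbrakk>
      \<Longrightarrow> sup_map L M (\<lambda>x. \<beta> x r a c)"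
    and v: "v \<in> carrier (tensor_at A C q s)"
  shows "sup_map L M (\<lambda>x. ind M (\<beta> x) v)"
proof (rule sup_mapI[OF L M])
  have \<beta>_in: "\<beta> x r a c \<in> carrier M"
    if "x \<in> carrier L" "r \<in> Ob R" "a \<in> carrier (At A q r)" "c \<in> carrier (At C r s)" for x r a c
    using sup_map_in[OF sup] that by blast
  show "ind M (\<beta> x) v \<in> carrier M" if "x \<in> carrier L" for x
    by (rule ind_in[OF q s M \<beta>_in[OF that] v])
  fix X m assume X: "X \<subseteq> carrier L" and m: "m \<in> carrier M"
  have "ind M (\<beta> (\<Squnion>\<^bsub>L\<^esub> X)) v \<sqsubseteq>\<^bsub>M\<^esub> m \<longleftrightarrow> (\<forall>r a c. (r, a, c) \<in> dec v \<longrightarrow> \<beta> (\<Squnion>\<^bsub>L\<^esub> X) r a c \<sqsubseteq>\<^bsub>M\<^esub> m)"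
    by (rule ind_le_iff[OF q s M \<beta>_in[OF sup_le_iff(1)[OF L X]] v m])
  also have "\<dots> \<longleftrightarrow> (\<forall>r a c. (r, a, c) \<in> dec v \<longrightarrow> (\<forall>x \<in> X. \<beta> x r a c \<sqsubseteq>\<^bsub>M\<^esub> m))"
  proof -
    have "\<beta> (\<Squnion>\<^bsub>L\<^esub> X) r a c \<sqsubseteq>\<^bsub>M\<^esub> m \<longleftrightarrow> (\<forall>x \<in> X. \<beta> x r a c \<sqsubseteq>\<^bsub>M\<^esub> m)" if "(r, a, c) \<in> dec v" for r a c
      using sup_map_le_iff[OF M sup X m, of r a c] dec_tensor[OF q s v that] by blast
    then show ?thesis by blast
  qed
  also have "\<dots> \<longleftrightarrow> (\<forall>x \<in> X. ind M (\<beta> x) v \<sqsubseteq>\<^bsub>M\<^esub> m)"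
  proof -
    have "ind M (\<beta> x) v \<sqsubseteq>\<^bsub>M\<^esub> m \<longleftrightarrow> (\<forall>r a c. (r, a, c) \<in> dec v \<longrightarrow> \<beta> x r a c \<sqsubseteq>\<^bsub>M\<^esub> m)" if "x \<in> X" for x
      by (rule ind_le_iff[OF q s M \<beta>_in v m]) (use that X in auto)
    then show ?thesis by blast
  qed
  finally show "ind M (\<beta> (\<Squnion>\<^bsub>L\<^esub> X)) v \<sqsubseteq>\<^bsub>M\<^esub> m \<longleftrightarrow> (\<forall>x \<in> X. ind M (\<beta> x) v \<sqsubseteq>\<^bsub>M\<^esub> m)" .
qed

text \<open>Brings the defining formulas of \<open>tensor\<close> and \<open>tensor_hom\<close> into
  the form \<open>ind\<close>; \<open>f\<close>, \<open>g\<close>, \<open>h\<close> are the three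
  components of the image of a generator.\<close>

lemma tensor_join_eq_ind:
  assumes q: "q \<in> Ob Q" and s: "s \<in> Ob S"
    and D: "\<And>r a c. (r, a, c) \<in> dec v \<Longrightarrow> f r a c \<in> Ob R \<and> g r a c \<in> carrier (At A q (f r a c)) \<and>
      h r a c \<in> carrier (At C (f r a c) s)"
  shows "tensor_join A C q s {(f r a c, g r a c, h r a c) | r a c. (r, a, c) \<in> dec v}
    = ind (tensor_at A C q s) (\<lambda>r a c. tens A C q s (f r a c) (g r a c) (h r a c)) v"
proof -
  have "{tens A C q s r' a' c' | r' a' c'. (r', a', c') \<in> {(f r a c, g r a c, h r a c) | r a c. (r, a,
    c) \<in> dec v}}
    = {tens A C q s (f r a c) (g r a c) (h r a c) | r a c. (r, a, c) \<in> dec v}" by blast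
  then show ?thesis
    unfolding ind_def by (subst tensor_join_eq_Sup[OF q s]) (use D in auto)
qed

end


section \<open>The composite of two modules\<close>

lemma tensor_simps [simp]:
  "Src (tensor A C) = Src A" "Trg (tensor A C) = Trg C" "At (tensor A C) = tensor_at A C"
  by (simp_all add: tensor_def)

context
  fixes A C :: "'u qmodule" and Q R S :: "'u quantaloid"
  assumes mA: "is_module A" "Src A = Q" "Trg A = R" and mC: "is_module C" "Src C = R" "Trg C = S"
begin

lemma lact_tensor:
  assumes "q \<in> Ob Q" "q' \<in> Ob Q" "s \<in> Ob S" "f \<in> carrier (Hom Q q q')" "v \<in> carrier (tensor_at A C q' s)"
  shows "lact (tensor A C) q q' s f v
    = ind (tensor_at A C q s) (\<lambda>r a c. tens A C q s r (lact A q q' r f a) c) v"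
proof -
  have "lact (tensor A C) q q' s f v = tensor_join A C q s {(r, lact A q q' r f a, c) | r a c. (r, a,
    c) \<in> dec v}"
    by (simp add: tensor_def)
  also have "\<dots> = ind (tensor_at A C q s) (\<lambda>r a c. tens A C q s r (lact A q q' r f a) c) v"
    by (rule tensor_join_eq_ind[OF mA mC, where f = "\<lambda>r a c. r" and g
      = "\<lambda>r a c. lact A q q' r f a" and h = "\<lambda>r a c. c"])
      (use assms dec_tensor[OF mA mC _ _ assms(5)] lact_in[OF mA] in auto)
  finally show ?thesis .
qed

lemma ract_tensor:
  assumes "q \<in> Ob Q" "s \<in> Ob S" "s' \<in> Ob S" "v \<in> carrier (tensor_at A C q s)" "h \<in> carrier (Hom S s s')"
  shows "ract (tensor A C) q s s' v h
    = ind (tensor_at A C q s') (\<lambda>r a c. tens A C q s' r a (ract C r s s' c h)) v"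
proof -
  have "ract (tensor A C) q s s' v h = tensor_join A C q s' {(r, a, ract C r s s' c h) | r a c. (r, a,
    c) \<in> dec v}"
    by (simp add: tensor_def)
  also have "\<dots> = ind (tensor_at A C q s') (\<lambda>r a c. tens A C q s' r a (ract C r s s' c h)) v"
    by (rule tensor_join_eq_ind[OF mA mC, where f = "\<lambda>r a c. r" and g = "\<lambda>r a c. a" and h
      = "\<lambda>r a c. ract C r s s' c h"])
      (use assms dec_tensor[OF mA mC _ _ assms(4)] ract_in[OF mC] in auto)
  finally show ?thesis .
qed

text \<open>In \<open>v\<close> the action is induced by a bimap, balanced because the actions of
  \<open>Q\<close> and \<open>R\<close> on \<open>A\<close> commute; in \<open>f\<close> it is a
  supremum of sup-maps over an index set independent of \<open>f\<close>.\<close>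

lemma
  assumes ob: "q \<in> Ob Q" "q' \<in> Ob Q" "s \<in> Ob S"
  shows lact_tensor_bimap:
      "sup_bimap (Hom Q q q') (tensor_at A C q' s) (tensor_at A C q s) (lact (tensor A C) q q' s)"
    and lact_tensor_tens: "\<And>f r a c. \<lbrakk>f \<in> carrier (Hom Q q q'); r \<in> Ob R; a \<in> carrier (At A q' r);
      c \<in> carrier (At C r s)\<rbrakk>
      \<Longrightarrow> lact (tensor A C) q q' s f (tens A C q' s r a c) = tens A C q s r (lact A q q' r f a) c"
proof -
  let ?\<beta> = "\<lambda>f r a c. tens A C q s r (lact A q q' r f a) c"
  note T = tensor_lattice[OF mA mC ob(1,3)] and T' = tensor_lattice[OF mA mC ob(2,3)]
  have bi: "sup_bimap (At A q' r) (At C r s) (tensor_at A C q s) (?\<beta> f r)"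
    if "f \<in> carrier (Hom Q q q')" "r \<in> Ob R" for f r
    by (rule sup_bimap_comp[OF sup_bimap2[OF lact_bimap[OF mA ob(1,2) that(2)] that(1)]
          sup_map_id[OF at_lattice[OF mC that(2) ob(3)]] tens_bimap[OF mA mC ob(1,3) that(2)]])
  have bal: "?\<beta> f r' (ract A q' r r' a h) c = ?\<beta> f r a (lact C r r' s h c)"
    if "f \<in> carrier (Hom Q q q')" "r \<in> Ob R" "r' \<in> Ob R" "a \<in> carrier (At A q' r)" "h \<in> carrier (Hom R r r')"
      "c \<in> carrier (At C r' s)" for f r r' a h c
    using that ob lact_in[OF mA] tens_balanced[OF mA mC] by (simp add: ract_lact[OF mA, symmetric])
  show "lact (tensor A C) q q' s f (tens A C q' s r a c) = ?\<beta> f r a c"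
    if f: "f \<in> carrier (Hom Q q q')" and r: "r \<in> Ob R" "a \<in> carrier (At A q' r)"
      "c \<in> carrier (At C r s)" for f r a c
    using ind_tens[OF mA mC ob(2,3) T bi[OF f] bal[OF f] r]
    by (simp add: lact_tensor[OF ob f tens_in[OF mA mC ob(2,3) r]])
  show "sup_bimap (Hom Q q q') (tensor_at A C q' s) (tensor_at A C q s) (lact (tensor A C) q q' s)"
    unfolding sup_bimap_def
  proof (intro conjI ballI)
    show "sup_map (tensor_at A C q' s) (tensor_at A C q s) (lact (tensor A C) q q' s f)"
      if f: "f \<in> carrier (Hom Q q q')" for f
      by (rule iffD2[OF sup_map_cong[OF T'] ind_sup_map[OF mA mC ob(2,3) T bi[OF f] bal[OF f]]])
        (rule lact_tensor[OF ob f])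
    fix v assume v: "v \<in> carrier (tensor_at A C q' s)"
    have *: "sup_map (Hom Q q q') (tensor_at A C q s) (\<lambda>f. ?\<beta> f r a c)"
      if "r \<in> Ob R" "a \<in> carrier (At A q' r)" "c \<in> carrier (At C r s)" for r a c
      by (rule sup_map_comp[OF sup_bimap1[OF lact_bimap[OF mA ob(1,2) that(1)] that(2)]
            sup_bimap1[OF tens_bimap[OF mA mC ob(1,3) that(1)] that(3)]])
    note L = hom_lattice[OF module_Src[OF mA] ob(1,2)]
    show "sup_map (Hom Q q q') (tensor_at A C q s) (\<lambda>f. lact (tensor A C) q q' s f v)"
      by (rule iffD2[OF sup_map_cong[OF L] ind_param_sup_map[OF mA mC ob(2,3) T L * v]])
        (rule lact_tensor[OF ob _ v])
  qed
qed

lemma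
  assumes ob: "q \<in> Ob Q" "s \<in> Ob S" "s' \<in> Ob S"
  shows ract_tensor_bimap:
      "sup_bimap (tensor_at A C q s) (Hom S s s') (tensor_at A C q s') (ract (tensor A C) q s s')"
    and ract_tensor_tens: "\<And>r a c h. \<lbrakk>r \<in> Ob R; a \<in> carrier (At A q r); c \<in> carrier (At C r s);
      h \<in> carrier (Hom S s s')\<rbrakk>
      \<Longrightarrow> ract (tensor A C) q s s' (tens A C q s r a c) h = tens A C q s' r a (ract C r s s' c h)"
proof -
  let ?\<beta> = "\<lambda>h r a c. tens A C q s' r a (ract C r s s' c h)"
  note T' = tensor_lattice[OF mA mC ob(1,3)] and T = tensor_lattice[OF mA mC ob(1,2)]
  have bi: "sup_bimap (At A q r) (At C r s) (tensor_at A C q s') (?\<beta> h r)"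
    if "h \<in> carrier (Hom S s s')" "r \<in> Ob R" for h r
    by (rule sup_bimap_comp[OF sup_map_id[OF at_lattice[OF mA ob(1) that(2)]]
          sup_bimap1[OF ract_bimap[OF mC that(2) ob(2,3)] that(1)] tens_bimap[OF mA mC ob(1,3) that(2)]])
  have bal: "?\<beta> h r' (ract A q r r' a k) c = ?\<beta> h r a (lact C r r' s k c)"
    if "h \<in> carrier (Hom S s s')" "r \<in> Ob R" "r' \<in> Ob R" "a \<in> carrier (At A q r)" "k \<in> carrier (Hom R r r')"
      "c \<in> carrier (At C r' s)" for h r r' a k c
    using that ob ract_lact[OF mC] ract_in[OF mC] tens_balanced[OF mA mC] by simp
  show "ract (tensor A C) q s s' (tens A C q s r a c) h = ?\<beta> h r a c"
    if r: "r \<in> Ob R" "a \<in> carrier (At A q r)" "c \<in> carrier (At C r s)" and h: "h \<in> carrier (Hom S s s')"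
      for r a c h
    using ind_tens[OF mA mC ob(1,2) T' bi[OF h] bal[OF h] r]
    by (simp add: ract_tensor[OF ob tens_in[OF mA mC ob(1,2) r] h])
  show "sup_bimap (tensor_at A C q s) (Hom S s s') (tensor_at A C q s') (ract (tensor A C) q s s')"
    unfolding sup_bimap_def
  proof (intro conjI ballI)
    show "sup_map (tensor_at A C q s) (tensor_at A C q s') (\<lambda>v. ract (tensor A C) q s s' v h)"
      if h: "h \<in> carrier (Hom S s s')" for h
      by (rule iffD2[OF sup_map_cong[OF T] ind_sup_map[OF mA mC ob(1,2) T' bi[OF h] bal[OF h]]])
        (rule ract_tensor[OF ob _ h])
    fix v assume v: "v \<in> carrier (tensor_at A C q s)"
    have *: "sup_map (Hom S s s') (tensor_at A C q s') (\<lambda>h. ?\<beta> h r a c)"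
      if "r \<in> Ob R" "a \<in> carrier (At A q r)" "c \<in> carrier (At C r s)" for r a c
      by (rule sup_map_comp[OF sup_bimap2[OF ract_bimap[OF mC that(1) ob(2,3)] that(3)]
            sup_bimap2[OF tens_bimap[OF mA mC ob(1,3) that(1)] that(2)]])
    note L = hom_lattice[OF module_Trg[OF mC] ob(2,3)]
    show "sup_map (Hom S s s') (tensor_at A C q s') (\<lambda>h. ract (tensor A C) q s s' v h)"
      by (rule iffD2[OF sup_map_cong[OF L] ind_param_sup_map[OF mA mC ob(1,2) T' L * v]])
        (rule ract_tensor[OF ob v])
  qed
qed

text \<open>Both sides of each law are sup-maps in \<open>v\<close>. On an elementary tensor the
  left action touches only \<open>A\<close> and the right action only \<open>C\<close>, so the laws
  come from the two factors and the commutation of the two actions is immediate.\<close>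

lemma is_module_tensor: "is_module (tensor A C)"
proof (rule is_moduleI[of Q S])
  note lb = lact_tensor_bimap and rb = ract_tensor_bimap and lt = lact_tensor_tens and rt = ract_tensor_tens
  note l_in = lact_in[OF mA] and r_in = ract_in[OF mC]
  note Q = module_Src[OF mA] and S = module_Trg[OF mC]
  show "small_quantaloid Q" "small_quantaloid S" "Src (tensor A C) = Q" "Trg (tensor A C) = S"
    using Q S mA mC by simp_all
  fix q s assume q: "q \<in> Ob Q" and s: "s \<in> Ob S"
  show "complete_lattice (At (tensor A C) q s)" using tensor_lattice[OF mA mC q s] by simp
  show "small (carrier (At (tensor A C) q s))" using composable.small_T[OF composableI[OF mA mC q s]] by simp
  show "sup_bimap (Hom Q q q') (At (tensor A C) q' s) (At (tensor A C) q s) (lact (tensor A C) q q' s)"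
    if "q' \<in> Ob Q" for q' using lb[OF q that s] by simp
  show "sup_bimap (At (tensor A C) q s) (Hom S s s') (At (tensor A C) q s') (ract (tensor A C) q s s')"
    if "s' \<in> Ob S" for s' using rb[OF q s that] by simp
  show "lact (tensor A C) q q s (qid Q q) v = v" if "v \<in> carrier (At (tensor A C) q s)" for v
    by (rule tensor_ext[OF mA mC q s sup_bimap2[OF lb] sup_map_id[OF tensor_lattice[OF mA mC]]])
      (use that q s Q qid_in in \<open>simp_all add: lt lact_qid[OF mA]\<close>)
  show "ract (tensor A C) q s s v (qid S s) = v" if "v \<in> carrier (At (tensor A C) q s)" for v
    by (rule tensor_ext[OF mA mC q s sup_bimap1[OF rb] sup_map_id[OF tensor_lattice[OF mA mC]]])
      (use that q s S qid_in in \<open>simp_all add: rt ract_qid[OF mC]\<close>)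
  show "lact (tensor A C) q q'' s (qcomp Q q q' q'' f g) v
    = lact (tensor A C) q q' s f (lact (tensor A C) q' q'' s g v)"
    if "q' \<in> Ob Q" "q'' \<in> Ob Q" "f \<in> carrier (Hom Q q q')" "g \<in> carrier (Hom Q q' q'')"
      "v \<in> carrier (At (tensor A C) q'' s)" for q' q'' f g v
    by (rule tensor_ext[OF mA mC that(2) s sup_bimap2[OF lb] sup_map_comp[OF sup_bimap2[OF lb]
      sup_bimap2[OF lb]]])
      (use that q s Q qcomp_in[OF Q] l_in in \<open>simp_all add: lt lact_qcomp[OF mA]\<close>)
  show "ract (tensor A C) q s s'' v (qcomp S s s' s'' h k)
    = ract (tensor A C) q s' s'' (ract (tensor A C) q s s' v h) k"
    if "s' \<in> Ob S" "s'' \<in> Ob S" "v \<in> carrier (At (tensor A C) q s)" "h \<in> carrier (Hom S s s')"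
      "k \<in> carrier (Hom S s' s'')" for s' s'' v h k
    by (rule tensor_ext[OF mA mC q s sup_bimap1[OF rb] sup_map_comp[OF sup_bimap1[OF rb] sup_bimap1[OF rb]]])
      (use that q s S qcomp_in[OF S] r_in in \<open>simp_all add: rt ract_qcomp[OF mC]\<close>)
  show "ract (tensor A C) q s s' (lact (tensor A C) q q' s f v) h
    = lact (tensor A C) q q' s' f (ract (tensor A C) q' s s' v h)"
    if "q' \<in> Ob Q" "s' \<in> Ob S" "f \<in> carrier (Hom Q q q')" "v \<in> carrier (At (tensor A C) q' s)"
      "h \<in> carrier (Hom S s s')" for q' s' f v h
    by (rule tensor_ext[OF mA mC that(1) s sup_map_comp[OF sup_bimap2[OF lb] sup_bimap1[OF rb]]
          sup_map_comp[OF sup_bimap1[OF rb] sup_bimap2[OF lb]]])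
      (use that q s l_in r_in in \<open>simp_all add: lt rt\<close>)
qed

lemma tensor_hom_eqI:
  assumes \<phi>: "is_modhom \<phi>" "Dom \<phi> = tensor A C" "Cod \<phi> = M" and \<psi>: "is_modhom \<psi>" "Dom \<psi>
    = tensor A C" "Cod \<psi> = M"
    and eq: "\<And>q s r a c. \<lbrakk>q \<in> Ob Q; s \<in> Ob S; r \<in> Ob R; a \<in> carrier (At A q r); c \<in> carrier (At C r s)\<rbrakk>
      \<Longrightarrow> app \<phi> q s (tens A C q s r a c) = app \<psi> q s (tens A C q s r a c)"
  shows "\<phi> = \<psi>"
proof (rule modhom_eqI[OF \<phi> \<psi>])
  fix q s v assume "q \<in> Ob (Src (tensor A C))" "s \<in> Ob (Trg (tensor A C))" and v:
    "v \<in> carrier (At (tensor A C) q s)"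
  then have q: "q \<in> Ob Q" and s: "s \<in> Ob S" using mA mC by simp_all
  have sup: "sup_map (tensor_at A C q s) (At M q s) (app \<chi> q s)"
    if "is_modhom \<chi>" "Dom \<chi> = tensor A C" "Cod \<chi> = M" for \<chi>
    using app_sup_map[OF that, of Q S q s] mA mC q s by simp
  show "app \<phi> q s v = app \<psi> q s v"
    by (rule tensor_ext[OF mA mC q s sup[OF \<phi>] sup[OF \<psi>] eq[OF q s]]) (use v in simp_all)
qed

text \<open>The recipe for 2-cells out of a composite: horizontal composites, unitors, associators
  in both directions and evaluations are obtained by supplying a balanced, equivariant
  \<open>\<beta>\<close>.\<close>

lemma
  assumes M: "is_module M" "Src M = Q" "Trg M = S"
    and bi: "\<And>q s r. \<lbrakk>q \<in> Ob Q; s \<in> Ob S; r \<in> Ob R\<rbrakk> \<Longrightarrow> sup_bimap (At A q r) (At C r s) (At M q s) (\<beta> q s r)"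
    and bal: "\<And>q s r r' a h c. \<lbrakk>q \<in> Ob Q; s \<in> Ob S; r \<in> Ob R; r' \<in> Ob R; a \<in> carrier (At A q r);
      h \<in> carrier (Hom R r r');
      c \<in> carrier (At C r' s)\<rbrakk> \<Longrightarrow> \<beta> q s r' (ract A q r r' a h) c = \<beta> q s r a (lact C r r' s h c)"
    and l: "\<And>q q' s r f a c. \<lbrakk>q \<in> Ob Q; q' \<in> Ob Q; s \<in> Ob S; r \<in> Ob R; f \<in> carrier (Hom Q q q');
      a \<in> carrier (At A q' r); c \<in> carrier (At C r s)\<rbrakk>
      \<Longrightarrow> \<beta> q s r (lact A q q' r f a) c = lact M q q' s f (\<beta> q' s r a c)"
    and r: "\<And>q s s' r a c h. \<lbrakk>q \<in> Ob Q; s \<in> Ob S; s' \<in> Ob S; r \<in> Ob R;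
      a \<in> carrier (At A q r); c \<in> carrier (At C r s); h \<in> carrier (Hom S s s')\<rbrakk>
      \<Longrightarrow> \<beta> q s' r a (ract C r s s' c h) = ract M q s s' (\<beta> q s r a c) h"
  shows is_modhom_ind: "is_modhom (extend_hom (tensor A C) M (\<lambda>q s. ind (At M q s) (\<beta> q s)))"
    and app_ind: "\<And>q s r a c. \<lbrakk>q \<in> Ob Q; s \<in> Ob S; r \<in> Ob R; a \<in> carrier (At A q r); c \<in> carrier (At C r s)\<rbrakk>
      \<Longrightarrow> app (extend_hom (tensor A C) M (\<lambda>q s. ind (At M q s) (\<beta> q s))) q s (tens A C q s r a c) = \<beta> q s r a c"
proof -
  note sup = ind_sup_map[OF mA mC _ _ at_lattice[OF M] bi bal]
  note tens = ind_tens[OF mA mC _ _ at_lattice[OF M] bi bal]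
  note l_in = lact_in[OF mA] and r_in = ract_in[OF mC]
  show "app (extend_hom (tensor A C) M (\<lambda>q s. ind (At M q s) (\<beta> q s))) q s (tens A C q s r a c) = \<beta> q s r a c"
    if "q \<in> Ob Q" "s \<in> Ob S" "r \<in> Ob R" "a \<in> carrier (At A q r)" "c \<in> carrier (At C r s)" for q s r a c
    using that mA(2) mC(3) by (simp add: app_extend_hom tens_in[OF mA mC] tens)
  show "is_modhom (extend_hom (tensor A C) M (\<lambda>q s. ind (At M q s) (\<beta> q s)))"
  proof (rule is_modhom_extend_hom[OF is_module_tensor _ _ M])
    show "Src (tensor A C) = Q" "Trg (tensor A C) = S" using mA mC by simp_all
    show "sup_map (At (tensor A C) q s) (At M q s) (ind (At M q s) (\<beta> q s))" if "q \<in> Ob Q" "s \<in> Ob S" for q s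
      using sup that by simp
    show "ind (At M q s) (\<beta> q s) (lact (tensor A C) q q' s f v)
      = lact M q q' s f (ind (At M q' s) (\<beta> q' s) v)"
      if "q \<in> Ob Q" "q' \<in> Ob Q" "s \<in> Ob S" "f \<in> carrier (Hom Q q q')"
        "v \<in> carrier (At (tensor A C) q' s)" for q q' s f v
      by (rule tensor_ext[OF mA mC that(2,3) sup_map_comp[OF sup_bimap2[OF lact_tensor_bimap] sup]
            sup_map_comp[OF sup sup_bimap2[OF lact_bimap[OF M]]]])
        (use that in \<open>simp_all add: lact_tensor_tens tens l_in l\<close>)
    show "ind (At M q s') (\<beta> q s') (ract (tensor A C) q s s' v h)
      = ract M q s s' (ind (At M q s) (\<beta> q s) v) h"
      if "q \<in> Ob Q" "s \<in> Ob S" "s' \<in> Ob S" "v \<in> carrier (At (tensor A C) q s)"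
        "h \<in> carrier (Hom S s s')" for q s s' v h
      by (rule tensor_ext[OF mA mC that(1,2) sup_map_comp[OF sup_bimap1[OF ract_tensor_bimap] sup]
            sup_map_comp[OF sup sup_bimap1[OF ract_bimap[OF M]]]])
        (use that in \<open>simp_all add: ract_tensor_tens tens r_in r\<close>)
  qed
qed

end


section \<open>The bicategory of small quantaloids\<close>

text \<open>\<open>id_hom\<close> and \<open>comp_hom\<close> name the anonymous identities and
  vertical composites inside \<open>Qtld\<close>, so that \<open>Qtld_simps\<close> can hide the
  record.\<close>

definition id_hom :: "'u qmodule \<Rightarrow> 'u qmodhom" where
  "id_hom A = extend_hom A A (\<lambda>q r a. a)"

definition comp_hom :: "'u qmodhom \<Rightarrow> 'u qmodhom \<Rightarrow> 'u qmodhom" where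
  "comp_hom \<psi> \<phi> = extend_hom (Dom \<phi>) (Cod \<psi>) (\<lambda>q r a. app \<psi> q r (app \<phi> q r a))"

lemma Qtld_simps [simp]:
  "ob Qtld = {Q. small_quantaloid Q}" "arr1 Qtld = {A. is_module A}" "src1 Qtld = Src" "trg1 Qtld = Trg"
  "arr2 Qtld = {\<phi>. is_modhom \<phi>}" "src2 Qtld = Dom" "trg2 Qtld = Cod"
  "vid Qtld = id_hom" "vcomp Qtld = comp_hom" "hid Qtld = id_module"
  "hcomp1 Qtld = tensor" "hcomp2 Qtld = tensor_hom"
  "assoc Qtld = assoc_hom" "lunit Qtld = lunit_hom" "runit Qtld = runit_hom"
  by (simp_all add: Qtld_def id_hom_def comp_hom_def fun_eq_iff)

lemma hom1_Qtld: "A \<in> hom1 Qtld Q R \<longleftrightarrow> is_module A \<and> Src A = Q \<and> Trg A = R"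
  by (simp add: hom1_def)

lemma hom2_Qtld: "\<phi> \<in> hom2 Qtld A A' \<longleftrightarrow> is_modhom \<phi> \<and> Dom \<phi> = A \<and> Cod \<phi> = A'"
  by (simp add: hom2_def)

lemma hom_simps [simp]:
  "Dom (id_hom A) = A" "Cod (id_hom A) = A" "Dom (comp_hom \<psi> \<phi>) = Dom \<phi>" "Cod (comp_hom \<psi> \<phi>) = Cod \<psi>"
  "Dom (tensor_hom \<phi> \<psi>) = tensor (Dom \<phi>) (Dom \<psi>)" "Cod (tensor_hom \<phi> \<psi>) = tensor (Cod \<phi>) (Cod \<psi>)"
  "Dom (assoc_hom A C D) = tensor (tensor A C) D" "Cod (assoc_hom A C D) = tensor A (tensor C D)"
  "Dom (lunit_hom A) = tensor (id_module (Src A)) A" "Cod (lunit_hom A) = A"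
  "Dom (runit_hom A) = tensor A (id_module (Trg A))" "Cod (runit_hom A) = A"
  by (simp_all add: id_hom_def comp_hom_def tensor_hom_def assoc_hom_def lunit_hom_def runit_hom_def)

lemma app_id_hom:
  "\<lbrakk>q \<in> Ob (Src A); r \<in> Ob (Trg A); a \<in> carrier (At A q r)\<rbrakk> \<Longrightarrow> app (id_hom A) q r a = a"
  by (simp add: id_hom_def app_extend_hom)

lemma app_comp_hom:
  "\<lbrakk>q \<in> Ob (Src (Dom \<phi>)); r \<in> Ob (Trg (Dom \<phi>)); a \<in> carrier (At (Dom \<phi>) q r)\<rbrakk>
    \<Longrightarrow> app (comp_hom \<psi> \<phi>) q r a = app \<psi> q r (app \<phi> q r a)"
  by (simp add: comp_hom_def app_extend_hom)

lemma is_modhom_id_hom: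
  assumes "is_module A"
  shows "is_modhom (id_hom A)"
  unfolding id_hom_def
  by (rule is_modhom_extend_hom[OF assms refl refl assms refl refl])
    (simp_all add: sup_map_id[OF at_lattice[OF assms refl refl]])

lemma is_modhom_comp_hom:
  assumes \<phi>: "is_modhom \<phi>" "Dom \<phi> = A" "Cod \<phi> = A'" and \<psi>: "is_modhom \<psi>" "Dom \<psi> = A'" "Cod \<psi> = A''"
  shows "is_modhom (comp_hom \<psi> \<phi>)"
proof -
  note \<phi>' = \<phi> refl refl
  note \<psi>' = \<psi> modhom_Src[OF \<phi>'] modhom_Trg[OF \<phi>']
  show ?thesis
    unfolding comp_hom_def \<phi>(2) \<psi>(3)
    by (rule is_modhom_extend_hom[OF modhom_Dom[OF \<phi>'] refl refl modhom_Cod[OF \<psi>'] modhom_Src[OF \<psi>']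
      modhom_Trg[OF \<psi>']])
      (simp_all add: sup_map_comp[OF app_sup_map[OF \<phi>'] app_sup_map[OF \<psi>']] app_lact[OF \<phi>'] app_lact[OF \<psi>']
        app_ract[OF \<phi>'] app_ract[OF \<psi>'] app_in[OF \<phi>'])
qed

lemma extend_hom_cong:
  assumes "\<And>q r a. \<lbrakk>q \<in> Ob (Src A); r \<in> Ob (Trg A); a \<in> carrier (At A q r)\<rbrakk> \<Longrightarrow> \<phi> q r a = \<psi> q r a"
  shows "extend_hom A A' \<phi> = extend_hom A A' \<psi>"
  using assms by (auto simp: extend_hom_def fun_eq_iff)

section \<open>Horizontal composition of 2-cells and the unitors\<close>

lemma
  assumes \<phi>: "is_modhom \<phi>" "Dom \<phi> = A" "Cod \<phi> = A'" and QR: "Src A = Q" "Trg A = R"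
    and \<psi>: "is_modhom \<psi>" "Dom \<psi> = C" "Cod \<psi> = C'" and RS: "Src C = R" "Trg C = S"
  shows is_modhom_tensor_hom: "is_modhom (tensor_hom \<phi> \<psi>)"
    and app_tensor_hom: "\<And>q s r a c. \<lbrakk>q \<in> Ob Q; s \<in> Ob S; r \<in> Ob R; a \<in> carrier (At A q r);
      c \<in> carrier (At C r s)\<rbrakk>
      \<Longrightarrow> app (tensor_hom \<phi> \<psi>) q s (tens A C q s r a c) = tens A' C' q s r (app \<phi> q r a) (app \<psi> r s c)"
proof -
  note \<phi>' = \<phi> QR and \<psi>' = \<psi> RS
  note mA = modhom_Dom[OF \<phi>'] QR and mC = modhom_Dom[OF \<psi>'] RS
  note mA' = modhom_Cod[OF \<phi>'] modhom_Src[OF \<phi>'] modhom_Trg[OF \<phi>']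
    and mC' = modhom_Cod[OF \<psi>'] modhom_Src[OF \<psi>'] modhom_Trg[OF \<psi>']
  define \<beta> where "\<beta> q s r a c = tens A' C' q s r (app \<phi> q r a) (app \<psi> r s c)" for q s r a c
  note M = is_module_tensor[OF mA' mC']
  have bi: "sup_bimap (At A q r) (At C r s) (At (tensor A' C') q s) (\<beta> q s r)"
    if "q \<in> Ob Q" "s \<in> Ob S" "r \<in> Ob R" for q s r
    unfolding \<beta>_def
    using sup_bimap_comp[OF app_sup_map[OF \<phi>'] app_sup_map[OF \<psi>'] tens_bimap[OF mA' mC']] that by simp
  have eq: "tensor_hom \<phi> \<psi> = extend_hom (tensor A C) (tensor A' C') (\<lambda>q s. ind (At (tensor A' C') q s)
    (\<beta> q s))"
    unfolding tensor_hom_def \<phi>(2,3) \<psi>(2,3) \<beta>_def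
  proof (rule extend_hom_cong)
    fix q s v assume "q \<in> Ob (Src (tensor A C))" "s \<in> Ob (Trg (tensor A C))"
      "v \<in> carrier (At (tensor A C) q s)"
    then have qsv: "q \<in> Ob Q" "s \<in> Ob S" "v \<in> carrier (tensor_at A C q s)" using QR RS by simp_all
    show "tensor_join A' C' q s {(r, app \<phi> q r a, app \<psi> r s c) | r a c. (r, a, c) \<in> dec v}
      = ind (At (tensor A' C') q s) (\<lambda>r a c. tens A' C' q s r (app \<phi> q r a) (app \<psi> r s c)) v"
      unfolding tensor_simps
      by (rule tensor_join_eq_ind[OF mA' mC' qsv(1,2), where f = "\<lambda>r a c. r" and g = "\<lambda>r a c. app \<phi> q r a"
            and h = "\<lambda>r a c. app \<psi> r s c"])
        (use dec_tensor[OF mA mC qsv] qsv app_in[OF \<phi>'] app_in[OF \<psi>'] in blast)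
  qed
  have sides: "Src (tensor A' C') = Q" "Trg (tensor A' C') = S" using mA' mC' by simp_all
  note [simp] = app_in[OF \<phi>'] app_in[OF \<psi>'] app_ract[OF \<phi>'] app_ract[OF \<psi>'] app_lact[OF \<phi>'] app_lact[OF \<psi>']
    lact_tensor_tens[OF mA' mC'] ract_tensor_tens[OF mA' mC'] tens_balanced[OF mA' mC']
  show "is_modhom (tensor_hom \<phi> \<psi>)"
    unfolding eq by (rule is_modhom_ind[OF mA mC M sides bi]) (simp_all add: \<beta>_def)
  show "app (tensor_hom \<phi> \<psi>) q s (tens A C q s r a c) = tens A' C' q s r (app \<phi> q r a) (app \<psi> r s c)"
    if "q \<in> Ob Q" "s \<in> Ob S" "r \<in> Ob R" "a \<in> carrier (At A q r)" "c \<in> carrier (At C r s)" for q s r a c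
    unfolding eq by (subst app_ind[OF mA mC M sides bi]) (use that in \<open>simp_all add: \<beta>_def\<close>)
qed

text \<open>For the left unitor \<open>lact_qcomp\<close> is the balance condition and also
  equivariance on the left; for the right unitor \<open>ract_qcomp\<close> does both on the other
  side. The remaining equivariance is \<open>ract_lact\<close> in either case.\<close>

lemma
  assumes mA: "is_module A" "Src A = Q" "Trg A = R"
  shows is_modhom_lunit_hom: "is_modhom (lunit_hom A)"
    and app_lunit_hom: "\<And>q r p f a. \<lbrakk>q \<in> Ob Q; r \<in> Ob R; p \<in> Ob Q; f \<in> carrier (Hom Q q p);
      a \<in> carrier (At A p r)\<rbrakk>
      \<Longrightarrow> app (lunit_hom A) q r (tens (id_module Q) A q r p f a) = lact A q p r f a"
    and is_modhom_runit_hom: "is_modhom (runit_hom A)"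
    and app_runit_hom: "\<And>q r p a h. \<lbrakk>q \<in> Ob Q; r \<in> Ob R; p \<in> Ob R; a \<in> carrier (At A q p);
      h \<in> carrier (Hom R p r)\<rbrakk>
      \<Longrightarrow> app (runit_hom A) q r (tens A (id_module R) q r p a h) = ract A q p r a h"
proof -
  have idQ: "is_module (id_module Q)" "Src (id_module Q) = Q" "Trg (id_module Q) = Q"
    and idR: "is_module (id_module R)" "Src (id_module R) = R" "Trg (id_module R) = R"
    using is_module_id_module module_Src[OF mA] module_Trg[OF mA] by simp_all
  have l: "lunit_hom A = extend_hom (tensor (id_module Q) A) A (\<lambda>q r. ind (At A q r) (\<lambda>p f a. lact A q p
    r f a))"
    and r: "runit_hom A = extend_hom (tensor A (id_module R)) A (\<lambda>q r. ind (At A q r) (\<lambda>p a h. ract A q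
      p r a h))"
    by (simp_all add: lunit_hom_def runit_hom_def ind_def[abs_def] mA)
  have bi: "sup_bimap (At (id_module Q) q p) (At A p r) (At A q r) (lact A q p r)"
    if "q \<in> Ob Q" "r \<in> Ob R" "p \<in> Ob Q" for q r p
    using lact_bimap[OF mA] that by simp
  have bi': "sup_bimap (At A q p) (At (id_module R) p r) (At A q r) (ract A q p r)"
    if "q \<in> Ob Q" "r \<in> Ob R" "p \<in> Ob R" for q r p
    using ract_bimap[OF mA] that by simp
  show "is_modhom (lunit_hom A)"
    unfolding l by (rule is_modhom_ind[OF idQ mA mA bi]) (simp_all add: lact_qcomp[OF mA] ract_lact[OF mA])
  show "is_modhom (runit_hom A)"
    unfolding r by (rule is_modhom_ind[OF mA idR mA bi']) (simp_all add: ract_qcomp[OF mA] ract_lact[OF mA])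
  show "app (lunit_hom A) q r (tens (id_module Q) A q r p f a) = lact A q p r f a"
    if "q \<in> Ob Q" "r \<in> Ob R" "p \<in> Ob Q" "f \<in> carrier (Hom Q q p)" "a \<in> carrier (At A p r)" for q r p f a
    unfolding l by (subst app_ind[OF idQ mA mA bi])
      (use that in \<open>simp_all add: lact_qcomp[OF mA] ract_lact[OF mA]\<close>)
  show "app (runit_hom A) q r (tens A (id_module R) q r p a h) = ract A q p r a h"
    if "q \<in> Ob Q" "r \<in> Ob R" "p \<in> Ob R" "a \<in> carrier (At A q p)" "h \<in> carrier (Hom R p r)" for q r p a h
    unfolding r by (subst app_ind[OF mA idR mA bi'])
      (use that in \<open>simp_all add: ract_qcomp[OF mA] ract_lact[OF mA]\<close>)
qed


text \<open>\<open>a \<otimes> (c \<otimes> d) \<mapsto> (a \<otimes> c) \<otimes> d\<close>\<close>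

definition assoc_inv :: "'u qmodule \<Rightarrow> 'u qmodule \<Rightarrow> 'u qmodule \<Rightarrow> 'u qmodhom" where
  "assoc_inv A C D = extend_hom (tensor A (tensor C D)) (tensor (tensor A C) D)
     (\<lambda>q t. ind (tensor_at (tensor A C) D q t) (\<lambda>r a. ind (tensor_at (tensor A C) D q t)
       (\<lambda>s c d. tens (tensor A C) D q t s (tens A C q s r a c) d)))"

lemma assoc_inv_simps [simp]:
  "Dom (assoc_inv A C D) = tensor A (tensor C D)" "Cod (assoc_inv A C D) = tensor (tensor A C) D"
  by (simp_all add: assoc_inv_def)

section \<open>The associator and its inverse\<close>

context
  fixes A C D :: "'u qmodule" and Q R S U :: "'u quantaloid"
  assumes mA: "is_module A" "Src A = Q" "Trg A = R" and mC: "is_module C" "Src C = R" "Trg C = S"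
    and mD: "is_module D" "Src D = S" "Trg D = U"
begin

lemma tensor_AC: "is_module (tensor A C)" "Src (tensor A C) = Q" "Trg (tensor A C) = S"
  using is_module_tensor[OF mA mC] mA mC by simp_all

lemma tensor_CD: "is_module (tensor C D)" "Src (tensor C D) = R" "Trg (tensor C D) = U"
  using is_module_tensor[OF mC mD] mC mD by simp_all

lemma tensor_AC_D: "is_module (tensor (tensor A C) D)" "Src (tensor (tensor A C) D)
  = Q" "Trg (tensor (tensor A C) D) = U"
  using is_module_tensor[OF tensor_AC mD] tensor_AC mD by simp_all

lemma tensor_A_CD: "is_module (tensor A (tensor C D))" "Src (tensor A (tensor C D))
  = Q" "Trg (tensor A (tensor C D)) = U"
  using is_module_tensor[OF mA tensor_CD] mA tensor_CD by simp_all

text \<open>Density is applied twice: once for the outer composite, and then, with \<open>d\<close>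
  fixed, to the sup-map in the inner element \<open>w\<close>.\<close>

lemma left_nested_eqI:
  assumes \<phi>: "is_modhom \<phi>" "Dom \<phi> = tensor (tensor A C) D" "Cod \<phi> = M"
    and \<psi>: "is_modhom \<psi>" "Dom \<psi> = tensor (tensor A C) D" "Cod \<psi> = M"
    and eq: "\<And>q r s t a c d. \<lbrakk>q \<in> Ob Q; r \<in> Ob R; s \<in> Ob S; t \<in> Ob U; a \<in> carrier (At A q r);
      c \<in> carrier (At C r s);
      d \<in> carrier (At D s t)\<rbrakk>
      \<Longrightarrow> app \<phi> q t (tens (tensor A C) D q t s (tens A C q s r a c) d)
        = app \<psi> q t (tens (tensor A C) D q t s (tens A C q s r a c) d)"
  shows "\<phi> = \<psi>"
proof (rule tensor_hom_eqI[OF tensor_AC mD \<phi> \<psi>])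
  fix q t s w d assume ob: "q \<in> Ob Q" "t \<in> Ob U" "s \<in> Ob S" and w: "w \<in> carrier (At (tensor A C) q s)"
    and d: "d \<in> carrier (At D s t)"
  have sup: "sup_map (tensor_at A C q s) (At M q t) (\<lambda>w. app \<chi> q t (tens (tensor A C) D q t s w d))"
    if "is_modhom \<chi>" "Dom \<chi> = tensor (tensor A C) D" "Cod \<chi> = M" for \<chi>
    using sup_map_comp[OF sup_bimap1[OF tens_bimap[OF tensor_AC mD ob] d]]
      app_sup_map[OF that tensor_AC_D(2,3) ob(1,2)] by simp
  show "app \<phi> q t (tens (tensor A C) D q t s w d) = app \<psi> q t (tens (tensor A C) D q t s w d)"
    by (rule tensor_ext[OF mA mC ob(1,3) sup[OF \<phi>] sup[OF \<psi>]]) (use w ob d eq in simp_all)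
qed

lemma right_nested_eqI:
  assumes \<phi>: "is_modhom \<phi>" "Dom \<phi> = tensor A (tensor C D)" "Cod \<phi> = M"
    and \<psi>: "is_modhom \<psi>" "Dom \<psi> = tensor A (tensor C D)" "Cod \<psi> = M"
    and eq: "\<And>q r s t a c d. \<lbrakk>q \<in> Ob Q; r \<in> Ob R; s \<in> Ob S; t \<in> Ob U; a \<in> carrier (At A q r);
      c \<in> carrier (At C r s);
      d \<in> carrier (At D s t)\<rbrakk>
      \<Longrightarrow> app \<phi> q t (tens A (tensor C D) q t r a (tens C D r t s c d))
        = app \<psi> q t (tens A (tensor C D) q t r a (tens C D r t s c d))"
  shows "\<phi> = \<psi>"
proof (rule tensor_hom_eqI[OF mA tensor_CD \<phi> \<psi>])
  fix q t r a w assume ob: "q \<in> Ob Q" "t \<in> Ob U" "r \<in> Ob R" and a: "a \<in> carrier (At A q r)"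
    and w: "w \<in> carrier (At (tensor C D) r t)"
  have sup: "sup_map (tensor_at C D r t) (At M q t) (\<lambda>w. app \<chi> q t (tens A (tensor C D) q t r a w))"
    if "is_modhom \<chi>" "Dom \<chi> = tensor A (tensor C D)" "Cod \<chi> = M" for \<chi>
    using sup_map_comp[OF sup_bimap2[OF tens_bimap[OF mA tensor_CD ob] a]]
      app_sup_map[OF that tensor_A_CD(2,3) ob(1,2)] by simp
  show "app \<phi> q t (tens A (tensor C D) q t r a w) = app \<psi> q t (tens A (tensor C D) q t r a w)"
    by (rule tensor_ext[OF mC mD ob(3,2) sup[OF \<phi>] sup[OF \<psi>]]) (use w ob a eq in simp_all)
qed

text \<open>The definition takes one supremum over generators of generators. It is recognised as the
  map induced by \<open>\<beta>\<close>, where \<open>\<beta>\<close> for fixed \<open>d\<close> is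
  in turn induced by \<open>\<gamma>\<close>; the recipe \<open>is_modhom_ind\<close> then applies
  to \<open>\<beta>\<close>.\<close>

lemma
  shows is_modhom_assoc_hom: "is_modhom (assoc_hom A C D)"
    and app_assoc_hom: "\<And>q r s t a c d. \<lbrakk>q \<in> Ob Q; r \<in> Ob R; s \<in> Ob S; t \<in> Ob U; a \<in> carrier (At A q r);
      c \<in> carrier (At C r s); d \<in> carrier (At D s t)\<rbrakk>
      \<Longrightarrow> app (assoc_hom A C D) q t (tens (tensor A C) D q t s (tens A C q s r a c) d)
        = tens A (tensor C D) q t r a (tens C D r t s c d)"
proof -
  let ?F = "tensor A C" and ?G = "tensor C D"
  let ?N = "tensor A ?G"
  define \<gamma> where "\<gamma> q t s d r a c = tens A ?G q t r a (tens C D r t s c d)" for q t s d r a c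
  define \<beta> where "\<beta> q t s w d = ind (tensor_at A ?G q t) (\<gamma> q t s d) w" for q t s w d
  note N = tensor_lattice[OF mA tensor_CD]
  have \<gamma>_bi: "sup_bimap (At A q r) (At C r s) (tensor_at A ?G q t) (\<gamma> q t s d r)"
    if "q \<in> Ob Q" "t \<in> Ob U" "s \<in> Ob S" "d \<in> carrier (At D s t)" "r \<in> Ob R" for q t s d r
    unfolding \<gamma>_def using that sup_bimap1[OF tens_bimap[OF mC mD] that(4)]
    by (intro sup_bimap_comp[OF sup_map_id[OF at_lattice[OF mA]] _ tens_bimap[OF mA tensor_CD]]) simp_all
  have \<gamma>_sup: "sup_map (At D s t) (tensor_at A ?G q t) (\<lambda>d. \<gamma> q t s d r a c)"
    if "q \<in> Ob Q" "t \<in> Ob U" "s \<in> Ob S" "r \<in> Ob R" "a \<in> carrier (At A q r)" "c \<in> carrier (At C r s)"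
      for q t s r a c
    unfolding \<gamma>_def
    using sup_map_comp[OF sup_bimap2[OF tens_bimap[OF mC mD that(4,2,3)] that(6)]]
      sup_bimap2[OF tens_bimap[OF mA tensor_CD that(1,2,4)] that(5)]
    by simp
  have \<gamma>_bal: "\<gamma> q t s d r' (ract A q r r' a h) c = \<gamma> q t s d r a (lact C r r' s h c)"
    if "q \<in> Ob Q" "t \<in> Ob U" "s \<in> Ob S" "d \<in> carrier (At D s t)" "r \<in> Ob R" "r' \<in> Ob R"
      "a \<in> carrier (At A q r)"
      "h \<in> carrier (Hom R r r')" "c \<in> carrier (At C r' s)" for q t s d r r' a h c
    unfolding \<gamma>_def using that tens_in[OF mC mD]
      by (simp add: tens_balanced[OF mA tensor_CD] lact_tensor_tens[OF mC mD])
  have \<beta>1: "sup_map (tensor_at A C q s) (tensor_at A ?G q t) (\<lambda>w. \<beta> q t s w d)"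
    if "q \<in> Ob Q" "t \<in> Ob U" "s \<in> Ob S" "d \<in> carrier (At D s t)" for q t s d
    unfolding \<beta>_def using that by (intro ind_sup_map[OF mA mC that(1,3)
      N[OF that(1,2)] \<gamma>_bi[OF that] \<gamma>_bal[OF that]])
  have \<beta>_tens: "\<beta> q t s (tens A C q s r a c) d = \<gamma> q t s d r a c"
    if "q \<in> Ob Q" "t \<in> Ob U" "s \<in> Ob S" "d \<in> carrier (At D s t)" "r \<in> Ob R" "a \<in> carrier (At A q r)"
      "c \<in> carrier (At C r s)"
    for q t s d r a c
    unfolding \<beta>_def using that
    by (intro ind_tens[OF mA mC that(1,3) N[OF that(1,2)] \<gamma>_bi[OF that(1-4)] \<gamma>_bal[OF that(1-4)]])
  have bi: "sup_bimap (At ?F q s) (At D s t) (At ?N q t) (\<beta> q t s)"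
    if "q \<in> Ob Q" "t \<in> Ob U" "s \<in> Ob S" for q t s
    unfolding sup_bimap_def tensor_simps
  proof (intro conjI ballI)
    \<comment> \<open>The supremum hidden in \<open>\<beta>\<close> ranges over
      \<open>dec w\<close>, which does not involve \<open>d\<close>.\<close>
    show "sup_map (At D s t) (tensor_at A ?G q t) (\<beta> q t s w)" if w: "w \<in> carrier (tensor_at A C q s)" for w
      unfolding \<beta>_def
      by (rule ind_param_sup_map[OF mA mC \<open>q \<in> Ob Q\<close> \<open>s \<in> Ob S\<close> N[OF \<open>q \<in> Ob Q\<close> \<open>t \<in> Ob U\<close>]
        at_lattice[OF mD \<open>s \<in> Ob S\<close> \<open>t \<in> Ob U\<close>]
            \<gamma>_sup[OF \<open>q \<in> Ob Q\<close> \<open>t \<in> Ob U\<close> \<open>s \<in> Ob S\<close>] w])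
  qed (rule \<beta>1[OF that])
  have bal: "\<beta> q t s' (ract ?F q s s' w h) d = \<beta> q t s w (lact D s s' t h d)"
    if "q \<in> Ob Q" "t \<in> Ob U" "s \<in> Ob S" "s' \<in> Ob S" "w \<in> carrier (At ?F q s)" "h \<in> carrier (Hom S s s')"
      "d \<in> carrier (At D s' t)"
    for q t s s' w h d
    by (rule tensor_ext[OF mA mC that(1,3) sup_map_comp[OF sup_bimap1[OF ract_tensor_bimap[OF mA mC]] \<beta>1] \<beta>1])
      (use that in \<open>simp_all add: lact_in[OF mD] ract_in[OF mC] ract_tensor_tens[OF mA mC] \<beta>_tens \<gamma>_def
        tens_balanced[OF mC mD]\<close>)
  have l: "\<beta> q t s (lact ?F q q' s f w) d = lact ?N q q' t f (\<beta> q' t s w d)"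
    if "q \<in> Ob Q" "q' \<in> Ob Q" "t \<in> Ob U" "s \<in> Ob S" "f \<in> carrier (Hom Q q q')"
      "w \<in> carrier (At ?F q' s)" "d \<in> carrier (At D s t)"
    for q q' t s f w d
    by (rule tensor_ext[OF mA mC that(2,4) sup_map_comp[OF sup_bimap2[OF lact_tensor_bimap[OF mA mC]] \<beta>1]
          sup_map_comp[OF \<beta>1 sup_bimap2[OF lact_tensor_bimap[OF mA tensor_CD]]]])
      (use that in \<open>simp_all add: lact_in[OF mA] lact_tensor_tens[OF mA mC]
        lact_tensor_tens[OF mA tensor_CD] \<beta>_tens \<gamma>_def tens_in[OF mC mD]\<close>)
  have r: "\<beta> q t' s w (ract D s t t' d h) = ract ?N q t t' (\<beta> q t s w d) h"
    if "q \<in> Ob Q" "t \<in> Ob U" "t' \<in> Ob U" "s \<in> Ob S" "w \<in> carrier (At ?F q s)" "d \<in> carrier (At D s t)"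
      "h \<in> carrier (Hom U t t')"
    for q t t' s w d h
    by (rule tensor_ext[OF mA mC that(1,4) \<beta>1 sup_map_comp[OF \<beta>1
      sup_bimap1[OF ract_tensor_bimap[OF mA tensor_CD]]]])
      (use that in \<open>simp_all add: ract_in[OF mD] ract_tensor_tens[OF mC mD]
        ract_tensor_tens[OF mA tensor_CD] \<beta>_tens \<gamma>_def tens_in[OF mC mD]\<close>)
  have eq: "assoc_hom A C D = extend_hom (tensor ?F D) ?N (\<lambda>q t. ind (At ?N q t) (\<beta> q t))"
    unfolding assoc_hom_def
  proof (rule extend_hom_cong)
    fix q t v assume "q \<in> Ob (Src (tensor ?F D))" "t \<in> Ob (Trg (tensor ?F D))"
      "v \<in> carrier (At (tensor ?F D) q t)"
    then have q: "q \<in> Ob Q" and t: "t \<in> Ob U" and v: "v \<in> carrier (tensor_at ?F D q t)"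
      using tensor_AC_D by simp_all
    let ?J = "{(r, a, tensor_join C D r t {(s, c, d)}) | r a s c d. \<exists>w. (s, w, d) \<in> dec v \<and> (r, a,
      c) \<in> dec w}"
    have dec_v: "s \<in> Ob S \<and> w \<in> carrier (tensor_at A C q s) \<and> d \<in> carrier (At D s t)"
      if "(s, w, d) \<in> dec v" for s w d
      using dec_tensor[OF tensor_AC mD q t v that] by simp
    have dec_w: "r \<in> Ob R \<and> a \<in> carrier (At A q r) \<and> c \<in> carrier (At C r s)"
      if "(s, w, d) \<in> dec v" "(r, a, c) \<in> dec w" for s w d r a c
      using dec_tensor[OF mA mC q _ _ that(2)] dec_v[OF that(1)] by blast
    have J: "r \<in> Ob R \<and> a \<in> carrier (At A q r) \<and> u \<in> carrier (At ?G r t)" if "(r, a, u) \<in> ?J" for r a u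
      using that dec_v dec_w tens_in[OF mC mD] t by (auto simp: tens_def[symmetric])
    have E: "{tens A ?G q t r a u | r a u. (r, a, u) \<in> ?J}
        = {\<gamma> q t s d r a c | s d r a c. \<exists>w. (s, w, d) \<in> dec v \<and> (r, a, c) \<in> dec w}"
      unfolding \<gamma>_def tens_def[of C D] by blast
    have E_sub: "{tens A ?G q t r a u | r a u. (r, a, u) \<in> ?J} \<subseteq> carrier (tensor_at A ?G q t)"
      using J tens_in[OF mA tensor_CD q t] by blast
    have \<gamma>_in: "\<gamma> q t s d r a c \<in> carrier (tensor_at A ?G q t)"
      if "s \<in> Ob S" "d \<in> carrier (At D s t)" "r \<in> Ob R" "a \<in> carrier (At A q r)"
        "c \<in> carrier (At C r s)" for s d r a c
      using sup_bimap_in[OF \<gamma>_bi] q t that by blast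
    have \<beta>_in: "\<beta> q t s w d \<in> carrier (tensor_at A ?G q t)"
      if "s \<in> Ob S" "w \<in> carrier (At ?F q s)" "d \<in> carrier (At D s t)" for s w d
      using sup_bimap_in[OF bi[OF q t that(1)] that(2,3)] by simp
    have K: "tensor_join A ?G q t ?J = \<Squnion>\<^bsub>tensor_at A ?G q t\<^esub> {tens A ?G q t r a u | r a u. (r, a, u) \<in> ?J}"
      by (rule tensor_join_eq_Sup[OF mA tensor_CD q t J])
    \<comment> \<open>A nested supremum and a single one have the same upper bounds:
      \<open>m\<close> lies above either side exactly when it lies above
      \<open>\<gamma> q t s d r a c\<close> for all \<open>(s, w, d) \<in> dec v\<close> and
      \<open>(r, a, c) \<in> dec w\<close>.\<close>
    show "tensor_join A ?G q t ?J = ind (At ?N q t) (\<beta> q t) v"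
    proof (rule complete_lattice_eqI_above[OF N[OF q t]])
      show "tensor_join A ?G q t ?J \<in> carrier (tensor_at A ?G q t)"
        by (subst K) (rule sup_le_iff(1)[OF N[OF q t] E_sub])
      show "ind (At ?N q t) (\<beta> q t) v \<in> carrier (tensor_at A ?G q t)"
        using ind_in[OF tensor_AC mD q t N[OF q t] \<beta>_in v] by simp
      fix m assume m: "m \<in> carrier (tensor_at A ?G q t)"
      have "tensor_join A ?G q t ?J \<sqsubseteq>\<^bsub>tensor_at A ?G q t\<^esub> m
        \<longleftrightarrow> (\<forall>y \<in> {tens A ?G q t r a u | r a u. (r, a, u) \<in> ?J}. y \<sqsubseteq>\<^bsub>tensor_at A ?G q t\<^esub> m)"
        by (subst K) (rule sup_le_iff(2)[OF N[OF q t] E_sub m])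
      also have "\<dots> \<longleftrightarrow> (\<forall>s w d. (s, w, d) \<in> dec v \<longrightarrow> (\<forall>r a c. (r, a,
        c) \<in> dec w \<longrightarrow> \<gamma> q t s d r a c \<sqsubseteq>\<^bsub>tensor_at A ?G q t\<^esub> m))"
        unfolding E by blast
      also have "\<dots> \<longleftrightarrow> (\<forall>s w d. (s, w, d) \<in> dec v \<longrightarrow> \<beta> q t s w d \<sqsubseteq>\<^bsub>tensor_at A ?G q t\<^esub> m)"
      proof -
        have "\<beta> q t s w d \<sqsubseteq>\<^bsub>tensor_at A ?G q t\<^esub> m
          \<longleftrightarrow> (\<forall>r a c. (r, a, c) \<in> dec w \<longrightarrow> \<gamma> q t s d r a c \<sqsubseteq>\<^bsub>tensor_at A ?G q t\<^esub> m)"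
          if "(s, w, d) \<in> dec v" for s w d
          unfolding \<beta>_def
          by (rule ind_le_iff[OF mA mC q _ N[OF q t] \<gamma>_in _ m]) (use dec_v[OF that] in blast)+
        then show ?thesis by blast
      qed
      also have "\<dots> \<longleftrightarrow> ind (At ?N q t) (\<beta> q t) v \<sqsubseteq>\<^bsub>tensor_at A ?G q t\<^esub> m"
        using ind_le_iff[OF tensor_AC mD q t N[OF q t] \<beta>_in v m] by simp
      finally show "tensor_join A ?G q t ?J \<sqsubseteq>\<^bsub>tensor_at A ?G q t\<^esub> m
        \<longleftrightarrow> ind (At ?N q t) (\<beta> q t) v \<sqsubseteq>\<^bsub>tensor_at A ?G q t\<^esub> m" .
    qed
  qed
  show "is_modhom (assoc_hom A C D)"
    unfolding eq by (rule is_modhom_ind[OF tensor_AC mD tensor_A_CD bi bal l r])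
  show "app (assoc_hom A C D) q t (tens ?F D q t s (tens A C q s r a c) d)
    = tens A ?G q t r a (tens C D r t s c d)"
    if "q \<in> Ob Q" "r \<in> Ob R" "s \<in> Ob S" "t \<in> Ob U" "a \<in> carrier (At A q r)" "c \<in> carrier (At C r s)"
      "d \<in> carrier (At D s t)" for q r s t a c d
    unfolding eq using that app_ind[OF tensor_AC mD tensor_A_CD bi bal l r, of q t s "tens A C q s r a c" d]
    by (simp add: tens_in[OF mA mC] \<beta>_tens \<gamma>_def)
qed

text \<open>The mirror image of the associator. Because \<open>assoc_inv\<close> is defined with
  nested \<open>ind\<close> from the start, unfolding takes the place of the comparison of
  suprema.\<close>

lemma
  shows is_modhom_assoc_inv: "is_modhom (assoc_inv A C D)"
    and app_assoc_inv: "\<And>q r s t a c d. \<lbrakk>q \<in> Ob Q; r \<in> Ob R; s \<in> Ob S; t \<in> Ob U; a \<in> carrier (At A q r);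
      c \<in> carrier (At C r s); d \<in> carrier (At D s t)\<rbrakk>
      \<Longrightarrow> app (assoc_inv A C D) q t (tens A (tensor C D) q t r a (tens C D r t s c d))
        = tens (tensor A C) D q t s (tens A C q s r a c) d"
proof -
  let ?F = "tensor A C" and ?G = "tensor C D"
  let ?N = "tensor ?F D"
  define \<gamma> where "\<gamma> q t r a s c d = tens ?F D q t s (tens A C q s r a c) d" for q t r a s c d
  define \<beta> where "\<beta> q t r a = ind (tensor_at ?F D q t) (\<gamma> q t r a)" for q t r a
  note N = tensor_lattice[OF tensor_AC mD]
  have \<gamma>_bi: "sup_bimap (At C r s) (At D s t) (tensor_at ?F D q t) (\<gamma> q t r a s)"
    if "q \<in> Ob Q" "t \<in> Ob U" "r \<in> Ob R" "a \<in> carrier (At A q r)" "s \<in> Ob S" for q t r a s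
    unfolding \<gamma>_def using that sup_bimap2[OF tens_bimap[OF mA mC] that(4)]
    by (intro sup_bimap_comp[OF _ sup_map_id[OF at_lattice[OF mD]] tens_bimap[OF tensor_AC mD]]) simp_all
  have \<gamma>_sup: "sup_map (At A q r) (tensor_at ?F D q t) (\<lambda>a. \<gamma> q t r a s c d)"
    if "q \<in> Ob Q" "t \<in> Ob U" "r \<in> Ob R" "s \<in> Ob S" "c \<in> carrier (At C r s)" "d \<in> carrier (At D s t)"
      for q t r s c d
    unfolding \<gamma>_def
    using sup_map_comp[OF sup_bimap1[OF tens_bimap[OF mA mC that(1,4,3)] that(5)]]
      sup_bimap1[OF tens_bimap[OF tensor_AC mD that(1,2,4)] that(6)]
    by simp
  have \<gamma>_bal: "\<gamma> q t r a s' (ract C r s s' c h) d = \<gamma> q t r a s c (lact D s s' t h d)"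
    if "q \<in> Ob Q" "t \<in> Ob U" "r \<in> Ob R" "a \<in> carrier (At A q r)" "s \<in> Ob S" "s' \<in> Ob S"
      "c \<in> carrier (At C r s)"
      "h \<in> carrier (Hom S s s')" "d \<in> carrier (At D s' t)" for q t r a s s' c h d
    unfolding \<gamma>_def using that tens_in[OF mA mC] tens_balanced[OF tensor_AC mD, of q t s s'
      "tens A C q s r a c" h d]
    by (simp add: ract_tensor_tens[OF mA mC])
  have \<beta>2: "sup_map (tensor_at C D r t) (tensor_at ?F D q t) (\<beta> q t r a)"
    if "q \<in> Ob Q" "t \<in> Ob U" "r \<in> Ob R" "a \<in> carrier (At A q r)" for q t r a
    unfolding \<beta>_def using that by (intro ind_sup_map[OF mC mD that(3,2)
      N[OF that(1,2)] \<gamma>_bi[OF that] \<gamma>_bal[OF that]])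
  have \<beta>_tens: "\<beta> q t r a (tens C D r t s c d) = \<gamma> q t r a s c d"
    if "q \<in> Ob Q" "t \<in> Ob U" "r \<in> Ob R" "a \<in> carrier (At A q r)" "s \<in> Ob S" "c \<in> carrier (At C r s)"
      "d \<in> carrier (At D s t)"
    for q t r a s c d
    unfolding \<beta>_def using that
    by (intro ind_tens[OF mC mD that(3,2) N[OF that(1,2)] \<gamma>_bi[OF that(1-4)] \<gamma>_bal[OF that(1-4)]])
  have bi: "sup_bimap (At A q r) (At ?G r t) (At ?N q t) (\<beta> q t r)"
    if "q \<in> Ob Q" "t \<in> Ob U" "r \<in> Ob R" for q t r
    unfolding sup_bimap_def tensor_simps
  proof (intro conjI ballI)
    show "sup_map (At A q r) (tensor_at ?F D q t) (\<lambda>a. \<beta> q t r a w)"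
      if w: "w \<in> carrier (tensor_at C D r t)" for w
      unfolding \<beta>_def
      by (rule ind_param_sup_map[OF mC mD \<open>r \<in> Ob R\<close> \<open>t \<in> Ob U\<close> N[OF \<open>q \<in> Ob Q\<close> \<open>t \<in> Ob U\<close>]
        at_lattice[OF mA \<open>q \<in> Ob Q\<close> \<open>r \<in> Ob R\<close>]
            \<gamma>_sup[OF \<open>q \<in> Ob Q\<close> \<open>t \<in> Ob U\<close> \<open>r \<in> Ob R\<close>] w])
  qed (rule \<beta>2[OF that])
  have bal: "\<beta> q t r' (ract A q r r' a h) w = \<beta> q t r a (lact ?G r r' t h w)"
    if "q \<in> Ob Q" "t \<in> Ob U" "r \<in> Ob R" "r' \<in> Ob R" "a \<in> carrier (At A q r)" "h \<in> carrier (Hom R r r')"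
      "w \<in> carrier (At ?G r' t)"
    for q t r r' a h w
    by (rule tensor_ext[OF mC mD that(4,2) \<beta>2 sup_map_comp[OF sup_bimap2[OF lact_tensor_bimap[OF mC mD]] \<beta>2]])
      (use that in \<open>simp_all add: lact_in[OF mC] ract_in[OF mA] lact_tensor_tens[OF mC mD] \<beta>_tens \<gamma>_def
        tens_balanced[OF mA mC]\<close>)
  have l: "\<beta> q t r (lact A q q' r f a) w = lact ?N q q' t f (\<beta> q' t r a w)"
    if "q \<in> Ob Q" "q' \<in> Ob Q" "t \<in> Ob U" "r \<in> Ob R" "f \<in> carrier (Hom Q q q')" "a \<in> carrier (At A q' r)"
      "w \<in> carrier (At ?G r t)"
    for q q' t r f a w
    by (rule tensor_ext[OF mC mD that(4,3) \<beta>2 sup_map_comp[OF \<beta>2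
      sup_bimap2[OF lact_tensor_bimap[OF tensor_AC mD]]]])
      (use that in \<open>simp_all add: lact_in[OF mA] lact_tensor_tens[OF mA mC]
        lact_tensor_tens[OF tensor_AC mD] \<beta>_tens \<gamma>_def tens_in[OF mA mC]\<close>)
  have r: "\<beta> q t' r a (ract ?G r t t' w h) = ract ?N q t t' (\<beta> q t r a w) h"
    if "q \<in> Ob Q" "t \<in> Ob U" "t' \<in> Ob U" "r \<in> Ob R" "a \<in> carrier (At A q r)" "w \<in> carrier (At ?G r t)"
      "h \<in> carrier (Hom U t t')"
    for q t t' r a w h
    by (rule tensor_ext[OF mC mD that(4,2) sup_map_comp[OF sup_bimap1[OF ract_tensor_bimap[OF mC mD]] \<beta>2]
          sup_map_comp[OF \<beta>2 sup_bimap1[OF ract_tensor_bimap[OF tensor_AC mD]]]])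
      (use that in \<open>simp_all add: ract_in[OF mD] ract_tensor_tens[OF mC mD]
        ract_tensor_tens[OF tensor_AC mD] \<beta>_tens \<gamma>_def tens_in[OF mA mC]\<close>)
  have eq: "assoc_inv A C D = extend_hom (tensor A ?G) ?N (\<lambda>q t. ind (At ?N q t) (\<beta> q t))"
    unfolding assoc_inv_def \<beta>_def \<gamma>_def by simp
  show "is_modhom (assoc_inv A C D)"
    unfolding eq by (rule is_modhom_ind[OF mA tensor_CD tensor_AC_D bi bal l r])
  show "app (assoc_inv A C D) q t (tens A ?G q t r a (tens C D r t s c d))
    = tens ?F D q t s (tens A C q s r a c) d"
    if "q \<in> Ob Q" "r \<in> Ob R" "s \<in> Ob S" "t \<in> Ob U" "a \<in> carrier (At A q r)" "c \<in> carrier (At C r s)"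
      "d \<in> carrier (At D s t)" for q r s t a c d
    unfolding eq using that app_ind[OF mA tensor_CD tensor_AC_D bi bal l r, of q t r a "tens C D r t s c d"]
    by (simp add: tens_in[OF mC mD] \<beta>_tens \<gamma>_def)
qed

end


section \<open>Typing and evaluation rules phrased with \<open>hom1 Qtld\<close> and
  \<open>hom2 Qtld\<close>\<close>

lemma hom1D:
  assumes "A \<in> hom1 Qtld Q R"
  shows "is_module A" "Src A = Q" "Trg A = R"
  using assms by (simp_all add: hom1_Qtld)

lemma hom2D:
  assumes "\<phi> \<in> hom2 Qtld A A'"
  shows "is_modhom \<phi>" "Dom \<phi> = A" "Cod \<phi> = A'"
  using assms by (simp_all add: hom2_Qtld)

lemma hom2_Cod:
  assumes \<phi>: "\<phi> \<in> hom2 Qtld A A'" and A: "A \<in> hom1 Qtld Q R"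
  shows "A' \<in> hom1 Qtld Q R"
proof -
  note \<phi>' = hom2D[OF \<phi>] hom1D(2,3)[OF A]
  show ?thesis using modhom_Cod[OF \<phi>'] modhom_Src[OF \<phi>'] modhom_Trg[OF \<phi>'] by (simp add: hom1_Qtld)
qed

lemma id_module_hom1: "small_quantaloid Q \<Longrightarrow> id_module Q \<in> hom1 Qtld Q Q"
  by (simp add: hom1_Qtld is_module_id_module)

lemma hom1_quantaloid: "A \<in> hom1 Qtld Q R \<Longrightarrow> small_quantaloid Q \<and> small_quantaloid R"
  using module_Src module_Trg unfolding hom1_Qtld by metis

lemma tensor_hom1: "A \<in> hom1 Qtld Q R \<Longrightarrow> C \<in> hom1 Qtld R S \<Longrightarrow> tensor A C \<in> hom1 Qtld Q S"
  using is_module_tensor[OF hom1D hom1D] by (simp add: hom1_Qtld)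

lemma id_hom2: "A \<in> hom1 Qtld Q R \<Longrightarrow> id_hom A \<in> hom2 Qtld A A"
  by (simp add: hom1_Qtld hom2_Qtld is_modhom_id_hom)

lemma comp_hom2: "\<phi> \<in> hom2 Qtld A A' \<Longrightarrow> \<psi> \<in> hom2 Qtld A' A'' \<Longrightarrow> comp_hom \<psi> \<phi> \<in> hom2 Qtld A A''"
  using is_modhom_comp_hom[OF hom2D hom2D] by (simp add: hom2_Qtld)

lemma tensor_hom2:
  "\<lbrakk>A \<in> hom1 Qtld Q R; C \<in> hom1 Qtld R S; \<phi> \<in> hom2 Qtld A A'; \<psi> \<in> hom2 Qtld C C'\<rbrakk>
    \<Longrightarrow> tensor_hom \<phi> \<psi> \<in> hom2 Qtld (tensor A C) (tensor A' C')"
  using is_modhom_tensor_hom[OF hom2D _ _ hom2D] hom1D by (simp add: hom2_Qtld)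

lemma assoc_hom2:
  "\<lbrakk>A \<in> hom1 Qtld Q R; C \<in> hom1 Qtld R S; D \<in> hom1 Qtld S U\<rbrakk>
    \<Longrightarrow> assoc_hom A C D \<in> hom2 Qtld (tensor (tensor A C) D) (tensor A (tensor C D))"
  using is_modhom_assoc_hom[OF hom1D hom1D hom1D] by (simp add: hom2_Qtld)

lemma assoc_inv2:
  "\<lbrakk>A \<in> hom1 Qtld Q R; C \<in> hom1 Qtld R S; D \<in> hom1 Qtld S U\<rbrakk>
    \<Longrightarrow> assoc_inv A C D \<in> hom2 Qtld (tensor A (tensor C D)) (tensor (tensor A C) D)"
  using is_modhom_assoc_inv[OF hom1D hom1D hom1D] by (simp add: hom2_Qtld)

lemma lunit_hom2: "A \<in> hom1 Qtld Q R \<Longrightarrow> lunit_hom A \<in> hom2 Qtld (tensor (id_module Q) A) A"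
  and runit_hom2: "A \<in> hom1 Qtld Q R \<Longrightarrow> runit_hom A \<in> hom2 Qtld (tensor A (id_module R)) A"
  using is_modhom_lunit_hom is_modhom_runit_hom by (simp_all add: hom2_Qtld hom1_Qtld)

lemmas hom_intros = id_module_hom1 tensor_hom1 id_hom2 comp_hom2 tensor_hom2 assoc_hom2 assoc_inv2
  lunit_hom2 runit_hom2

lemma hom2_eqI:
  assumes "A \<in> hom1 Qtld Q R" "\<phi> \<in> hom2 Qtld A A'" "\<psi> \<in> hom2 Qtld A A'"
    and "\<And>q r a. \<lbrakk>q \<in> Ob Q; r \<in> Ob R; a \<in> carrier (At A q r)\<rbrakk> \<Longrightarrow> app \<phi> q r a = app \<psi> q r a"
  shows "\<phi> = \<psi>"
  by (rule modhom_eqI[OF hom2D[OF assms(2)] hom2D[OF assms(3)]]) (use assms(4) hom1D[OF assms(1)] in simp)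

lemma tensor_hom2_eqI:
  assumes "A \<in> hom1 Qtld Q R" "C \<in> hom1 Qtld R S" "\<phi> \<in> hom2 Qtld (tensor A C) M" "\<psi>
    \<in> hom2 Qtld (tensor A C) M"
    and "\<And>q s r a c. \<lbrakk>q \<in> Ob Q; s \<in> Ob S; r \<in> Ob R; a \<in> carrier (At A q r); c \<in> carrier (At C r s)\<rbrakk>
      \<Longrightarrow> app \<phi> q s (tens A C q s r a c) = app \<psi> q s (tens A C q s r a c)"
  shows "\<phi> = \<psi>"
  by (rule tensor_hom_eqI[OF hom1D[OF assms(1)] hom1D[OF assms(2)] hom2D[OF assms(3)]
    hom2D[OF assms(4)] assms(5)])

lemma left_nested_hom2_eqI:
  assumes "A \<in> hom1 Qtld Q R" "C \<in> hom1 Qtld R S" "D \<in> hom1 Qtld S U"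
    "\<phi> \<in> hom2 Qtld (tensor (tensor A C) D) M" "\<psi> \<in> hom2 Qtld (tensor (tensor A C) D) M"
    and "\<And>q r s t a c d. \<lbrakk>q \<in> Ob Q; r \<in> Ob R; s \<in> Ob S; t \<in> Ob U; a \<in> carrier (At A q r);
      c \<in> carrier (At C r s);
      d \<in> carrier (At D s t)\<rbrakk>
      \<Longrightarrow> app \<phi> q t (tens (tensor A C) D q t s (tens A C q s r a c) d)
        = app \<psi> q t (tens (tensor A C) D q t s (tens A C q s r a c) d)"
  shows "\<phi> = \<psi>"
  by (rule left_nested_eqI[OF hom1D[OF assms(1)] hom1D[OF assms(2)] hom1D[OF assms(3)]
    hom2D[OF assms(4)] hom2D[OF assms(5)] assms(6)])

lemma right_nested_hom2_eqI:
  assumes "A \<in> hom1 Qtld Q R" "C \<in> hom1 Qtld R S" "D \<in> hom1 Qtld S U"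
    "\<phi> \<in> hom2 Qtld (tensor A (tensor C D)) M" "\<psi> \<in> hom2 Qtld (tensor A (tensor C D)) M"
    and "\<And>q r s t a c d. \<lbrakk>q \<in> Ob Q; r \<in> Ob R; s \<in> Ob S; t \<in> Ob U; a \<in> carrier (At A q r);
      c \<in> carrier (At C r s);
      d \<in> carrier (At D s t)\<rbrakk>
      \<Longrightarrow> app \<phi> q t (tens A (tensor C D) q t r a (tens C D r t s c d))
        = app \<psi> q t (tens A (tensor C D) q t r a (tens C D r t s c d))"
  shows "\<phi> = \<psi>"
  by (rule right_nested_eqI[OF hom1D[OF assms(1)] hom1D[OF assms(2)] hom1D[OF assms(3)]
    hom2D[OF assms(4)] hom2D[OF assms(5)] assms(6)])

lemma tens_in_hom1:
  assumes "A \<in> hom1 Qtld Q R" "C \<in> hom1 Qtld R S"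
  shows "\<lbrakk>q \<in> Ob Q; s \<in> Ob S; r \<in> Ob R; a \<in> carrier (At A q r); c \<in> carrier (At C r s)\<rbrakk>
    \<Longrightarrow> tens A C q s r a c \<in> carrier (tensor_at A C q s)"
  by (rule tens_in[OF hom1D[OF assms(1)] hom1D[OF assms(2)]])

lemma app_in_hom2:
  assumes "\<phi> \<in> hom2 Qtld A A'" "A \<in> hom1 Qtld Q R"
  shows "\<lbrakk>q \<in> Ob Q; r \<in> Ob R; a \<in> carrier (At A q r)\<rbrakk> \<Longrightarrow> app \<phi> q r a \<in> carrier (At A' q r)"
  by (rule app_in[OF hom2D[OF assms(1)] hom1D(2,3)[OF assms(2)]])

lemma app_tensor_hom2:
  assumes "\<phi> \<in> hom2 Qtld A A'" "A \<in> hom1 Qtld Q R" "\<psi> \<in> hom2 Qtld C C'" "C \<in> hom1 Qtld R S"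
  shows "\<lbrakk>q \<in> Ob Q; s \<in> Ob S; r \<in> Ob R; a \<in> carrier (At A q r); c \<in> carrier (At C r s)\<rbrakk>
    \<Longrightarrow> app (tensor_hom \<phi> \<psi>) q s (tens A C q s r a c) = tens A' C' q s r (app \<phi> q r a) (app \<psi> r s c)"
  by (rule app_tensor_hom[OF hom2D[OF assms(1)] hom1D(2,3)[OF assms(2)]
    hom2D[OF assms(3)] hom1D(2,3)[OF assms(4)]])

lemma app_assoc_hom2:
  assumes "A \<in> hom1 Qtld Q R" "C \<in> hom1 Qtld R S" "D \<in> hom1 Qtld S U"
  shows "\<lbrakk>q \<in> Ob Q; r \<in> Ob R; s \<in> Ob S; t \<in> Ob U; a \<in> carrier (At A q r); c \<in> carrier (At C r s);
    d \<in> carrier (At D s t)\<rbrakk>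
    \<Longrightarrow> app (assoc_hom A C D) q t (tens (tensor A C) D q t s (tens A C q s r a c) d)
      = tens A (tensor C D) q t r a (tens C D r t s c d)"
    and "\<lbrakk>q \<in> Ob Q; r \<in> Ob R; s \<in> Ob S; t \<in> Ob U; a \<in> carrier (At A q r); c \<in> carrier (At C r s);
      d \<in> carrier (At D s t)\<rbrakk>
    \<Longrightarrow> app (assoc_inv A C D) q t (tens A (tensor C D) q t r a (tens C D r t s c d))
      = tens (tensor A C) D q t s (tens A C q s r a c) d"
  by (rule app_assoc_hom[OF hom1D[OF assms(1)] hom1D[OF assms(2)] hom1D[OF assms(3)]]
      app_assoc_inv[OF hom1D[OF assms(1)] hom1D[OF assms(2)] hom1D[OF assms(3)]]; assumption)+

section \<open>Interchange, invertibility, naturality and coherence\<close>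

lemma hom2_interchange:
  assumes A: "A \<in> hom1 Qtld Q R" and C: "C \<in> hom1 Qtld R S" and \<phi>: "\<phi> \<in> hom2 Qtld A A'" and \<phi>': "\<phi>'
    \<in> hom2 Qtld A' A''"
    and \<psi>: "\<psi> \<in> hom2 Qtld C C'" and \<psi>': "\<psi>' \<in> hom2 Qtld C' C''"
  shows "tensor_hom (comp_hom \<phi>' \<phi>) (comp_hom \<psi>' \<psi>) = comp_hom (tensor_hom \<phi>' \<psi>') (tensor_hom \<phi> \<psi>)"
proof (rule tensor_hom2_eqI[OF A C])
  note A' = hom2_Cod[OF \<phi> A] and C' = hom2_Cod[OF \<psi> C]
  show "tensor_hom (comp_hom \<phi>' \<phi>) (comp_hom \<psi>' \<psi>) \<in> hom2 Qtld (tensor A C) (tensor A'' C'')"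
    by (rule hom_intros | fact)+
  show "comp_hom (tensor_hom \<phi>' \<psi>') (tensor_hom \<phi> \<psi>) \<in> hom2 Qtld (tensor A C) (tensor A'' C'')"
    by (rule hom_intros assms A' C')+
  fix q s r a c assume "q \<in> Ob Q" "s \<in> Ob S" "r \<in> Ob R" "a \<in> carrier (At A q r)" "c \<in> carrier (At C r s)"
  then show "app (tensor_hom (comp_hom \<phi>' \<phi>) (comp_hom \<psi>' \<psi>)) q s (tens A C q s r a c)
      = app (comp_hom (tensor_hom \<phi>' \<psi>') (tensor_hom \<phi> \<psi>)) q s (tens A C q s r a c)"
    by (simp add: app_comp_hom app_tensor_hom2[OF comp_hom2[OF \<phi> \<phi>'] A comp_hom2[OF \<psi> \<psi>'] C]
      app_tensor_hom2[OF \<phi> A \<psi> C]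
        app_tensor_hom2[OF \<phi>' A' \<psi>' C'] tens_in_hom1[OF A C] app_in_hom2[OF \<phi> A] app_in_hom2[OF \<psi> C]
        hom1D[OF A] hom1D[OF C] hom2D[OF \<phi>] hom2D[OF \<psi>])
qed

lemma assoc_hom_iso2:
  assumes A: "A \<in> hom1 Qtld Q R" and C: "C \<in> hom1 Qtld R S" and D: "D \<in> hom1 Qtld S U"
  shows "assoc_hom A C D \<in> iso2 Qtld (tensor (tensor A C) D) (tensor A (tensor C D))"
proof -
  note AC = tensor_hom1[OF A C] and CD = tensor_hom1[OF C D]
  note L = tensor_hom1[OF AC D] and R = tensor_hom1[OF A CD]
  note a = assoc_hom2[OF A C D] and b = assoc_inv2[OF A C D]
  note [simp] = app_comp_hom app_id_hom app_assoc_hom2[OF A C D] tens_in_hom1[OF A C] tens_in_hom1[OF C D]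
    tens_in_hom1[OF AC D] tens_in_hom1[OF A CD] hom1D[OF A] hom1D[OF C] hom1D[OF D]
  have "comp_hom (assoc_inv A C D) (assoc_hom A C D) = id_hom (tensor (tensor A C) D)"
    by (rule left_nested_hom2_eqI[OF A C D comp_hom2[OF a b] id_hom2[OF L]]) simp
  moreover have "comp_hom (assoc_hom A C D) (assoc_inv A C D) = id_hom (tensor A (tensor C D))"
    by (rule right_nested_hom2_eqI[OF A C D comp_hom2[OF b a] id_hom2[OF R]]) simp
  ultimately show ?thesis using a b by (auto simp: iso2_def)
qed

lemma assoc_hom_natural:
  assumes A: "A \<in> hom1 Qtld Q R" and C: "C \<in> hom1 Qtld R S" and D: "D \<in> hom1 Qtld S U"
    and \<phi>: "\<phi> \<in> hom2 Qtld A A'" and \<psi>: "\<psi> \<in> hom2 Qtld C C'" and \<chi>: "\<chi> \<in> hom2 Qtld D D'"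
  shows "comp_hom (assoc_hom A' C' D') (tensor_hom (tensor_hom \<phi> \<psi>) \<chi>)
    = comp_hom (tensor_hom \<phi> (tensor_hom \<psi> \<chi>)) (assoc_hom A C D)"
proof (rule left_nested_hom2_eqI[OF A C D])
  note A' = hom2_Cod[OF \<phi> A] and C' = hom2_Cod[OF \<psi> C] and D' = hom2_Cod[OF \<chi> D]
  note AC = tensor_hom1[OF A C] and CD = tensor_hom1[OF C D]
  note \<phi>\<psi> = tensor_hom2[OF A C \<phi> \<psi>] and \<psi>\<chi> = tensor_hom2[OF C D \<psi> \<chi>]
  show "comp_hom (assoc_hom A' C' D') (tensor_hom (tensor_hom \<phi> \<psi>) \<chi>)
      \<in> hom2 Qtld (tensor (tensor A C) D) (tensor A' (tensor C' D'))"
    by (rule comp_hom2[OF tensor_hom2[OF AC D \<phi>\<psi> \<chi>] assoc_hom2[OF A' C' D']])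
  show "comp_hom (tensor_hom \<phi> (tensor_hom \<psi> \<chi>)) (assoc_hom A C D)
      \<in> hom2 Qtld (tensor (tensor A C) D) (tensor A' (tensor C' D'))"
    by (rule comp_hom2[OF assoc_hom2[OF A C D] tensor_hom2[OF A CD \<phi> \<psi>\<chi>]])
  fix q r s t a c d
  assume "q \<in> Ob Q" "r \<in> Ob R" "s \<in> Ob S" "t \<in> Ob U" "a \<in> carrier (At A q r)" "c \<in> carrier (At C r s)"
    "d \<in> carrier (At D s t)"
  then show "app (comp_hom (assoc_hom A' C' D') (tensor_hom (tensor_hom \<phi> \<psi>) \<chi>)) q t
        (tens (tensor A C) D q t s (tens A C q s r a c) d)
      = app (comp_hom (tensor_hom \<phi> (tensor_hom \<psi> \<chi>)) (assoc_hom A C D)) q t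
        (tens (tensor A C) D q t s (tens A C q s r a c) d)"
    by (simp add: app_comp_hom app_assoc_hom2[OF A C D] app_assoc_hom2[OF A' C' D']
      app_tensor_hom2[OF \<phi>\<psi> AC \<chi> D] app_tensor_hom2[OF \<phi> A \<psi>\<chi> CD]
        app_tensor_hom2[OF \<phi> A \<psi> C] app_tensor_hom2[OF \<psi> C \<chi> D] tens_in_hom1[OF A C]
          tens_in_hom1[OF C D] tens_in_hom1[OF AC D] tens_in_hom1[OF A CD]
        app_in_hom2[OF \<phi> A] app_in_hom2[OF \<psi> C] app_in_hom2[OF \<chi> D]
        hom1D[OF A] hom1D[OF C] hom1D[OF D] hom2D[OF \<phi>] hom2D[OF \<psi>] hom2D[OF \<chi>])
qed

lemma lunit_hom_iso2:
  assumes A: "A \<in> hom1 Qtld Q R"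
  shows "lunit_hom A \<in> iso2 Qtld (tensor (id_module Q) A) A"
proof -
  have Q: "small_quantaloid Q" using hom1_quantaloid[OF A] by blast
  note I = id_module_hom1[OF Q] and mA = hom1D[OF A]
  note IA = tensor_hom1[OF I A]
  \<comment> \<open>The inverse of the unitor inserts the identity as left factor.\<close>
  define \<psi> where "\<psi> = extend_hom A (tensor (id_module Q) A) (\<lambda>q r a. tens (id_module Q) A q r q (qid Q q) a)"
  note qi = qid_in[OF Q]
  note [simp] = qcomp_qid_left[OF Q] qcomp_qid_right[OF Q] qi qcomp_in[OF Q] lact_in[OF mA] ract_in[OF mA] mA
  \<comment> \<open>Moving \<open>f\<close> across the tensor sign composes it with the identity.
    This gives both the left equivariance of \<open>\<psi>\<close> and the fact that
    \<open>\<psi>\<close> after the unitor is the identity.\<close>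
  have bal: "tens (id_module Q) A q r q (qid Q q) (lact A q p r f a) = tens (id_module Q) A q r p f a"
    if "q \<in> Ob Q" "p \<in> Ob Q" "r \<in> Ob R" "f \<in> carrier (Hom Q q p)" "a \<in> carrier (At A p r)" for q p r f a
    using tens_balanced[OF hom1D[OF I] mA that(1,3,1,2), of "qid Q q" f a] that by simp
  have "is_modhom \<psi>"
    unfolding \<psi>_def
  proof (rule is_modhom_extend_hom[OF mA hom1D[OF IA]])
    show "sup_map (At A q r) (At (tensor (id_module Q) A) q r) (tens (id_module Q) A q r q (qid Q q))"
      if "q \<in> Ob Q" "r \<in> Ob R" for q r
      using sup_bimap2[OF tens_bimap[OF hom1D[OF I] mA that(1,2,1)]] qi that by simp
  qed (simp_all add: bal lact_tensor_tens[OF hom1D[OF I] mA] ract_tensor_tens[OF hom1D[OF I] mA])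
  then have \<psi>: "\<psi> \<in> hom2 Qtld A (tensor (id_module Q) A)" by (simp add: hom2_Qtld \<psi>_def)
  have app: "app \<psi> q r a = tens (id_module Q) A q r q (qid Q q) a"
    if "q \<in> Ob Q" "r \<in> Ob R" "a \<in> carrier (At A q r)" for q r a
    using that by (simp add: \<psi>_def app_extend_hom)
  note l = lunit_hom2[OF A]
  note [simp] = app bal app_comp_hom app_id_hom app_lunit_hom[OF mA] tens_in_hom1[OF I A] hom2D[OF \<psi>]
    lact_qid[OF mA]
  have "comp_hom \<psi> (lunit_hom A) = id_hom (tensor (id_module Q) A)"
    by (rule tensor_hom2_eqI[OF I A comp_hom2[OF l \<psi>] id_hom2[OF IA]]) simp
  moreover have "comp_hom (lunit_hom A) \<psi> = id_hom A"
    by (rule hom2_eqI[OF A comp_hom2[OF \<psi> l] id_hom2[OF A]]) simp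
  ultimately show ?thesis using l \<psi> by (auto simp: iso2_def)
qed

lemma runit_hom_iso2:
  assumes A: "A \<in> hom1 Qtld Q R"
  shows "runit_hom A \<in> iso2 Qtld (tensor A (id_module R)) A"
proof -
  have R: "small_quantaloid R" using hom1_quantaloid[OF A] by blast
  note I = id_module_hom1[OF R] and mA = hom1D[OF A]
  note AI = tensor_hom1[OF A I]
  define \<psi> where "\<psi> = extend_hom A (tensor A (id_module R)) (\<lambda>q r a. tens A (id_module R) q r r a (qid R r))"
  note qi = qid_in[OF R]
  note [simp] = qcomp_qid_left[OF R] qcomp_qid_right[OF R] qi qcomp_in[OF R] lact_in[OF mA] ract_in[OF mA] mA
  have bal: "tens A (id_module R) q r r (ract A q p r a h) (qid R r) = tens A (id_module R) q r p a h"
    if "q \<in> Ob Q" "p \<in> Ob R" "r \<in> Ob R" "a \<in> carrier (At A q p)" "h \<in> carrier (Hom R p r)" for q p r a h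
    using tens_balanced[OF mA hom1D[OF I] that(1,3,2,3), of a h "qid R r"] that by simp
  have "is_modhom \<psi>"
    unfolding \<psi>_def
  proof (rule is_modhom_extend_hom[OF mA hom1D[OF AI]])
    show "sup_map (At A q r) (At (tensor A (id_module R)) q r) (\<lambda>a. tens A (id_module R) q r r a (qid R r))"
      if "q \<in> Ob Q" "r \<in> Ob R" for q r
      using sup_bimap1[OF tens_bimap[OF mA hom1D[OF I] that(1,2,2)]] qi that by simp
  qed (simp_all add: bal lact_tensor_tens[OF mA hom1D[OF I]] ract_tensor_tens[OF mA hom1D[OF I]])
  then have \<psi>: "\<psi> \<in> hom2 Qtld A (tensor A (id_module R))" by (simp add: hom2_Qtld \<psi>_def)
  have app: "app \<psi> q r a = tens A (id_module R) q r r a (qid R r)"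
    if "q \<in> Ob Q" "r \<in> Ob R" "a \<in> carrier (At A q r)" for q r a
    using that by (simp add: \<psi>_def app_extend_hom)
  note l = runit_hom2[OF A]
  note [simp] = app bal app_comp_hom app_id_hom app_runit_hom[OF mA] tens_in_hom1[OF A I] hom2D[OF \<psi>]
    ract_qid[OF mA]
  have "comp_hom \<psi> (runit_hom A) = id_hom (tensor A (id_module R))"
    by (rule tensor_hom2_eqI[OF A I comp_hom2[OF l \<psi>] id_hom2[OF AI]]) simp
  moreover have "comp_hom (runit_hom A) \<psi> = id_hom A"
    by (rule hom2_eqI[OF A comp_hom2[OF \<psi> l] id_hom2[OF A]]) simp
  ultimately show ?thesis using l \<psi> by (auto simp: iso2_def)
qed

lemma unit_hom_natural:
  assumes A: "A \<in> hom1 Qtld Q R" and \<phi>: "\<phi> \<in> hom2 Qtld A A'"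
  shows lunit_hom_natural: "comp_hom (lunit_hom A') (tensor_hom (id_hom (id_module Q)) \<phi>)
    = comp_hom \<phi> (lunit_hom A)"
    and runit_hom_natural: "comp_hom (runit_hom A') (tensor_hom \<phi> (id_hom (id_module R)))
      = comp_hom \<phi> (runit_hom A)"
proof -
  have Q: "small_quantaloid Q" and R: "small_quantaloid R" using hom1_quantaloid[OF A] by blast+
  note IQ = id_module_hom1[OF Q] and IR = id_module_hom1[OF R] and A' = hom2_Cod[OF \<phi> A]
  note jQ = id_hom2[OF IQ] and jR = id_hom2[OF IR]
  note [simp] = app_comp_hom app_id_hom app_lunit_hom[OF hom1D[OF A]] app_lunit_hom[OF hom1D[OF A']]
    app_runit_hom[OF hom1D[OF A]] app_runit_hom[OF hom1D[OF A']] tens_in_hom1[OF IQ A] tens_in_hom1[OF A IR]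
    app_tensor_hom2[OF jQ IQ \<phi> A] app_tensor_hom2[OF \<phi> A jR IR] hom1D[OF A] hom2D[OF \<phi>] app_in_hom2[OF \<phi> A]
    app_lact[OF hom2D[OF \<phi>] hom1D(2,3)[OF A]] app_ract[OF hom2D[OF \<phi>] hom1D(2,3)[OF A]]
  show "comp_hom (lunit_hom A') (tensor_hom (id_hom (id_module Q)) \<phi>) = comp_hom \<phi> (lunit_hom A)"
    by (rule tensor_hom2_eqI[OF IQ A comp_hom2[OF tensor_hom2[OF IQ A jQ \<phi>] lunit_hom2[OF A']]
      comp_hom2[OF lunit_hom2[OF A] \<phi>]])
      simp
  show "comp_hom (runit_hom A') (tensor_hom \<phi> (id_hom (id_module R))) = comp_hom \<phi> (runit_hom A)"
    by (rule tensor_hom2_eqI[OF A IR comp_hom2[OF tensor_hom2[OF A IR \<phi> jR] runit_hom2[OF A']]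
      comp_hom2[OF runit_hom2[OF A] \<phi>]])
      simp
qed

text \<open>On a generator with middle component \<open>h\<close> this is the balance relation that
  lets \<open>h\<close> move across the tensor sign.\<close>

lemma assoc_hom_triangle:
  assumes A: "A \<in> hom1 Qtld Q R" and C: "C \<in> hom1 Qtld R S"
  shows "comp_hom (tensor_hom (id_hom A) (lunit_hom C)) (assoc_hom A (id_module R) C)
    = tensor_hom (runit_hom A) (id_hom C)"
proof -
  have R: "small_quantaloid R" using hom1_quantaloid[OF A] by blast
  note I = id_module_hom1[OF R] and a = id_hom2[OF A] and c = id_hom2[OF C]
  note AI = tensor_hom1[OF A I] and IC = tensor_hom1[OF I C]
  note [simp] = app_comp_hom app_id_hom app_lunit_hom[OF hom1D[OF C]] app_runit_hom[OF hom1D[OF A]]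
    tens_in_hom1[OF A I] tens_in_hom1[OF I C]
    tens_in_hom1[OF AI C] tens_in_hom1[OF A IC] app_assoc_hom2[OF A I C] app_tensor_hom2[OF a A
      lunit_hom2[OF C] IC] app_tensor_hom2[OF runit_hom2[OF A] AI c C]
    hom1D[OF A] hom1D[OF C] tens_balanced[OF hom1D[OF A] hom1D[OF C]]
  show ?thesis
    by (rule left_nested_hom2_eqI[OF A I C comp_hom2[OF assoc_hom2[OF A I C] tensor_hom2[OF A IC a
      lunit_hom2[OF C]]]
          tensor_hom2[OF AI C runit_hom2[OF A] c]]) simp
qed

lemma assoc_hom_pentagon:
  assumes A: "A \<in> hom1 Qtld P Q" and C: "C \<in> hom1 Qtld Q R" and D: "D \<in> hom1 Qtld R S" and E:
    "E \<in> hom1 Qtld S U"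
  shows "comp_hom (assoc_hom A C (tensor D E)) (assoc_hom (tensor A C) D E)
    = comp_hom (comp_hom (tensor_hom (id_hom A) (assoc_hom C D E)) (assoc_hom A (tensor C D) E))
      (tensor_hom (assoc_hom A C D) (id_hom E))"
    (is "?l = ?r")
proof -
  note AC = tensor_hom1[OF A C] and CD = tensor_hom1[OF C D] and DE = tensor_hom1[OF D E]
  note AC_D = tensor_hom1[OF AC D] and A_CD = tensor_hom1[OF A CD] and CD_E
    = tensor_hom1[OF CD E] and C_DE = tensor_hom1[OF C DE]
  note a = id_hom2[OF A] and e = id_hom2[OF E]
  note ACD = assoc_hom2[OF A C D] and CDE = assoc_hom2[OF C D E]
  note [simp] = app_comp_hom app_id_hom app_assoc_hom2[OF A C D] app_assoc_hom2[OF C D E]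
    app_assoc_hom2[OF A C DE] app_assoc_hom2[OF AC D E]
    app_assoc_hom2[OF A CD E] app_tensor_hom2[OF a A CDE CD_E] app_tensor_hom2[OF ACD AC_D e E]
    tens_in_hom1[OF A C] tens_in_hom1[OF C D] tens_in_hom1[OF D E] tens_in_hom1[OF AC D]
      tens_in_hom1[OF A CD] tens_in_hom1[OF CD E] tens_in_hom1[OF C DE]
    tens_in_hom1[OF AC_D E] tens_in_hom1[OF A_CD E] tens_in_hom1[OF AC DE]
    hom1D[OF A] hom1D[OF C] hom1D[OF D] hom1D[OF E]
  have l: "?l \<in> hom2 Qtld (tensor (tensor (tensor A C) D) E) (tensor A (tensor C (tensor D E)))"
    by (rule comp_hom2[OF assoc_hom2[OF AC D E] assoc_hom2[OF A C DE]])
  have r: "?r \<in> hom2 Qtld (tensor (tensor (tensor A C) D) E) (tensor A (tensor C (tensor D E)))"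
    by (rule comp_hom2[OF tensor_hom2[OF AC_D E ACD e] comp_hom2[OF assoc_hom2[OF A CD E]
      tensor_hom2[OF A CD_E a CDE]]])
  show ?thesis
  proof (rule left_nested_hom2_eqI[OF AC D E l r])
    fix p r s u w d x
    assume ob: "p \<in> Ob P" "r \<in> Ob R" "s \<in> Ob S" "u \<in> Ob U" and w: "w \<in> carrier (At (tensor A C) p r)"
      and d: "d \<in> carrier (At D r s)" and x: "x \<in> carrier (At E s u)"
    let ?t = "\<lambda>w. tens (tensor (tensor A C) D) E p u s (tens (tensor A C) D p s r w d) x"
    \<comment> \<open>\<open>left_nested_hom2_eqI\<close> leaves an arbitrary \<open>w\<close> of
      the innermost composite. With \<open>d\<close> and \<open>x\<close> fixed both sides are
      sup-maps in \<open>w\<close>, so \<open>w\<close> may be taken elementary too; after that only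
      brackets move.\<close>
    have sup: "sup_map (tensor_at A C p r) (At (tensor A (tensor C (tensor D E))) p u) (\<lambda>w. app \<chi> p u (?t w))"
      if "\<chi> \<in> hom2 Qtld (tensor (tensor (tensor A C) D) E) (tensor A (tensor C (tensor D E)))" for \<chi>
    proof -
      note ob' = ob(1,3,2) and ob'' = ob(1,4,3)
      have "sup_map (tensor_at A C p r) (tensor_at (tensor (tensor A C) D) E p u) ?t"
        using sup_map_comp[OF sup_bimap1[OF tens_bimap[OF hom1D[OF AC] hom1D[OF D] ob'] d]]
          sup_bimap1[OF tens_bimap[OF hom1D[OF AC_D] hom1D[OF E] ob''] x] by simp
      then show ?thesis
        using sup_map_comp app_sup_map[OF hom2D[OF that] hom1D(2,3)[OF tensor_hom1[OF AC_D E]] ob(1,4)]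
          by simp
    qed
    show "app ?l p u (?t w) = app ?r p u (?t w)"
      by (rule tensor_ext[OF hom1D[OF A] hom1D[OF C] ob(1,2) sup[OF l] sup[OF r]]) (use ob w d x in simp_all)
  qed
qed

theorem bicategory_Qtld: "bicategory Qtld"
proof
  fix A C :: "'u qmodule" and Q R S assume A: "A \<in> hom1 Qtld Q R" and C: "C \<in> hom1 Qtld R S"
  note AC = tensor_hom1[OF A C]
  show "vid Qtld A \<odot>\<^bsub>Qtld\<^esub> vid Qtld C = vid Qtld (A \<otimes>\<^bsub>Qtld\<^esub> C)"
    unfolding Qtld_simps
    by (rule tensor_hom2_eqI[OF A C tensor_hom2[OF A C id_hom2[OF A] id_hom2[OF C]] id_hom2[OF AC]])
      (simp add: app_id_hom tens_in_hom1[OF A C] app_tensor_hom2[OF id_hom2[OF A] A id_hom2[OF C] C]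
        hom1D[OF A] hom1D[OF C])
next
  show "\<phi> \<cdot>\<^bsub>Qtld\<^esub> vid Qtld A = \<phi> \<and> vid Qtld A' \<cdot>\<^bsub>Qtld\<^esub> \<phi> = \<phi>" if \<phi>: "\<phi> \<in> hom2 Qtld A A'" for \<phi> A A'
  proof -
    have A: "A \<in> hom1 Qtld (Src A) (Trg A)" using modhom_Dom[OF hom2D[OF \<phi>] refl refl]
      by (simp add: hom1_Qtld)
    note A' = hom2_Cod[OF \<phi> A]
    note [simp] = app_comp_hom app_id_hom hom2D[OF \<phi>] app_in_hom2[OF \<phi> A] hom1D(2,3)[OF A']
    have "comp_hom \<phi> (id_hom A) = \<phi>" by (rule hom2_eqI[OF A comp_hom2[OF id_hom2[OF A] \<phi>] \<phi>]) simp
    moreover have "comp_hom (id_hom A') \<phi> = \<phi>" by (rule hom2_eqI[OF A comp_hom2[OF \<phi> id_hom2[OF A']] \<phi>]) simp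
    ultimately show ?thesis by simp
  qed
next
  show "\<chi> \<cdot>\<^bsub>Qtld\<^esub> (\<psi> \<cdot>\<^bsub>Qtld\<^esub> \<phi>) = \<chi> \<cdot>\<^bsub>Qtld\<^esub> \<psi> \<cdot>\<^bsub>Qtld\<^esub> \<phi>"
    if \<phi>: "\<phi> \<in> hom2 Qtld A A'" and \<psi>: "\<psi> \<in> hom2 Qtld A' A''" and \<chi>: "\<chi> \<in> hom2 Qtld A'' A'''"
      for \<phi> \<psi> \<chi> A A' A'' A'''
  proof -
    have A: "A \<in> hom1 Qtld (Src A) (Trg A)" using modhom_Dom[OF hom2D[OF \<phi>] refl refl]
      by (simp add: hom1_Qtld)
    note A' = hom2_Cod[OF \<phi> A]
    show ?thesis
      unfolding Qtld_simps
      by (rule hom2_eqI[OF A comp_hom2[OF comp_hom2[OF \<phi> \<psi>] \<chi>] comp_hom2[OF \<phi> comp_hom2[OF \<psi> \<chi>]]])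
        (simp add: app_comp_hom hom2D[OF \<phi>] hom2D[OF \<psi>] app_in_hom2[OF \<phi> A] hom1D(2,3)[OF A'])
  qed
next
  show "src1 Qtld A \<in> ob Qtld \<and> trg1 Qtld A \<in> ob Qtld" if "A \<in> arr1 Qtld" for A
    using that module_Src module_Trg by simp
  show "src2 Qtld \<phi> \<in> arr1 Qtld \<and> trg2 Qtld \<phi> \<in> arr1 Qtld" if "\<phi> \<in> arr2 Qtld" for \<phi>
    using that by (simp add: is_modhom_def Let_def)
  show "src1 Qtld (src2 Qtld \<phi>) = src1 Qtld (trg2 Qtld \<phi>) \<and> trg1 Qtld (src2 Qtld \<phi>) = trg1 Qtld (trg2 Qtld \<phi>)"
    if "\<phi> \<in> arr2 Qtld" for \<phi>
    using that by (simp add: is_modhom_def Let_def)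
  show "vid Qtld A \<in> hom2 Qtld A A" if "A \<in> arr1 Qtld" for A
    using that by (simp add: hom2_Qtld is_modhom_id_hom)
qed (simp_all add: hom_intros hom2_interchange assoc_hom_iso2 assoc_hom_natural lunit_hom_iso2 runit_hom_iso2
      lunit_hom_natural runit_hom_natural assoc_hom_triangle assoc_hom_pentagon)

end


lemma right_adjoint_cong:
  "(\<And>a. a \<in> carrier L \<Longrightarrow> f a = g a) \<Longrightarrow> right_adjoint L M f b = right_adjoint L M g b"
  unfolding right_adjoint_def by (metis (no_types, lifting))

context set_universe
begin

section \<open>Dual modules\<close>

definition dual :: "'u qmodule \<Rightarrow> 'u qmodule" where
  "dual A = \<lparr> Src = Trg A, Trg = Src A, At = (\<lambda>r q. opposite (At A q r)),
     lact = (\<lambda>r r' q h. right_adjoint (At A q r) (At A q r') (\<lambda>x. ract A q r r' x h)),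
     ract = (\<lambda>r q q' a f. right_adjoint (At A q' r) (At A q r) (lact A q q' r f) a) \<rparr>"

lemma dual_simps [simp]:
  "Src (dual A) = Trg A" "Trg (dual A) = Src A" "At (dual A) r q = opposite (At A q r)"
  "lact (dual A) r r' q h = right_adjoint (At A q r) (At A q r') (\<lambda>x. ract A q r r' x h)"
  "ract (dual A) r q q' a f = right_adjoint (At A q' r) (At A q r) (lact A q q' r f) a"
  by (simp_all add: dual_def)

context
  fixes A :: "'u qmodule" and Q R :: "'u quantaloid"
  assumes A: "A \<in> hom1 Qtld Q R"
begin

lemma le_lact_dual:
  "\<lbrakk>q \<in> Ob Q; r \<in> Ob R; r' \<in> Ob R; h \<in> carrier (Hom R r r'); x \<in> carrier (At A q r); a \<in> carrier (At A q r')\<rbrakk>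
    \<Longrightarrow> x \<sqsubseteq>\<^bsub>At A q r\<^esub> right_adjoint (At A q r) (At A q r') (\<lambda>x. ract A q r r' x h) a
      \<longleftrightarrow> ract A q r r' x h \<sqsubseteq>\<^bsub>At A q r'\<^esub> a"
  using at_lattice[OF hom1D[OF A]] sup_bimap1[OF ract_bimap[OF hom1D[OF A]]]
  by (intro le_right_adjoint_iff) simp_all

lemma le_ract_dual:
  "\<lbrakk>q \<in> Ob Q; q' \<in> Ob Q; r \<in> Ob R; f \<in> carrier (Hom Q q q'); x \<in> carrier (At A q' r); a \<in> carrier (At A q r)\<rbrakk>
    \<Longrightarrow> x \<sqsubseteq>\<^bsub>At A q' r\<^esub> right_adjoint (At A q' r) (At A q r) (lact A q q' r f) a
      \<longleftrightarrow> lact A q q' r f x \<sqsubseteq>\<^bsub>At A q r\<^esub> a"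
  using at_lattice[OF hom1D[OF A]] sup_bimap2[OF lact_bimap[OF hom1D[OF A]]]
  by (intro le_right_adjoint_iff) simp_all

text \<open>Each law is read off below a test element: \<open>x\<close> lies below the result of
  \<open>h\<close> acting on \<open>a\<close> exactly when \<open>x \<cdot> h\<close> lies below
  \<open>a\<close>. So the laws of the left action on the dual are those of the right action on
  \<open>A\<close>, and conversely; the two actions commute because those on \<open>A\<close>
  do.\<close>

lemma dual_hom1: "dual A \<in> hom1 Qtld R Q"
proof -
  note mA = hom1D[OF A]
  note L = at_lattice[OF mA] and Q = module_Src[OF mA] and R = module_Trg[OF mA]
  note [simp] = L Q R lact_in[OF mA] ract_in[OF mA] right_adjoint_in le_lact_dual le_ract_dual
    qcomp_in[OF Q] qcomp_in[OF R] qid_in[OF Q] qid_in[OF R]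
  have "is_module (dual A)"
  proof (rule is_moduleI[OF R Q])
    show "Src (dual A) = R" "Trg (dual A) = Q" using mA by simp_all
    show "complete_lattice (At (dual A) r q)" if "r \<in> Ob R" "q \<in> Ob Q" for r q
      using that by (simp add: complete_lattice_opposite)
    show "small (carrier (At (dual A) r q))" if "r \<in> Ob R" "q \<in> Ob Q" for r q
      using that by (simp add: at_small[OF mA])
    show "sup_bimap (Hom R r r') (At (dual A) r' q) (At (dual A) r q) (lact (dual A) r r' q)"
      if "r \<in> Ob R" "r' \<in> Ob R" "q \<in> Ob Q" for r r' q
      using sup_bimap_right_adjoint[OF hom_lattice[OF R that(1,2)] L[OF that(3,1)] L[OF that(3,2)]
          sup_bimap_flip[OF ract_bimap[OF mA that(3,1,2)]]]
      by (simp add: dual_def)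
    show "sup_bimap (At (dual A) r q) (Hom Q q q') (At (dual A) r q') (ract (dual A) r q q')"
      if "r \<in> Ob R" "q \<in> Ob Q" "q' \<in> Ob Q" for r q q'
      using sup_bimap_flip[OF sup_bimap_right_adjoint[OF hom_lattice[OF Q that(2,3)] L[OF that(3,1)]
        L[OF that(2,1)]
          lact_bimap[OF mA that(2,3,1)]]]
      by (simp add: dual_def)
    show "lact (dual A) r r q (qid R r) a = a" if "r \<in> Ob R" "q \<in> Ob Q" "a \<in> carrier (At (dual A) r q)"
      for r q a
      by (rule complete_lattice_eqI_below[of "At A q r"]) (use that in \<open>simp_all add: ract_qid[OF mA]\<close>)
    show "ract (dual A) r q q a (qid Q q) = a" if "r \<in> Ob R" "q \<in> Ob Q" "a \<in> carrier (At (dual A) r q)"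
      for r q a
      by (rule complete_lattice_eqI_below[of "At A q r"]) (use that in \<open>simp_all add: lact_qid[OF mA]\<close>)
    show "lact (dual A) r r'' q (qcomp R r r' r'' h k) a
      = lact (dual A) r r' q h (lact (dual A) r' r'' q k a)"
      if "r \<in> Ob R" "r' \<in> Ob R" "r'' \<in> Ob R" "q \<in> Ob Q" "h \<in> carrier (Hom R r r')"
        "k \<in> carrier (Hom R r' r'')"
        "a \<in> carrier (At (dual A) r'' q)" for r r' r'' q h k a
      by (rule complete_lattice_eqI_below[of "At A q r"]) (use that in \<open>simp_all add: ract_qcomp[OF mA]\<close>)
    show "ract (dual A) r q q'' a (qcomp Q q q' q'' f g)
      = ract (dual A) r q' q'' (ract (dual A) r q q' a f) g"
      if "r \<in> Ob R" "q \<in> Ob Q" "q' \<in> Ob Q" "q'' \<in> Ob Q" "a \<in> carrier (At (dual A) r q)"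
        "f \<in> carrier (Hom Q q q')"
        "g \<in> carrier (Hom Q q' q'')" for r q q' q'' a f g
      by (rule complete_lattice_eqI_below[of "At A q'' r"]) (use that in \<open>simp_all add: lact_qcomp[OF mA]\<close>)
    show "ract (dual A) r q q' (lact (dual A) r r' q h a) f
      = lact (dual A) r r' q' h (ract (dual A) r' q q' a f)"
      if "r \<in> Ob R" "r' \<in> Ob R" "q \<in> Ob Q" "q' \<in> Ob Q" "h \<in> carrier (Hom R r r')"
        "a \<in> carrier (At (dual A) r' q)"
        "f \<in> carrier (Hom Q q q')" for r r' q q' h a f
      by (rule complete_lattice_eqI_below[of "At A q' r"]) (use that in \<open>simp_all add: ract_lact[OF mA]\<close>)
  qed
  then show ?thesis using mA by (simp add: hom1_Qtld)
qed

end

section \<open>The dualizing 1-cells and evaluation\<close>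

definition dualizer :: "'u quantaloid \<Rightarrow> 'u qmodule" where
  "dualizer Q = dual (id_module Q)"

lemma dualizer_hom1: "small_quantaloid Q \<Longrightarrow> dualizer Q \<in> hom1 Qtld Q Q"
  unfolding dualizer_def by (rule dual_hom1[OF id_module_hom1])

lemma dualizer_at [simp]: "At (dualizer Q) q q' = opposite (Hom Q q' q)"
  by (simp add: dualizer_def)

lemma le_lact_dualizer:
  "\<lbrakk>small_quantaloid Q; p \<in> Ob Q; q \<in> Ob Q; q' \<in> Ob Q; g \<in> carrier (Hom Q p q);
    x \<in> carrier (Hom Q q' p); a \<in> carrier (Hom Q q' q)\<rbrakk>
    \<Longrightarrow> x \<sqsubseteq>\<^bsub>Hom Q q' p\<^esub> lact (dualizer Q) p q q' g a \<longleftrightarrow> qcomp Q q' p q x g \<sqsubseteq>\<^bsub>Hom Q q' q\<^esub> a"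
  using le_lact_dual[OF id_module_hom1, of Q q' p q g x a] by (simp add: dualizer_def)

lemma le_ract_dualizer:
  "\<lbrakk>small_quantaloid Q; p \<in> Ob Q; q \<in> Ob Q; q' \<in> Ob Q; g \<in> carrier (Hom Q q' p);
    x \<in> carrier (Hom Q p q); a \<in> carrier (Hom Q q' q)\<rbrakk>
    \<Longrightarrow> x \<sqsubseteq>\<^bsub>Hom Q p q\<^esub> ract (dualizer Q) q q' p a g \<longleftrightarrow> qcomp Q q' p q g x \<sqsubseteq>\<^bsub>Hom Q q' q\<^esub> a"
  using le_ract_dual[OF id_module_hom1, of Q q' p q g x a] by (simp add: dualizer_def)

text \<open>\<open>a \<otimes> b\<close> is sent to the largest \<open>g\<close> with \<open>g \<star> a\<close> below \<open>b\<close>.\<close>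

definition ev_hom :: "'u qmodule \<Rightarrow> 'u qmodhom" where
  "ev_hom A = extend_hom (tensor A (dual A)) (dualizer (Src A))
     (\<lambda>q q'. ind (At (dualizer (Src A)) q q')
       (\<lambda>r a. right_adjoint (Hom (Src A) q' q) (At A q' r) (\<lambda>g. lact A q' q r g a)))"

context
  fixes A :: "'u qmodule" and Q R :: "'u quantaloid"
  assumes A: "A \<in> hom1 Qtld Q R"
begin

text \<open>Everything follows from the adjunction \<open>le_\<beta>\<close>. Balance holds because
  \<open>(g \<star> a) \<cdot> h \<le> b\<close> can be solved for \<open>g \<star> a\<close>;
  equivariance on either side is associativity of the action, with the scalar multiplied to
  \<open>g\<close> from the right or from the left.\<close>

lemma
  shows ev_hom2: "ev_hom A \<in> hom2 Qtld (tensor A (dual A)) (dualizer Q)"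
    and le_ev_hom: "\<And>q q' r a b g. \<lbrakk>q \<in> Ob Q; q' \<in> Ob Q; r \<in> Ob R; a \<in> carrier (At A q r);
      b \<in> carrier (At A q' r);
      g \<in> carrier (Hom Q q' q)\<rbrakk> \<Longrightarrow> g \<sqsubseteq>\<^bsub>Hom Q q' q\<^esub> app (ev_hom A) q q' (tens A (dual A) q q' r a b) \<longleftrightarrow>
        lact A q' q r g a \<sqsubseteq>\<^bsub>At A q' r\<^esub> b"
proof -
  note mA = hom1D[OF A] and mdA = hom1D[OF dual_hom1[OF A]]
  have Q: "small_quantaloid Q" using hom1_quantaloid[OF A] by blast
  note mB = hom1D[OF dualizer_hom1[OF Q]]
  note L = at_lattice[OF mA] and H = hom_lattice[OF Q]
  define \<beta> where "\<beta> q q' r a = right_adjoint (Hom Q q' q) (At A q' r) (\<lambda>g. lact A q' q r g a)" for q q' r a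
  have le_\<beta>: "g \<sqsubseteq>\<^bsub>Hom Q q' q\<^esub> \<beta> q q' r a b \<longleftrightarrow> lact A q' q r g a \<sqsubseteq>\<^bsub>At A q' r\<^esub> b"
    if "q \<in> Ob Q" "q' \<in> Ob Q" "r \<in> Ob R" "a \<in> carrier (At A q r)" "b \<in> carrier (At A q' r)"
      "g \<in> carrier (Hom Q q' q)"
    for q q' r a b g
    unfolding \<beta>_def using that by (intro le_right_adjoint_iff H L sup_bimap1[OF lact_bimap[OF mA]])
  have \<beta>_in: "\<beta> q q' r a b \<in> carrier (Hom Q q' q)" if "q \<in> Ob Q" "q' \<in> Ob Q" for q q' r a b
    unfolding \<beta>_def by (rule right_adjoint_in[OF H[OF that(2,1)]])
  note [simp] = le_\<beta> \<beta>_in H L lact_in[OF mA] ract_in[OF mA] right_adjoint_in le_lact_dual[OF A]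
    le_ract_dual[OF A]
    le_lact_dualizer[OF Q] le_ract_dualizer[OF Q] qcomp_in[OF Q] ract_lact[OF mA] lact_qcomp[OF mA]
  have bi: "sup_bimap (At A q r) (At (dual A) r q') (At (dualizer Q) q q') (\<beta> q q' r)"
    if "q \<in> Ob Q" "q' \<in> Ob Q" "r \<in> Ob R" for q q' r
    unfolding \<beta>_def
    using sup_bimap_right_adjoint[OF L[OF that(1,3)] H[OF that(2,1)] L[OF that(2,3)]
      sup_bimap_flip[OF lact_bimap[OF mA that(2,1,3)]]]
    by simp
  have bal: "\<beta> q q' r' (ract A q r r' a h) b = \<beta> q q' r a (lact (dual A) r r' q' h b)"
    if "q \<in> Ob Q" "q' \<in> Ob Q" "r \<in> Ob R" "r' \<in> Ob R" "a \<in> carrier (At A q r)" "h \<in> carrier (Hom R r r')"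
      "b \<in> carrier (At (dual A) r' q')" for q q' r r' a h b
    by (rule complete_lattice_eqI_below[of "Hom Q q' q"]) (use that in \<open>simp_all flip: ract_lact[OF mA]\<close>)
  have lB: "lact (dualizer Q) p q q' f b \<in> carrier (Hom Q q' p)"
    if "p \<in> Ob Q" "q \<in> Ob Q" "q' \<in> Ob Q" "f \<in> carrier (Hom Q p q)" "b \<in> carrier (Hom Q q' q)" for p q q' f b
    using lact_in[OF mB that(1-4)] that(5) by simp
  have rB: "ract (dualizer Q) q q' p b f \<in> carrier (Hom Q p q)"
    if "p \<in> Ob Q" "q \<in> Ob Q" "q' \<in> Ob Q" "f \<in> carrier (Hom Q q' p)" "b \<in> carrier (Hom Q q' q)" for p q q' f b
    using ract_in[OF mB that(2,3,1) _ that(4)] that(5) by simp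
  have l: "\<beta> p q' r (lact A p q r f a) b = lact (dualizer Q) p q q' f (\<beta> q q' r a b)"
    if "p \<in> Ob Q" "q \<in> Ob Q" "q' \<in> Ob Q" "r \<in> Ob R" "f \<in> carrier (Hom Q p q)" "a \<in> carrier (At A q r)"
      "b \<in> carrier (At (dual A) r q')" for p q q' r f a b
    by (rule complete_lattice_eqI_below[of "Hom Q q' p"]) (use that in \<open>simp_all add: lB\<close>)
  have r: "\<beta> q p r a (ract (dual A) r q' p b f) = ract (dualizer Q) q q' p (\<beta> q q' r a b) f"
    if "q \<in> Ob Q" "q' \<in> Ob Q" "p \<in> Ob Q" "r \<in> Ob R" "a \<in> carrier (At A q r)" "b \<in> carrier (At (dual A) r q')"
      "f \<in> carrier (Hom Q q' p)" for q q' p r a b f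
    by (rule complete_lattice_eqI_below[of "Hom Q p q"]) (use that in \<open>simp_all add: rB\<close>)
  have eq: "ev_hom A = extend_hom (tensor A (dual A)) (dualizer Q) (\<lambda>q q'. ind (At (dualizer Q) q q') (\<beta>
    q q'))"
    unfolding ev_hom_def \<beta>_def mA(2) ..
  show "ev_hom A \<in> hom2 Qtld (tensor A (dual A)) (dualizer Q)"
    unfolding eq hom2_Qtld using is_modhom_ind[OF mA mdA mB bi bal l r] by simp
  show "g \<sqsubseteq>\<^bsub>Hom Q q' q\<^esub> app (ev_hom A) q q' (tens A (dual A) q q' r a b) \<longleftrightarrow> lact A q' q r g a \<sqsubseteq>\<^bsub>At A q' r\<^esub> b"
    if "q \<in> Ob Q" "q' \<in> Ob Q" "r \<in> Ob R" "a \<in> carrier (At A q r)" "b \<in> carrier (At A q' r)"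
      "g \<in> carrier (Hom Q q' q)"
    for q q' r a b g
    unfolding eq using that app_ind[OF mA mdA mB bi bal l r, of q q' r a b] by simp
qed

lemma app_ev_in:
  assumes "q \<in> Ob Q" "q' \<in> Ob Q" "r \<in> Ob R" "a \<in> carrier (At A q r)" "b \<in> carrier (At A q' r)"
  shows "app (ev_hom A) q q' (tens A (dual A) q q' r a b) \<in> carrier (Hom Q q' q)"
  using app_in_hom2[OF ev_hom2 tensor_hom1[OF A dual_hom1[OF A]] assms(1,2)] tens_in_hom1[OF A
    dual_hom1[OF A] assms(1-4)] assms by simp

lemma dual_right_extension: "is_right_extension Qtld Q R Q A (dualizer Q) (dual A) (ev_hom A)"
proof -
  note mA = hom1D[OF A] and dA = dual_hom1[OF A] and id = id_hom2[OF A]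
  have Q: "small_quantaloid Q" using hom1_quantaloid[OF A] by blast
  note mB = hom1D[OF dualizer_hom1[OF Q]]
  note L = at_lattice[OF mA] and H = hom_lattice[OF Q]
  have "bij_betw (\<lambda>\<phi>. comp_hom (ev_hom A) (tensor_hom (id_hom A) \<phi>)) (hom2 Qtld C (dual A)) (hom2 Qtld
    (tensor A C) (dualizer Q))"
    if C: "C \<in> hom1 Qtld R Q" for C
  proof (rule bij_betwI')
    note mC = hom1D[OF C]
    have in2: "comp_hom (ev_hom A) (tensor_hom (id_hom A) \<phi>) \<in> hom2 Qtld (tensor A C) (dualizer Q)"
      if "\<phi> \<in> hom2 Qtld C (dual A)" for \<phi>
      by (rule comp_hom2[OF tensor_hom2[OF A C id that] ev_hom2])
    then show "comp_hom (ev_hom A) (tensor_hom (id_hom A) \<phi>) \<in> hom2 Qtld (tensor A C) (dualizer Q)"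
      if "\<phi> \<in> hom2 Qtld C (dual A)" for \<phi> using that .
    have \<phi>_in: "app \<phi> r q c \<in> carrier (At A q r)"
      if "\<phi> \<in> hom2 Qtld C (dual A)" "r \<in> Ob R" "q \<in> Ob Q" "c \<in> carrier (At C r q)" for \<phi> r q c
      using app_in_hom2[OF that(1) C that(2-4)] by simp
    have app: "app (comp_hom (ev_hom A) (tensor_hom (id_hom A) \<phi>)) q q' (tens A C q q' r a c)
        = app (ev_hom A) q q' (tens A (dual A) q q' r a (app \<phi> r q' c))"
      if "\<phi> \<in> hom2 Qtld C (dual A)" "q \<in> Ob Q" "q' \<in> Ob Q" "r \<in> Ob R" "a \<in> carrier (At A q r)"
        "c \<in> carrier (At C r q')"
      for \<phi> q q' r a c
      using that by (simp add: app_comp_hom app_tensor_hom2[OF id A that(1) C] app_id_hom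
        tens_in_hom1[OF A C] mA mC hom2D[OF that(1)])
    show "(comp_hom (ev_hom A) (tensor_hom (id_hom A) \<phi>)
      = comp_hom (ev_hom A) (tensor_hom (id_hom A) \<psi>)) \<longleftrightarrow> (\<phi> = \<psi>)"
      if \<phi>: "\<phi> \<in> hom2 Qtld C (dual A)" and \<psi>: "\<psi> \<in> hom2 Qtld C (dual A)" for \<phi> \<psi>
    proof
      assume eq: "comp_hom (ev_hom A) (tensor_hom (id_hom A) \<phi>)
        = comp_hom (ev_hom A) (tensor_hom (id_hom A) \<psi>)"
      show "\<phi> = \<psi>"
      proof (rule hom2_eqI[OF C \<phi> \<psi>])
        fix r q c assume r: "r \<in> Ob R" and q: "q \<in> Ob Q" and c: "c \<in> carrier (At C r q)"
        \<comment> \<open>Testing the evaluation at the identity \<open>qid Q q\<close> recovers the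
          lower bounds of \<open>app \<chi> r q c\<close>, which makes transposition
          injective.\<close>
        have iff: "a \<sqsubseteq>\<^bsub>At A q r\<^esub> app \<chi> r q c \<longleftrightarrow>
            qid Q q \<sqsubseteq>\<^bsub>Hom Q q q\<^esub> app (comp_hom (ev_hom A) (tensor_hom (id_hom A) \<chi>)) q q (tens A C q q r a c)"
          if "\<chi> \<in> hom2 Qtld C (dual A)" "a \<in> carrier (At A q r)" for \<chi> a
          using that r q c by (simp add: app le_ev_hom \<phi>_in qid_in[OF Q] lact_qid[OF mA])
        show "app \<phi> r q c = app \<psi> r q c"
          by (rule complete_lattice_eqI_below[OF L[OF q r] \<phi>_in[OF \<phi> r q c] \<phi>_in[OF \<psi> r q c]])
            (simp add: iff \<phi> \<psi> eq)
      qed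
    qed simp
    fix f assume f: "f \<in> hom2 Qtld (tensor A C) (dualizer Q)"
    define F where "F q q' r a c = app f q q' (tens A C q q' r a c)" for q q' r a c
    note AC = tensor_hom1[OF A C]
    note f' = hom2D[OF f] hom1D(2,3)[OF AC]
    have F_in: "F q q' r a c \<in> carrier (Hom Q q' q)"
      if "q \<in> Ob Q" "q' \<in> Ob Q" "r \<in> Ob R" "a \<in> carrier (At A q r)" "c \<in> carrier (At C r q')" for q q' r a c
      unfolding F_def using app_in_hom2[OF f AC that(1,2)] tens_in_hom1[OF A C that] by simp
    have F_bi: "sup_bimap (At A q r) (At C r q') (opposite (Hom Q q' q)) (F q q' r)"
      if "q \<in> Ob Q" "q' \<in> Ob Q" "r \<in> Ob R" for q q' r
    proof -
      have "sup_map (tensor_at A C q q') (opposite (Hom Q q' q)) (app f q q')"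
        using app_sup_map[OF f' that(1,2)] by simp
      then show ?thesis
        using tens_bimap[OF mA mC that] sup_map_comp unfolding sup_bimap_def F_def by blast
    qed
    have F_bal: "F q q' r' (ract A q r r' a h) c = F q q' r a (lact C r r' q' h c)"
      if "q \<in> Ob Q" "q' \<in> Ob Q" "r \<in> Ob R" "r' \<in> Ob R" "a \<in> carrier (At A q r)" "h \<in> carrier (Hom R r r')"
        "c \<in> carrier (At C r' q')" for q q' r r' a h c
      using tens_balanced[OF mA mC that] by (simp add: F_def)
    have F_l: "x \<sqsubseteq>\<^bsub>Hom Q q' p\<^esub> F p q' r (lact A p q r g a) c \<longleftrightarrow> qcomp Q q' p q x g \<sqsubseteq>\<^bsub>Hom Q q' q\<^esub> F q q' r a c"
      if "p \<in> Ob Q" "q \<in> Ob Q" "q' \<in> Ob Q" "r \<in> Ob R" "g \<in> carrier (Hom Q p q)" "a \<in> carrier (At A q r)"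
        "c \<in> carrier (At C r q')" "x \<in> carrier (Hom Q q' p)" for p q q' r g a c x
    proof -
      have "F p q' r (lact A p q r g a) c = lact (dualizer Q) p q q' g (F q q' r a c)"
        unfolding F_def
        using app_lact[OF f' that(1-3,5), of "tens A C q q' r a c"]
          lact_tensor_tens[OF mA mC that(1-3,5,4,6,7)]
          tens_in_hom1[OF A C that(2,3,4,6,7)] by simp
      then show ?thesis using le_lact_dualizer[OF Q that(1-3,5,8) F_in[OF that(2,3,4,6,7)]] by simp
    qed
    have F_r: "x \<sqsubseteq>\<^bsub>Hom Q s q\<^esub> F q s r a (ract C r q' s c k) \<longleftrightarrow> qcomp Q q' s q k x \<sqsubseteq>\<^bsub>Hom Q q' q\<^esub> F q q' r a c"
      if "q \<in> Ob Q" "q' \<in> Ob Q" "s \<in> Ob Q" "r \<in> Ob R" "a \<in> carrier (At A q r)" "c \<in> carrier (At C r q')"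
        "k \<in> carrier (Hom Q q' s)" "x \<in> carrier (Hom Q s q)" for q q' s r a c k x
    proof -
      have "F q s r a (ract C r q' s c k) = ract (dualizer Q) q q' s (F q q' r a c) k"
        unfolding F_def
        using app_ract[OF f' that(1-3) _ that(7), of
          "tens A C q q' r a c"] ract_tensor_tens[OF mA mC that(1-6,7)]
          tens_in_hom1[OF A C that(1,2,4,5,6)] by simp
      then show ?thesis using le_ract_dualizer[OF Q that(3,1,2,7,8) F_in[OF that(1,2,4,5,6)]] by simp
    qed
    \<comment> \<open>The largest \<open>a\<close> with \<open>qid Q q\<close> below
      \<open>F q q r a c\<close>: in \<open>a\<close>, \<open>F\<close> is a sup-map into the
      reversed order, and there the condition in \<open>right_adjoint\<close> reads this
      way.\<close>
    define g where "g r q c = right_adjoint (At A q r) (opposite (Hom Q q q)) (\<lambda>a. F q q r a c) (qid Q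
      q)" for r q c
    have g_in: "g r q c \<in> carrier (At A q r)" if "r \<in> Ob R" "q \<in> Ob Q" for r q c
      unfolding g_def by (rule right_adjoint_in[OF L[OF that(2,1)]])
    have le_g: "a \<sqsubseteq>\<^bsub>At A q r\<^esub> g r q c \<longleftrightarrow> qid Q q \<sqsubseteq>\<^bsub>Hom Q q q\<^esub> F q q r a c"
      if "r \<in> Ob R" "q \<in> Ob Q" "c \<in> carrier (At C r q)" "a \<in> carrier (At A q r)" for r q c a
      unfolding g_def
      using le_right_adjoint_iff[OF L[OF that(2,1)] complete_lattice_opposite[OF H[OF that(2,2)]]
          sup_bimap1[OF F_bi[OF that(2,2,1)] that(3)] that(4), of "qid Q q"] qid_in[OF Q that(2)] by simp
    note [simp] = le_g g_in F_in F_l F_r L qid_in[OF Q] qcomp_qid_left[OF Q] qcomp_qid_right[OF Q]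
      lact_in[OF mA] ract_in[OF mA]
      lact_in[OF mC] ract_in[OF mC] right_adjoint_in le_lact_dual[OF A] le_ract_dual[OF A] mA mC
    let ?\<phi> = "extend_hom C (dual A) g"
    have \<phi>: "?\<phi> \<in> hom2 Qtld C (dual A)"
      unfolding hom2_Qtld
    proof (intro conjI is_modhom_extend_hom[OF mC hom1D[OF dA]])
      show "sup_map (At C r q) (At (dual A) r q) (g r q)" if "r \<in> Ob R" "q \<in> Ob Q" for r q
        unfolding g_def
        using sup_bimap1[OF sup_bimap_right_adjoint[OF at_lattice[OF mC that] L[OF that(2,1)]
              complete_lattice_opposite[OF H[OF that(2,2)]] sup_bimap_flip[OF F_bi[OF that(2,2,1)]]], of
                "qid Q q"]
          qid_in[OF Q that(2)] by simp
      show "g r q (lact C r r' q h c) = lact (dual A) r r' q h (g r' q c)"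
        if "r \<in> Ob R" "r' \<in> Ob R" "q \<in> Ob Q" "h \<in> carrier (Hom R r r')" "c \<in> carrier (At C r' q)"
          for r r' q h c
        by (rule complete_lattice_eqI_below[of "At A q r"]) (use that in \<open>simp_all flip: F_bal\<close>)
      \<comment> \<open>A test element \<open>a\<close> lies below either side exactly when
        \<open>k\<close> lies below \<open>F s q r a c\<close>, by \<open>F_r\<close> on the left
        and by \<open>F_l\<close> on the right.\<close>
      show "g r s (ract C r q s c k) = ract (dual A) r q s (g r q c) k"
        if "r \<in> Ob R" "q \<in> Ob Q" "s \<in> Ob Q" "c \<in> carrier (At C r q)" "k \<in> carrier (Hom Q q s)" for r q s c k
        by (rule complete_lattice_eqI_below[of "At A s r"]) (use that in simp_all)
    qed simp_all
    moreover have "f = comp_hom (ev_hom A) (tensor_hom (id_hom A) ?\<phi>)"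
    proof (rule tensor_hom2_eqI[OF A C f in2[OF \<phi>]])
      fix q q' r a c assume *: "q \<in> Ob Q" "q' \<in> Ob Q" "r \<in> Ob R" "a \<in> carrier (At A q r)"
        "c \<in> carrier (At C r q')"
      \<comment> \<open>A scalar \<open>x\<close> lies below either side exactly when
        \<open>qid Q q'\<close> lies below the value of \<open>F q' q' r\<close> at
        \<open>x \<star> a\<close> and \<open>c\<close>: this is \<open>F_l\<close> on the left, and
        \<open>le_ev_hom\<close> with \<open>le_g\<close> on the right.\<close>
      have "F q q' r a c = app (ev_hom A) q q' (tens A (dual A) q q' r a (g r q' c))"
        by (rule complete_lattice_eqI_below[OF H[OF *(2,1)]]) (use * in \<open>simp_all add: app_ev_in le_ev_hom\<close>)
      then show "app f q q' (tens A C q q' r a c)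
        = app (comp_hom (ev_hom A) (tensor_hom (id_hom A) ?\<phi>)) q q' (tens A C q q' r a c)"
        using * by (simp add: app[OF \<phi>] app_extend_hom F_def)
    qed
    ultimately show "\<exists>\<phi> \<in> hom2 Qtld C (dual A). f = comp_hom (ev_hom A) (tensor_hom (id_hom A) \<phi>)" by blast
  qed
  then show ?thesis by (simp add: is_right_extension_def dA ev_hom2)
qed

end

section \<open>Duality on 2-cells and the double dual\<close>

definition dual_hom :: "'u qmodhom \<Rightarrow> 'u qmodhom" where
  "dual_hom \<phi> = extend_hom (dual (Cod \<phi>)) (dual (Dom \<phi>))
     (\<lambda>r q. right_adjoint (At (Dom \<phi>) q r) (At (Cod \<phi>) q r) (app \<phi> q r))"

definition double_dual :: "'u qmodule \<Rightarrow> 'u qmodhom" where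
  "double_dual A = extend_hom A (dual (dual A)) (\<lambda>q r a. a)"

text \<open>The right adjoint of an equivariant map is equivariant for the residual actions: below a
  test element both sides of each law unfold to equivariance of \<open>\<phi>\<close>.\<close>

lemma
  assumes A: "A \<in> hom1 Qtld Q R" and \<phi>: "\<phi> \<in> hom2 Qtld A A'"
  shows dual_hom2: "dual_hom \<phi> \<in> hom2 Qtld (dual A') (dual A)"
    and app_dual_hom: "\<And>q r b. \<lbrakk>q \<in> Ob Q; r \<in> Ob R; b \<in> carrier (At A' q r)\<rbrakk>
      \<Longrightarrow> app (dual_hom \<phi>) r q b = right_adjoint (At A q r) (At A' q r) (app \<phi> q r) b"
    and le_app_dual_hom: "\<And>q r a b. \<lbrakk>q \<in> Ob Q; r \<in> Ob R; a \<in> carrier (At A q r); b \<in> carrier (At A' q r)\<rbrakk>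
      \<Longrightarrow> a \<sqsubseteq>\<^bsub>At A q r\<^esub> app (dual_hom \<phi>) r q b \<longleftrightarrow> app \<phi> q r a \<sqsubseteq>\<^bsub>At A' q r\<^esub> b"
proof -
  note A' = hom2_Cod[OF \<phi> A]
  note mA = hom1D[OF A] and mA' = hom1D[OF A'] and \<phi>' = hom2D[OF \<phi>] hom1D(2,3)[OF A]
  note L = at_lattice[OF mA] and L' = at_lattice[OF mA'] and sup = app_sup_map[OF \<phi>']
  have app: "app (dual_hom \<phi>) r q b = right_adjoint (At A q r) (At A' q r) (app \<phi> q r) b"
    if "q \<in> Ob Q" "r \<in> Ob R" "b \<in> carrier (At A' q r)" for q r b
    using that by (simp add: dual_hom_def app_extend_hom hom2D[OF \<phi>] mA')
  note le = le_right_adjoint_iff[OF L L' sup]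
  show "app (dual_hom \<phi>) r q b = right_adjoint (At A q r) (At A' q r) (app \<phi> q r) b"
    if "q \<in> Ob Q" "r \<in> Ob R" "b \<in> carrier (At A' q r)" for q r b using app that .
  show "a \<sqsubseteq>\<^bsub>At A q r\<^esub> app (dual_hom \<phi>) r q b \<longleftrightarrow> app \<phi> q r a \<sqsubseteq>\<^bsub>At A' q r\<^esub> b"
    if "q \<in> Ob Q" "r \<in> Ob R" "a \<in> carrier (At A q r)" "b \<in> carrier (At A' q r)" for q r a b
    using that by (simp add: app le)
  note [simp] = le L L' right_adjoint_in le_lact_dual[OF A] le_ract_dual[OF A] le_lact_dual[OF A']
    le_ract_dual[OF A']
    lact_in[OF mA] ract_in[OF mA] lact_in[OF mA'] ract_in[OF mA'] app_in_hom2[OF \<phi> A]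
  show "dual_hom \<phi> \<in> hom2 Qtld (dual A') (dual A)"
    unfolding hom2_Qtld dual_hom_def \<phi>'(2,3)
  proof (intro conjI is_modhom_extend_hom[OF hom1D[OF dual_hom1[OF A']] hom1D[OF dual_hom1[OF A]]])
    show "sup_map (At (dual A') r q) (At (dual A) r q) (right_adjoint (At A q r) (At A' q r) (app \<phi> q r))"
      if "r \<in> Ob R" "q \<in> Ob Q" for r q
      using sup_map_right_adjoint[OF L L' sup] that by simp
    show "right_adjoint (At A q r) (At A' q r) (app \<phi> q r) (lact (dual A') r r' q h b)
        = lact (dual A) r r' q h (right_adjoint (At A q r') (At A' q r') (app \<phi> q r') b)"
      if "r \<in> Ob R" "r' \<in> Ob R" "q \<in> Ob Q" "h \<in> carrier (Hom R r r')" "b \<in> carrier (At (dual A') r' q)"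
        for r r' q h b
      by (rule complete_lattice_eqI_below[of "At A q r"]) (use that in \<open>simp_all add: app_ract[OF \<phi>']\<close>)
    show "right_adjoint (At A q' r) (At A' q' r) (app \<phi> q' r) (ract (dual A') r q q' b f)
        = ract (dual A) r q q' (right_adjoint (At A q r) (At A' q r) (app \<phi> q r) b) f"
      if "r \<in> Ob R" "q \<in> Ob Q" "q' \<in> Ob Q" "b \<in> carrier (At (dual A') r q)" "f \<in> carrier (Hom Q q q')"
        for r q q' b f
      by (rule complete_lattice_eqI_below[of "At A q' r"]) (use that in \<open>simp_all add: app_lact[OF \<phi>']\<close>)
  qed simp_all
qed

text \<open>On a generator \<open>a \<otimes> b\<close>, a scalar \<open>g\<close> lies below either
  side exactly when \<open>\<phi>\<close> maps \<open>g \<star> a\<close> below \<open>b\<close>.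
  The equation identifies \<open>dual_hom \<phi>\<close> as the 2-cell induced between the right
  extensions.\<close>

lemma ev_hom_natural:
  assumes A: "A \<in> hom1 Qtld Q R" and \<phi>: "\<phi> \<in> hom2 Qtld A A'"
  shows "comp_hom (ev_hom A) (tensor_hom (id_hom A) (dual_hom \<phi>))
    = comp_hom (ev_hom A') (tensor_hom \<phi> (id_hom (dual A')))"
proof -
  note A' = hom2_Cod[OF \<phi> A]
  note dA = dual_hom1[OF A] and dA' = dual_hom1[OF A'] and d = dual_hom2[OF A \<phi>]
  note mA = hom1D[OF A] and mA' = hom1D[OF A']
  have Q: "small_quantaloid Q" using hom1_quantaloid[OF A] by blast
  show ?thesis
  proof (rule tensor_hom2_eqI[OF A dA' comp_hom2[OF tensor_hom2[OF A dA' id_hom2[OF A] d] ev_hom2[OF A]]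
        comp_hom2[OF tensor_hom2[OF A dA' \<phi> id_hom2[OF dA']] ev_hom2[OF A']]])
    fix q q' r a b assume *: "q \<in> Ob Q" "q' \<in> Ob Q" "r \<in> Ob R" "a \<in> carrier (At A q r)"
      "b \<in> carrier (At (dual A') r q')"
    have b: "app (dual_hom \<phi>) r q' b \<in> carrier (At A q' r)" using app_in_hom2[OF d dA' *(3,2,5)] by simp
    have "app (ev_hom A) q q' (tens A (dual A) q q' r a (app (dual_hom \<phi>) r q' b))
        = app (ev_hom A') q q' (tens A' (dual A') q q' r (app \<phi> q r a) b)"
      by (rule complete_lattice_eqI_below[OF hom_lattice[OF Q *(2,1)]])
        (use * b in \<open>simp_all add: app_ev_in[OF A] app_ev_in[OF A'] app_in_hom2[OF \<phi> A] le_ev_hom[OF A]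
          le_ev_hom[OF A']
            le_app_dual_hom[OF A \<phi>] lact_in[OF mA] app_lact[OF hom2D[OF \<phi>] mA(2,3)]\<close>)
    then show "app (comp_hom (ev_hom A) (tensor_hom (id_hom A) (dual_hom \<phi>))) q q' (tens A (dual A') q
      q' r a b)
        = app (comp_hom (ev_hom A') (tensor_hom \<phi> (id_hom (dual A')))) q q' (tens A (dual A') q q' r a b)"
      using * by (simp add: app_comp_hom app_id_hom app_tensor_hom2[OF id_hom2[OF A] A d dA']
        app_tensor_hom2[OF \<phi> A id_hom2[OF dA'] dA']
          tens_in_hom1[OF A dA'] mA mA' hom2D[OF \<phi>] hom2D[OF d])
  qed
qed

text \<open>Two residuations give back each action by \<open>right_adjoint_right_adjoint\<close>,
  but only on the carriers. The records may differ elsewhere, hence an isomorphism in place of an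
  equality.\<close>

lemma
  assumes A: "A \<in> hom1 Qtld Q R"
  shows double_dual_iso2: "double_dual A \<in> iso2 Qtld A (dual (dual A))"
    and app_double_dual: "\<And>q r a. \<lbrakk>q \<in> Ob Q; r \<in> Ob R; a \<in> carrier (At A q r)\<rbrakk>
      \<Longrightarrow> app (double_dual A) q r a = a"
proof -
  note mA = hom1D[OF A] and ddA = dual_hom1[OF dual_hom1[OF A]]
  note L = at_lattice[OF mA]
  show app: "app (double_dual A) q r a = a" if "q \<in> Ob Q" "r \<in> Ob R" "a \<in> carrier (At A q r)" for q r a
    using that by (simp add: double_dual_def app_extend_hom mA)
  have l: "lact (dual (dual A)) q q' r f a = lact A q q' r f a"
    if "q \<in> Ob Q" "q' \<in> Ob Q" "r \<in> Ob R" "f \<in> carrier (Hom Q q q')" "a \<in> carrier (At A q' r)" for q q' r f a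
    using right_adjoint_right_adjoint[OF L[OF that(2,3)] L[OF that(1,3)]
      sup_bimap2[OF lact_bimap[OF mA that(1-3)] that(4)] that(5)]
    by simp
  have r: "ract (dual (dual A)) q r r' a h = ract A q r r' a h"
    if "q \<in> Ob Q" "r \<in> Ob R" "r' \<in> Ob R" "a \<in> carrier (At A q r)" "h \<in> carrier (Hom R r r')" for q r r' a h
    using right_adjoint_right_adjoint[OF L[OF that(1,2)] L[OF that(1,3)]
      sup_bimap1[OF ract_bimap[OF mA that(1-3)] that(5)] that(4)]
    by simp
  have dd: "double_dual A \<in> hom2 Qtld A (dual (dual A))"
    unfolding hom2_Qtld double_dual_def
    \<comment> \<open>The rules \<open>dual_simps(4,5)\<close> would unfold the actions on the
      double dual before \<open>l\<close> and \<open>r\<close> can identify them.\<close>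
    by (intro conjI is_modhom_extend_hom[OF mA hom1D[OF ddA]])
      (simp_all add: l r sup_map_id[OF L] del: dual_simps(4,5))
  let ?\<psi> = "extend_hom (dual (dual A)) A (\<lambda>q r a. a)"
  have \<psi>: "?\<psi> \<in> hom2 Qtld (dual (dual A)) A"
    unfolding hom2_Qtld
    by (intro conjI is_modhom_extend_hom[OF hom1D[OF ddA] mA])
      (simp_all add: l r sup_map_id[OF L] del: dual_simps(4,5))
  have "comp_hom ?\<psi> (double_dual A) = id_hom A"
    by (rule hom2_eqI[OF A comp_hom2[OF dd \<psi>] id_hom2[OF A]])
      (simp add: app_comp_hom app_id_hom app_extend_hom app mA hom2D[OF dd])
  moreover have "comp_hom (double_dual A) ?\<psi> = id_hom (dual (dual A))"
    by (rule hom2_eqI[OF ddA comp_hom2[OF \<psi> dd] id_hom2[OF ddA]])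
      (simp add: app_comp_hom app_id_hom app_extend_hom app mA)
  ultimately show "double_dual A \<in> iso2 Qtld A (dual (dual A))" using dd \<psi> by (auto simp: iso2_def)
qed

lemma double_dual_hom2: "A \<in> hom1 Qtld Q R \<Longrightarrow> double_dual A \<in> hom2 Qtld A (dual (dual A))"
  using double_dual_iso2 by (auto simp: iso2_def)

text \<open>Taking the right adjoint twice, with the orders reversed in between, gives back
  \<open>\<phi>\<close>, and the double-dual maps are the identity on elements.\<close>

lemma double_dual_natural:
  assumes A: "A \<in> hom1 Qtld Q R" and \<phi>: "\<phi> \<in> hom2 Qtld A A'"
  shows "comp_hom (dual_hom (dual_hom \<phi>)) (double_dual A) = comp_hom (double_dual A') \<phi>"
proof -
  note A' = hom2_Cod[OF \<phi> A]
  note dA = dual_hom1[OF A] and dA' = dual_hom1[OF A'] and d = dual_hom2[OF A \<phi>]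
  note dd = dual_hom2[OF dA' d] and e = double_dual_hom2[OF A] and e' = double_dual_hom2[OF A']
  note mA = hom1D[OF A] and mA' = hom1D[OF A']
  show ?thesis
  proof (rule hom2_eqI[OF A comp_hom2[OF e dd] comp_hom2[OF \<phi> e']])
    fix q r a assume *: "q \<in> Ob Q" "r \<in> Ob R" "a \<in> carrier (At A q r)"
    note L = at_lattice[OF mA *(1,2)] and L' = at_lattice[OF mA' *(1,2)] and sup
      = app_sup_map[OF hom2D[OF \<phi>] mA(2,3) *(1,2)]
    have "app (dual_hom (dual_hom \<phi>)) q r a = right_adjoint (opposite (At A' q r)) (opposite (At A q r))
      (app (dual_hom \<phi>) r q) a"
      using app_dual_hom[OF dA' d *(2,1)] *(3) by simp
    also have "\<dots> = right_adjoint (opposite (At A' q r)) (opposite (At A q r)) (right_adjoint (At A q r)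
      (At A' q r) (app \<phi> q r)) a"
      by (rule right_adjoint_cong) (use app_dual_hom[OF A \<phi> *(1,2)] in simp)
    also have "\<dots> = app \<phi> q r a" by (rule right_adjoint_right_adjoint[OF L L' sup *(3)])
    finally show "app (comp_hom (dual_hom (dual_hom \<phi>)) (double_dual A)) q r a
      = app (comp_hom (double_dual A') \<phi>) q r a"
      using * by (simp add: app_comp_hom hom2D[OF e] hom2D[OF \<phi>] mA app_double_dual[OF A]
        app_double_dual[OF A'] app_in_hom2[OF \<phi> A])
  qed
qed

text \<open>All maps involved are the identity on elements; for the dualised one this is the fact
  that the right adjoint of an identity is an identity.\<close>

lemma double_dual_triangle:
  assumes A: "A \<in> hom1 Qtld Q R"
  shows "comp_hom (dual_hom (double_dual A)) (double_dual (dual A)) = id_hom (dual A)"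
proof -
  note dA = dual_hom1[OF A] and e = double_dual_hom2[OF A]
  note e' = double_dual_hom2[OF dA] and d = dual_hom2[OF A e] and mA = hom1D[OF A]
  show ?thesis
  proof (rule hom2_eqI[OF dA comp_hom2[OF e' d] id_hom2[OF dA]])
    fix r q a assume *: "r \<in> Ob R" "q \<in> Ob Q" "a \<in> carrier (At (dual A) r q)"
    note L = at_lattice[OF mA *(2,1)]
    have "app (dual_hom (double_dual A)) r q a = a"
      by (rule complete_lattice_eqI_below[OF L])
        (use * app_in_hom2[OF d dual_hom1[OF dual_hom1[OF dA]] *(1,2)] in
          \<open>simp_all add: le_app_dual_hom[OF A e] app_double_dual[OF A]\<close>)
    then show "app (comp_hom (dual_hom (double_dual A)) (double_dual (dual A))) r q a
      = app (id_hom (dual A)) r q a"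
      using * by (simp add: app_comp_hom app_id_hom hom2D[OF e'] mA app_double_dual[OF dA])
  qed
qed

end


section \<open>Bicategories with a duality\<close>

context bicategory
begin

section \<open>Whiskering, and composition with invertible 2-cells\<close>

lemma hom1_ob: "A \<in> hom1 B X Y \<Longrightarrow> X \<in> ob B \<and> Y \<in> ob B"
  using arr1_ob by (auto simp: hom1_def)

lemma hom1_arr1: "A \<in> hom1 B X Y \<Longrightarrow> A \<in> arr1 B"
  by (simp add: hom1_def)

lemma hom2_hom1: "\<phi> \<in> hom2 B A A' \<Longrightarrow> A \<in> hom1 B X Y \<Longrightarrow> A' \<in> hom1 B X Y"
  using arr2_arr1 arr2_parallel by (auto simp: hom1_def hom2_def)

lemma iso2_hom2: "\<phi> \<in> iso2 B A A' \<Longrightarrow> \<phi> \<in> hom2 B A A'"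
  by (simp add: iso2_def)

lemma vid_iso2: "A \<in> arr1 B \<Longrightarrow> vid B A \<in> iso2 B A A"
  using vid_hom[of A] vcomp_vid[of "vid B A" A A] by (auto simp: iso2_def)

lemma whisker_left:
  assumes "A \<in> hom1 B X Y" "C \<in> hom1 B Y Z" "\<phi> \<in> hom2 B C C'" "\<psi> \<in> hom2 B C' C''"
  shows "vid B A \<odot> (\<psi> \<cdot> \<phi>) = (vid B A \<odot> \<psi>) \<cdot> (vid B A \<odot> \<phi>)"
  using interchange[OF assms(1,2) vid_hom vid_hom assms(3,4)] vcomp_vid[OF vid_hom] assms(1)
  by (simp add: hom1_arr1)

lemma whisker_right:
  assumes "A \<in> hom1 B X Y" "C \<in> hom1 B Y Z" "\<phi> \<in> hom2 B A A'" "\<psi> \<in> hom2 B A' A''"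
  shows "(\<psi> \<cdot> \<phi>) \<odot> vid B C = (\<psi> \<odot> vid B C) \<cdot> (\<phi> \<odot> vid B C)"
  using interchange[OF assms(1,2,3,4) vid_hom vid_hom] vcomp_vid[OF vid_hom] assms(2)
  by (simp add: hom1_arr1)

lemma exchange:
  assumes "A \<in> hom1 B X Y" "C \<in> hom1 B Y Z" "\<phi> \<in> hom2 B A A'" "\<psi> \<in> hom2 B C C'"
  shows "(\<phi> \<odot> vid B C') \<cdot> (vid B A \<odot> \<psi>) = (vid B A' \<odot> \<psi>) \<cdot> (\<phi> \<odot> vid B C)"
proof -
  have A': "A' \<in> hom1 B X Y" and C': "C' \<in> hom1 B Y Z" using assms hom2_hom1 by blast+
  note v = vid_hom[OF hom1_arr1]
  have "(\<phi> \<odot> vid B C') \<cdot> (vid B A \<odot> \<psi>) = \<phi> \<odot> \<psi>"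
    using interchange[OF assms(1,2) v[OF assms(1)] assms(3,4) v[OF C']] vcomp_vid assms(3,4) by simp
  also have "\<dots> = (vid B A' \<odot> \<psi>) \<cdot> (\<phi> \<odot> vid B C)"
    using interchange[OF assms(1,2,3) v[OF A'] v[OF assms(2)] assms(4)] vcomp_vid assms(3,4) by simp
  finally show ?thesis .
qed

lemma whisker_left_hom:
  "\<lbrakk>A \<in> hom1 B X Y; C \<in> hom1 B Y Z; \<phi> \<in> hom2 B C C'\<rbrakk> \<Longrightarrow> vid B A \<odot> \<phi> \<in> hom2 B (A \<otimes> C) (A \<otimes> C')"
  using hcomp2_hom vid_hom hom1_arr1 by blast

lemma whisker_right_hom:
  "\<lbrakk>A \<in> hom1 B X Y; C \<in> hom1 B Y Z; \<phi> \<in> hom2 B A A'\<rbrakk> \<Longrightarrow> \<phi> \<odot> vid B C \<in> hom2 B (A \<otimes> C) (A' \<otimes> C)"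
  using hcomp2_hom vid_hom hom1_arr1 by blast

lemma bij_precomp:
  assumes i: "i \<in> iso2 B A A'"
  shows "bij_betw (\<lambda>\<psi>. \<psi> \<cdot> i) (hom2 B A' D) (hom2 B A D)"
proof -
  obtain j where j: "j \<in> hom2 B A' A" "j \<cdot> i = vid B A" "i \<cdot> j = vid B A'"
    and i: "i \<in> hom2 B A A'"
    using i by (auto simp: iso2_def)
  show ?thesis
    by (rule bij_betw_byWitness[where f' = "\<lambda>\<psi>. \<psi> \<cdot> j"])
      (use i j vcomp_hom vcomp_vid in \<open>auto simp: vcomp_assoc[symmetric,
        OF i j(1)] vcomp_assoc[symmetric, OF j(1) i]\<close>)
qed

lemma bij_postcomp:
  assumes i: "i \<in> iso2 B D D'"
  shows "bij_betw (\<lambda>\<psi>. i \<cdot> \<psi>) (hom2 B A D) (hom2 B A D')"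
proof -
  obtain j where j: "j \<in> hom2 B D' D" "j \<cdot> i = vid B D" "i \<cdot> j = vid B D'"
    and i: "i \<in> hom2 B D D'"
    using i by (auto simp: iso2_def)
  show ?thesis
    by (rule bij_betw_byWitness[where f' = "\<lambda>\<psi>. j \<cdot> \<psi>"])
      (use i j vcomp_hom vcomp_vid in \<open>auto simp: vcomp_assoc[OF _ i j(1)] vcomp_assoc[OF _ j(1) i]\<close>)
qed

end

context biclosed_bicategory
begin

lemma ext_transpose_eqI:
  assumes "A \<in> hom1 B X Y" "D \<in> hom1 B X Z" "C \<in> hom1 B Y Z"
    "\<phi> \<in> hom2 B C (A \<rhd> D)" "ev_ext A D \<cdot> (vid B A \<odot> \<phi>) = \<psi>"
  shows "ext_transpose A D C \<psi> = \<phi>"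
proof -
  have "inj_on (\<lambda>\<phi>. ev_ext A D \<cdot> (vid B A \<odot> \<phi>)) (hom2 B C (A \<rhd> D))"
    using right_ext[OF assms(1,2)] assms(3) by (auto simp: is_right_extension_def bij_betw_def)
  then show ?thesis
    unfolding ext_transpose_def using assms(4,5) by (intro the_equality) (auto dest: inj_onD)
qed

lemma lift_transpose_eqI:
  assumes "A \<in> hom1 B X Y" "C \<in> hom1 B Z Y" "D \<in> hom1 B Z X"
    "\<phi> \<in> hom2 B D (C \<lhd> A)" "ev_lift C A \<cdot> (\<phi> \<odot> vid B A) = \<psi>"
  shows "lift_transpose A C D \<psi> = \<phi>"
proof -
  have "inj_on (\<lambda>\<phi>. ev_lift C A \<cdot> (\<phi> \<odot> vid B A)) (hom2 B D (C \<lhd> A))"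
    using right_lift[OF assms(1,2)] assms(3) by (auto simp: is_right_lifting_def bij_betw_def)
  then show ?thesis
    unfolding lift_transpose_def using assms(4,5) by (intro the_equality) (auto dest: inj_onD)
qed

end

text \<open>What remains of dual modules once elements are forgotten: right extensions into
  \<open>\<beta>\<close>, the induced 2-cells, and a natural invertible comparison \<open>dd\<close>
  with the double dual. Right liftings, functoriality of \<open>dual2\<close>, all other extensions
  and the cyclic structure are consequences.\<close>

locale bicategory_duality = bicategory B
  for B :: "('o, 'm, 't) bicat" (structure) +
  fixes \<beta> :: "'o \<Rightarrow> 'm"
    and dual :: "'m \<Rightarrow> 'm"
    and ev :: "'m \<Rightarrow> 't"
    and dual2 :: "'t \<Rightarrow> 't"
    and dd :: "'m \<Rightarrow> 't"
  assumes beta_hom: "X \<in> ob B \<Longrightarrow> \<beta> X \<in> hom1 B X X"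
    and dual_extension: "A \<in> hom1 B X Y \<Longrightarrow> is_right_extension B X Y X A (\<beta> X) (dual A) (ev A)"
    and dual2_hom: "\<lbrakk>A \<in> hom1 B X Y; f \<in> hom2 B A A'\<rbrakk> \<Longrightarrow> dual2 f \<in> hom2 B (dual A') (dual A)"
    and ev_natural: "\<lbrakk>A \<in> hom1 B X Y; f \<in> hom2 B A A'\<rbrakk>
      \<Longrightarrow> ev A \<cdot> (vid B A \<odot> dual2 f) = ev A' \<cdot> (f \<odot> vid B (dual A'))"
    and dd_iso: "A \<in> hom1 B X Y \<Longrightarrow> dd A \<in> iso2 B A (dual (dual A))"
    and dd_natural: "\<lbrakk>A \<in> hom1 B X Y; f \<in> hom2 B A A'\<rbrakk> \<Longrightarrow> dual2 (dual2 f) \<cdot> dd A = dd A' \<cdot> f"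
    and dd_triangle: "A \<in> hom1 B X Y \<Longrightarrow> dual2 (dd A) \<cdot> dd (dual A) = vid B (dual A)"
begin

lemma dual_hom: "A \<in> hom1 B X Y \<Longrightarrow> dual A \<in> hom1 B Y X"
  and ev_hom: "A \<in> hom1 B X Y \<Longrightarrow> ev A \<in> hom2 B (A \<otimes> dual A) (\<beta> X)"
  and ev_bij: "\<lbrakk>A \<in> hom1 B X Y; C \<in> hom1 B Y X\<rbrakk>
    \<Longrightarrow> bij_betw (\<lambda>\<phi>. ev A \<cdot> (vid B A \<odot> \<phi>)) (hom2 B C (dual A)) (hom2 B (A \<otimes> C) (\<beta> X))"
  using dual_extension by (auto simp: is_right_extension_def)

lemma dd_hom: "A \<in> hom1 B X Y \<Longrightarrow> dd A \<in> hom2 B A (dual (dual A))"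
  using dd_iso iso2_hom2 by blast

text \<open>Both sides have the same transpose: \<open>ev_natural\<close> moves \<open>dual2\<close>
  of a 2-cell across \<open>ev\<close>, and the exchange law lets the moves for \<open>f\<close> and
  \<open>g\<close> be made one after the other.\<close>

lemma dual2_vcomp:
  assumes A: "A \<in> hom1 B X Y" and f: "f \<in> hom2 B A A'" and g: "g \<in> hom2 B A' A''"
  shows "dual2 (g \<cdot> f) = dual2 f \<cdot> dual2 g"
proof -
  have A': "A' \<in> hom1 B X Y" using A f hom2_hom1 by blast
  have A'': "A'' \<in> hom1 B X Y" using A' g hom2_hom1 by blast
  note d = dual_hom[OF A] dual_hom[OF A'] dual_hom[OF A'']
  note f' = dual2_hom[OF A f] and g' = dual2_hom[OF A' g]
  have fg: "dual2 f \<cdot> dual2 g \<in> hom2 B (dual A'') (dual A)" by (rule vcomp_hom[OF g' f'])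
  have gf: "g \<cdot> f \<in> hom2 B A A''" by (rule vcomp_hom[OF f g])
  have "ev A \<cdot> (vid B A \<odot> (dual2 f \<cdot> dual2 g)) = ev A \<cdot> ((vid B A \<odot> dual2 f) \<cdot> (vid B A \<odot> dual2 g))"
    by (simp add: whisker_left[OF A d(3) g' f'])
  also have "\<dots> = ev A \<cdot> (vid B A \<odot> dual2 f) \<cdot> (vid B A \<odot> dual2 g)"
    by (rule vcomp_assoc[OF whisker_left_hom[OF A d(3) g'] whisker_left_hom[OF A d(2) f'] ev_hom[OF A]])
  also have "\<dots> = ev A' \<cdot> (f \<odot> vid B (dual A')) \<cdot> (vid B A \<odot> dual2 g)"
    by (simp add: ev_natural[OF A f])
  also have "\<dots> = ev A' \<cdot> ((f \<odot> vid B (dual A')) \<cdot> (vid B A \<odot> dual2 g))"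
    by (rule vcomp_assoc[OF whisker_left_hom[OF A d(3) g'] whisker_right_hom[OF A d(2) f] ev_hom[OF A'],
      symmetric])
  also have "\<dots> = ev A' \<cdot> ((vid B A' \<odot> dual2 g) \<cdot> (f \<odot> vid B (dual A'')))"
    by (simp add: exchange[OF A d(3) f g'])
  also have "\<dots> = ev A' \<cdot> (vid B A' \<odot> dual2 g) \<cdot> (f \<odot> vid B (dual A''))"
    by (rule vcomp_assoc[OF whisker_right_hom[OF A d(3) f] whisker_left_hom[OF A' d(3) g'] ev_hom[OF A']])
  also have "\<dots> = ev A'' \<cdot> (g \<odot> vid B (dual A'')) \<cdot> (f \<odot> vid B (dual A''))"
    by (simp add: ev_natural[OF A' g])
  also have "\<dots> = ev A'' \<cdot> ((g \<odot> vid B (dual A'')) \<cdot> (f \<odot> vid B (dual A'')))"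
    by (rule vcomp_assoc[OF whisker_right_hom[OF A d(3) f] whisker_right_hom[OF A' d(3) g]
      ev_hom[OF A''], symmetric])
  also have "\<dots> = ev A'' \<cdot> ((g \<cdot> f) \<odot> vid B (dual A''))"
    by (simp add: whisker_right[OF A d(3) f g])
  also have "\<dots> = ev A \<cdot> (vid B A \<odot> dual2 (g \<cdot> f))"
    by (simp add: ev_natural[OF A gf])
  finally have "ev A \<cdot> (vid B A \<odot> dual2 (g \<cdot> f)) = ev A \<cdot> (vid B A \<odot> (dual2 f \<cdot> dual2 g))" by simp
  then show ?thesis
    using inj_onD[OF bij_betw_imp_inj_on[OF ev_bij[OF A d(3)]]] dual2_hom[OF A gf] fg by blast
qed

text \<open>Turns the right extensions given by \<open>ev\<close> into right liftings.\<close>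

lemma flip_bij:
  assumes A: "A \<in> hom1 B X Y" and C: "C \<in> hom1 B Y X"
  shows "bij_betw (\<lambda>\<phi>. dual2 \<phi> \<cdot> dd A) (hom2 B C (dual A)) (hom2 B A (dual C))"
proof -
  have hom: "dual2 \<phi> \<cdot> dd A \<in> hom2 B A (dual C)"
    if "A \<in> hom1 B X Y" "C \<in> hom1 B Y X" "\<phi> \<in> hom2 B C (dual A)" for X Y A C \<phi>
    by (rule vcomp_hom[OF dd_hom[OF that(1)] dual2_hom[OF that(2,3)]])
  \<comment> \<open>The inverse is the same formula with \<open>A\<close> and \<open>C\<close>
    interchanged: naturality of \<open>dd\<close> at \<open>\<phi>\<close> leaves
    \<open>dual2 (dd A) \<cdot> dd (dual A)\<close> in front of \<open>\<phi>\<close>, which is an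
    identity by the triangle law.\<close>
  have inv: "dual2 (dual2 \<phi> \<cdot> dd A) \<cdot> dd C = \<phi>"
    if A: "A \<in> hom1 B X Y" and C: "C \<in> hom1 B Y X" and \<phi>: "\<phi> \<in> hom2 B C (dual A)" for X Y A C \<phi>
  proof -
    note dA = dual_hom[OF A] and ddA = dual_hom[OF dual_hom[OF A]] and d = dd_hom[OF A]
    have \<phi>': "dual2 \<phi> \<in> hom2 B (dual (dual A)) (dual C)" by (rule dual2_hom[OF C \<phi>])
    have "dual2 (dual2 \<phi> \<cdot> dd A) \<cdot> dd C = dual2 (dd A) \<cdot> dual2 (dual2 \<phi>) \<cdot> dd C"
      by (simp add: dual2_vcomp[OF A d \<phi>'])
    also have "\<dots> = dual2 (dd A) \<cdot> (dual2 (dual2 \<phi>) \<cdot> dd C)"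
      by (rule vcomp_assoc[OF dd_hom[OF C] dual2_hom[OF ddA \<phi>'] dual2_hom[OF A d], symmetric])
    also have "\<dots> = dual2 (dd A) \<cdot> (dd (dual A) \<cdot> \<phi>)" by (simp add: dd_natural[OF C \<phi>])
    also have "\<dots> = dual2 (dd A) \<cdot> dd (dual A) \<cdot> \<phi>"
      by (rule vcomp_assoc[OF \<phi> dd_hom[OF dA] dual2_hom[OF A d]])
    also have "\<dots> = \<phi>" using dd_triangle[OF A] vcomp_vid[OF \<phi>] by simp
    finally show ?thesis .
  qed
  show ?thesis
    by (rule bij_betw_byWitness[where f' = "\<lambda>\<psi>. dual2 \<psi> \<cdot> dd C"])
      (use hom[OF A C] hom[OF C A] inv[OF A C] inv[OF C A] in auto)
qed

text \<open>The counit of the right lifting: the second factor \<open>A\<close> is sent into its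
  double dual, then \<open>dual A\<close> is evaluated against it.\<close>

definition lift_ev :: "'m \<Rightarrow> 't" where
  "lift_ev A = ev (dual A) \<cdot> (vid B (dual A) \<odot> dd A)"

lemma lift_ev_hom:
  assumes "A \<in> hom1 B X Y"
  shows "lift_ev A \<in> hom2 B (dual A \<otimes> A) (\<beta> Y)"
  unfolding lift_ev_def
  by (rule vcomp_hom[OF whisker_left_hom[OF dual_hom[OF assms] assms dd_hom[OF assms]]
    ev_hom[OF dual_hom[OF assms]]])

text \<open>Transposing through \<open>lift_ev A\<close> is the bijection of \<open>flip_bij\<close>
  followed by transposing through \<open>ev C\<close>; this makes \<open>lift_ev_bij\<close> a
  composite of bijections. The proof slides \<open>\<phi>\<close> past \<open>dd A\<close> and then
  across \<open>ev\<close>.\<close>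

lemma lift_ev_whisker:
  assumes A: "A \<in> hom1 B X Y" and C: "C \<in> hom1 B Y X" and \<phi>: "\<phi> \<in> hom2 B C (dual A)"
  shows "lift_ev A \<cdot> (\<phi> \<odot> vid B A) = ev C \<cdot> (vid B C \<odot> (dual2 \<phi> \<cdot> dd A))"
proof -
  note dA = dual_hom[OF A] and ddA = dual_hom[OF dual_hom[OF A]] and d = dd_hom[OF A]
  have \<phi>': "dual2 \<phi> \<in> hom2 B (dual (dual A)) (dual C)" by (rule dual2_hom[OF C \<phi>])
  have "lift_ev A \<cdot> (\<phi> \<odot> vid B A) = ev (dual A) \<cdot> ((vid B (dual A) \<odot> dd A) \<cdot> (\<phi> \<odot> vid B A))"
    unfolding lift_ev_def
    by (rule vcomp_assoc[OF whisker_right_hom[OF C A \<phi>] whisker_left_hom[OF dA A d] ev_hom[OF dA], symmetric])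
  also have "\<dots> = ev (dual A) \<cdot> ((\<phi> \<odot> vid B (dual (dual A))) \<cdot> (vid B C \<odot> dd A))"
    by (simp add: exchange[OF C A \<phi> d])
  also have "\<dots> = ev (dual A) \<cdot> (\<phi> \<odot> vid B (dual (dual A))) \<cdot> (vid B C \<odot> dd A)"
    by (rule vcomp_assoc[OF whisker_left_hom[OF C A d] whisker_right_hom[OF C ddA \<phi>] ev_hom[OF dA]])
  also have "\<dots> = ev C \<cdot> (vid B C \<odot> dual2 \<phi>) \<cdot> (vid B C \<odot> dd A)"
    by (simp add: ev_natural[OF C \<phi>])
  also have "\<dots> = ev C \<cdot> ((vid B C \<odot> dual2 \<phi>) \<cdot> (vid B C \<odot> dd A))"
    by (rule vcomp_assoc[OF whisker_left_hom[OF C A d] whisker_left_hom[OF C ddA \<phi>'] ev_hom[OF C], symmetric])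
  finally show ?thesis by (simp add: whisker_left[OF C A d \<phi>'])
qed

lemma lift_ev_bij:
  assumes A: "A \<in> hom1 B X Y" and C: "C \<in> hom1 B Y X"
  shows "bij_betw (\<lambda>\<phi>. lift_ev A \<cdot> (\<phi> \<odot> vid B A)) (hom2 B C (dual A)) (hom2 B (C \<otimes> A) (\<beta> Y))"
  using bij_betw_trans[OF flip_bij[OF A C] ev_bij[OF C A]]
  by (rule iffD1[OF bij_betw_cong, rotated]) (simp add: lift_ev_whisker[OF A C])

lemma dual_lifting: "A \<in> hom1 B X Y \<Longrightarrow> is_right_lifting B X Y Y A (\<beta> Y) (dual A) (lift_ev A)"
  by (simp add: is_right_lifting_def dual_hom lift_ev_hom lift_ev_bij)

lemma lift_ev_natural:
  assumes A: "A \<in> hom1 B X Y" and f: "f \<in> hom2 B A A'"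
  shows "lift_ev A \<cdot> (dual2 f \<odot> vid B A) = lift_ev A' \<cdot> (vid B (dual A') \<odot> f)"
proof -
  have A': "A' \<in> hom1 B X Y" using A f hom2_hom1 by blast
  note dA' = dual_hom[OF A'] and d = dd_hom[OF A']
  have "lift_ev A \<cdot> (dual2 f \<odot> vid B A) = ev (dual A') \<cdot> (vid B (dual A') \<odot> (dd A' \<cdot> f))"
    using lift_ev_whisker[OF A dA' dual2_hom[OF A f]] by (simp add: dd_natural[OF A f])
  also have "\<dots> = ev (dual A') \<cdot> ((vid B (dual A') \<odot> dd A') \<cdot> (vid B (dual A') \<odot> f))"
    by (simp add: whisker_left[OF dA' A f d])
  also have "\<dots> = lift_ev A' \<cdot> (vid B (dual A') \<odot> f)"
    unfolding lift_ev_def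
    by (rule vcomp_assoc[OF whisker_left_hom[OF dA' A f] whisker_left_hom[OF dA' A' d] ev_hom[OF dA']])
  finally show ?thesis .
qed

text \<open>A form of the triangle law: \<open>dd A\<close> is the transpose of \<open>ev A\<close>
  through \<open>lift_ev (dual A)\<close>, which is what the canonical 2-cell
  \<open>delta_src\<close> asks for.\<close>

lemma lift_ev_dual:
  assumes A: "A \<in> hom1 B X Y"
  shows "lift_ev (dual A) \<cdot> (dd A \<odot> vid B (dual A)) = ev A"
proof -
  note dA = dual_hom[OF A]
  have "lift_ev (dual A) \<cdot> (dd A \<odot> vid B (dual A)) = ev A \<cdot> (vid B A \<odot> vid B (dual A))"
    using lift_ev_whisker[OF dA A dd_hom[OF A]] by (simp add: dd_triangle[OF A])
  then show ?thesis using vcomp_vid[OF ev_hom[OF A]] by (simp add: hcomp2_vid[OF A dA])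
qed

text \<open>2-cells \<open>A \<otimes> C \<rightarrow> D = D**\<close> correspond to \<open>D* \<otimes> (A \<otimes> C) \<rightarrow> \<beta>\<close>, hence to \<open>C \<rightarrow> (D* \<otimes> A)*\<close>.\<close>

lemma ex_right_extension:
  assumes A: "A \<in> hom1 B X Y" and D: "D \<in> hom1 B X Z"
  shows "\<exists>\<epsilon>. is_right_extension B X Y Z A D (dual (dual D \<otimes> A)) \<epsilon>"
proof -
  note dD = dual_hom[OF D]
  let ?F = "dual D \<otimes> A"
  have F: "?F \<in> hom1 B Z Y" by (rule hcomp1_hom[OF dD A])
  let ?E = "dual ?F"
  have E: "?E \<in> hom1 B Y Z" by (rule dual_hom[OF F])
  \<comment> \<open>\<open>G\<close> realises the correspondence for each \<open>C\<close>. Since it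
    is natural in \<open>C\<close>, as \<open>eq\<close> below shows, the universal 2-cell has to be
    the preimage of \<open>ev ?F\<close>.\<close>
  define G where "G C \<psi> = ev (dual D) \<cdot> (vid B (dual D) \<odot> (dd D \<cdot> \<psi>)) \<cdot> assoc B (dual D) A C" for C \<psi>
  have G: "bij_betw (G C) (hom2 B (A \<otimes> C) D) (hom2 B (?F \<otimes> C) (\<beta> Z))" if C: "C \<in> hom1 B Y Z" for C
    unfolding G_def
    using bij_betw_trans[OF bij_betw_trans[OF bij_postcomp[OF dd_iso[OF D]] ev_bij[OF dD hcomp1_hom[OF A C]]]
        bij_precomp[OF assoc_iso[OF dD A C]]]
    by (simp add: comp_def)
  obtain \<epsilon> where \<epsilon>: "\<epsilon> \<in> hom2 B (A \<otimes> ?E) D" "G ?E \<epsilon> = ev ?F"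
    using bij_betw_imp_surj_on[OF G[OF E]] ev_hom[OF F] by (metis imageE)
  have hom: "\<epsilon> \<cdot> (vid B A \<odot> \<phi>) \<in> hom2 B (A \<otimes> C) D"
    if C: "C \<in> hom1 B Y Z" and \<phi>: "\<phi> \<in> hom2 B C ?E" for C \<phi>
    by (rule vcomp_hom[OF whisker_left_hom[OF A C \<phi>] \<epsilon>(1)])
  have eq: "G C (\<epsilon> \<cdot> (vid B A \<odot> \<phi>)) = ev ?F \<cdot> (vid B ?F \<odot> \<phi>)"
    if C: "C \<in> hom1 B Y Z" and \<phi>: "\<phi> \<in> hom2 B C ?E" for C \<phi>
  proof -
    let ?d = "dual D" and ?w = "vid B A \<odot> \<phi>"
    note AC = hcomp1_hom[OF A C] and AE = hcomp1_hom[OF A E]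
    have w: "?w \<in> hom2 B (A \<otimes> C) (A \<otimes> ?E)" by (rule whisker_left_hom[OF A C \<phi>])
    have d\<epsilon>: "dd D \<cdot> \<epsilon> \<in> hom2 B (A \<otimes> ?E) (dual ?d)" by (rule vcomp_hom[OF \<epsilon>(1) dd_hom[OF D]])
    note aC = iso2_hom2[OF assoc_iso[OF dD A C]] and aE = iso2_hom2[OF assoc_iso[OF dD A E]]
    note ww = whisker_left_hom[OF dD AC w] and dd\<epsilon> = whisker_left_hom[OF dD AE d\<epsilon>]
    note e = ev_hom[OF dD]
    have nat: "(vid B ?d \<odot> ?w) \<cdot> assoc B ?d A C = assoc B ?d A ?E \<cdot> (vid B ?F \<odot> \<phi>)"
      using assoc_natural[OF dD A C vid_hom[OF hom1_arr1[OF dD]] vid_hom[OF hom1_arr1[OF A]] \<phi>]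
      by (simp add: hcomp2_vid[OF dD A])
    have "G C (\<epsilon> \<cdot> ?w) = ev ?d \<cdot> (vid B ?d \<odot> (dd D \<cdot> \<epsilon> \<cdot> ?w)) \<cdot> assoc B ?d A C"
      unfolding G_def by (simp add: vcomp_assoc[OF w \<epsilon>(1) dd_hom[OF D]])
    also have "\<dots> = ev ?d \<cdot> ((vid B ?d \<odot> (dd D \<cdot> \<epsilon>)) \<cdot> (vid B ?d \<odot> ?w)) \<cdot> assoc B ?d A C"
      by (simp add: whisker_left[OF dD AC w d\<epsilon>])
    also have "\<dots> = ev ?d \<cdot> (vid B ?d \<odot> (dd D \<cdot> \<epsilon>)) \<cdot> (vid B ?d \<odot> ?w) \<cdot> assoc B ?d A C"
      by (simp add: vcomp_assoc[OF ww dd\<epsilon> e])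
    also have "\<dots> = ev ?d \<cdot> (vid B ?d \<odot> (dd D \<cdot> \<epsilon>)) \<cdot> ((vid B ?d \<odot> ?w) \<cdot> assoc B ?d A C)"
      by (rule vcomp_assoc[OF aC ww vcomp_hom[OF dd\<epsilon> e], symmetric])
    also have "\<dots> = G ?E \<epsilon> \<cdot> (vid B ?F \<odot> \<phi>)"
      unfolding nat G_def
      by (rule vcomp_assoc[OF whisker_left_hom[OF F C \<phi>] aE vcomp_hom[OF dd\<epsilon> e]])
    finally show ?thesis by (simp add: \<epsilon>(2))
  qed
  \<comment> \<open>Two out of three: \<open>G C\<close> is bijective, and so is its composite with
    the map in question, which is transposition through \<open>ev ?F\<close>.\<close>
  have "bij_betw (\<lambda>\<phi>. \<epsilon> \<cdot> (vid B A \<odot> \<phi>)) (hom2 B C ?E) (hom2 B (A \<otimes> C) D)" if C: "C \<in> hom1 B Y Z" for C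
  proof (rule iffD2[OF bij_betw_comp_iff2[OF G[OF C]]])
    show "bij_betw (G C \<circ> (\<lambda>\<phi>. \<epsilon> \<cdot> (vid B A \<odot> \<phi>))) (hom2 B C ?E) (hom2 B (?F \<otimes> C) (\<beta> Z))"
      using ev_bij[OF F C] by (rule iffD1[OF bij_betw_cong, rotated]) (simp add: eq[OF C])
  qed (use hom[OF C] in auto)
  then show ?thesis using E \<epsilon>(1) by (auto simp: is_right_extension_def)
qed

text \<open>The mirror image: 2-cells \<open>C \<otimes> A \<rightarrow> D\<close> correspond to
  \<open>C \<otimes> A \<otimes> dual D \<rightarrow> \<beta> Z\<close>, hence to
  \<open>C \<rightarrow> dual (A \<otimes> dual D)\<close>, with \<open>lift_ev\<close> in place of
  \<open>ev\<close>.\<close>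

lemma ex_right_lifting:
  assumes A: "A \<in> hom1 B X Y" and D: "D \<in> hom1 B Z Y"
  shows "\<exists>\<epsilon>. is_right_lifting B X Y Z A D (dual (A \<otimes> dual D)) \<epsilon>"
proof -
  note dD = dual_hom[OF D]
  let ?F = "A \<otimes> dual D"
  have F: "?F \<in> hom1 B X Z" by (rule hcomp1_hom[OF A dD])
  let ?E = "dual ?F"
  have E: "?E \<in> hom1 B Z X" by (rule dual_hom[OF F])
  define G where "G \<psi> = lift_ev (dual D) \<cdot> ((dd D \<cdot> \<psi>) \<odot> vid B (dual D))" for \<psi>
  have G: "bij_betw G (hom2 B (C \<otimes> A) D) (hom2 B (C \<otimes> A \<otimes> dual D) (\<beta> Z))" if C: "C \<in> hom1 B Z X" for C
    unfolding G_def
    using bij_betw_trans[OF bij_postcomp[OF dd_iso[OF D]] lift_ev_bij[OF dD hcomp1_hom[OF C A]]]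
    by (simp add: comp_def)
  \<comment> \<open>The associator is attached to this side, where precomposition uses it in its
    given direction; \<open>G\<close> and \<open>H C\<close> then meet in the same set of 2-cells
    and no inverse associator occurs.\<close>
  define H where "H C \<phi> = lift_ev ?F \<cdot> (\<phi> \<odot> vid B ?F) \<cdot> assoc B C A (dual D)" for C \<phi>
  have H: "bij_betw (H C) (hom2 B C ?E) (hom2 B (C \<otimes> A \<otimes> dual D) (\<beta> Z))" if C: "C \<in> hom1 B Z X" for C
    unfolding H_def
    using bij_betw_trans[OF lift_ev_bij[OF F C] bij_precomp[OF assoc_iso[OF C A dD]]]
    by (simp add: comp_def)
  have "H ?E (vid B ?E) \<in> hom2 B (?E \<otimes> A \<otimes> dual D) (\<beta> Z)"
    using bij_betw_imp_surj_on[OF H[OF E]] vid_hom[OF hom1_arr1[OF E]] by blast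
  \<comment> \<open>As in the Yoneda lemma, the counit is what corresponds to the identity of
    \<open>?E\<close>.\<close>
  then obtain \<epsilon> where \<epsilon>: "\<epsilon> \<in> hom2 B (?E \<otimes> A) D" "G \<epsilon> = H ?E (vid B ?E)"
    using bij_betw_imp_surj_on[OF G[OF E]] by (metis imageE)
  have HE: "H ?E (vid B ?E) = lift_ev ?F \<cdot> assoc B ?E A (dual D)"
    using vcomp_vid[OF lift_ev_hom[OF F]] by (simp add: H_def hcomp2_vid[OF E F])
  have hom: "\<epsilon> \<cdot> (\<phi> \<odot> vid B A) \<in> hom2 B (C \<otimes> A) D"
    if C: "C \<in> hom1 B Z X" and \<phi>: "\<phi> \<in> hom2 B C ?E" for C \<phi>
    by (rule vcomp_hom[OF whisker_right_hom[OF C A \<phi>] \<epsilon>(1)])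
  have eq: "G (\<epsilon> \<cdot> (\<phi> \<odot> vid B A)) = H C \<phi>"
    if C: "C \<in> hom1 B Z X" and \<phi>: "\<phi> \<in> hom2 B C ?E" for C \<phi>
  proof -
    let ?d = "dual D" and ?w = "\<phi> \<odot> vid B A"
    note CA = hcomp1_hom[OF C A] and EA = hcomp1_hom[OF E A]
    have w: "?w \<in> hom2 B (C \<otimes> A) (?E \<otimes> A)" by (rule whisker_right_hom[OF C A \<phi>])
    have d\<epsilon>: "dd D \<cdot> \<epsilon> \<in> hom2 B (?E \<otimes> A) (dual ?d)" by (rule vcomp_hom[OF \<epsilon>(1) dd_hom[OF D]])
    note ww = whisker_right_hom[OF CA dD w] and dd\<epsilon> = whisker_right_hom[OF EA dD d\<epsilon>]
    note e = lift_ev_hom[OF dD] and e' = lift_ev_hom[OF F]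
    note aC = iso2_hom2[OF assoc_iso[OF C A dD]] and aE = iso2_hom2[OF assoc_iso[OF E A dD]]
    have nat: "assoc B ?E A ?d \<cdot> (?w \<odot> vid B ?d) = (\<phi> \<odot> vid B ?F) \<cdot> assoc B C A ?d"
      using assoc_natural[OF C A dD \<phi> vid_hom[OF hom1_arr1[OF A]] vid_hom[OF hom1_arr1[OF dD]]]
      by (simp add: hcomp2_vid[OF A dD])
    have "G (\<epsilon> \<cdot> ?w) = lift_ev ?d \<cdot> ((dd D \<cdot> \<epsilon> \<cdot> ?w) \<odot> vid B ?d)"
      unfolding G_def by (simp add: vcomp_assoc[OF w \<epsilon>(1) dd_hom[OF D]])
    also have "\<dots> = lift_ev ?d \<cdot> (((dd D \<cdot> \<epsilon>) \<odot> vid B ?d) \<cdot> (?w \<odot> vid B ?d))"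
      by (simp add: whisker_right[OF CA dD w d\<epsilon>])
    also have "\<dots> = G \<epsilon> \<cdot> (?w \<odot> vid B ?d)"
      unfolding G_def by (rule vcomp_assoc[OF ww dd\<epsilon> e])
    also have "\<dots> = lift_ev ?F \<cdot> (assoc B ?E A ?d \<cdot> (?w \<odot> vid B ?d))"
      unfolding \<epsilon>(2) HE by (rule vcomp_assoc[OF ww aE e', symmetric])
    also have "\<dots> = H C \<phi>"
      unfolding nat H_def by (rule vcomp_assoc[OF aC whisker_right_hom[OF C F \<phi>] e'])
    finally show ?thesis .
  qed
  have "bij_betw (\<lambda>\<phi>. \<epsilon> \<cdot> (\<phi> \<odot> vid B A)) (hom2 B C ?E) (hom2 B (C \<otimes> A) D)" if C: "C \<in> hom1 B Z X" for C
  proof (rule iffD2[OF bij_betw_comp_iff2[OF G[OF C]]])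
    show "bij_betw (G \<circ> (\<lambda>\<phi>. \<epsilon> \<cdot> (\<phi> \<odot> vid B A))) (hom2 B C ?E) (hom2 B (C \<otimes> A \<otimes> dual D) (\<beta> Z))"
      using H[OF C] by (rule iffD1[OF bij_betw_cong, rotated]) (simp add: eq[OF C])
  qed (use hom[OF C] in auto)
  then show ?thesis using E \<epsilon>(1) by (auto simp: is_right_lifting_def)
qed

text \<open>
  The case distinction makes \<open>A \<rhd> \<beta>\<^bsub>X\<^esub>\<close> and \<open>\<beta>\<^bsub>Y\<^esub> \<lhd> A\<close> equal, not just isomorphic,
    so that identities serve as \<open>\<theta>\<close>.
\<close>

definition dual_ext :: "'m \<Rightarrow> 'm \<Rightarrow> 'm" where
  "dual_ext A D = (if D = \<beta> (src1 B A) then dual A else dual (dual D \<otimes> A))"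

definition dual_ev_ext :: "'m \<Rightarrow> 'm \<Rightarrow> 't" where
  "dual_ev_ext A D = (if D = \<beta> (src1 B A) then ev A else
     (SOME \<epsilon>. is_right_extension B (src1 B A) (trg1 B A) (trg1 B D) A D (dual (dual D \<otimes> A)) \<epsilon>))"

definition dual_lift :: "'m \<Rightarrow> 'm \<Rightarrow> 'm" where
  "dual_lift D A = (if D = \<beta> (trg1 B A) then dual A else dual (A \<otimes> dual D))"

definition dual_ev_lift :: "'m \<Rightarrow> 'm \<Rightarrow> 't" where
  "dual_ev_lift D A = (if D = \<beta> (trg1 B A) then lift_ev A else
     (SOME \<epsilon>. is_right_lifting B (src1 B A) (trg1 B A) (src1 B D) A D (dual (A \<otimes> dual D)) \<epsilon>))"

lemma dual_ext_extension:
  assumes A: "A \<in> hom1 B X Y" and D: "D \<in> hom1 B X Z"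
  shows "is_right_extension B X Y Z A D (dual_ext A D) (dual_ev_ext A D)"
proof (cases "D = \<beta> X")
  case True
  have "Z = X" using D beta_hom[of X] hom1_ob[OF A] unfolding True by (auto simp: hom1_def)
  then show ?thesis
    using dual_extension[OF A] A by (simp add: True dual_ext_def dual_ev_ext_def hom1_def)
next
  case False
  then show ?thesis
    using someI_ex[OF ex_right_extension[OF A D]] A D
    by (simp add: dual_ext_def dual_ev_ext_def hom1_def)
qed

lemma dual_lift_lifting:
  assumes A: "A \<in> hom1 B X Y" and D: "D \<in> hom1 B Z Y"
  shows "is_right_lifting B X Y Z A D (dual_lift D A) (dual_ev_lift D A)"
proof (cases "D = \<beta> Y")
  case True
  have "Z = Y" using D beta_hom[of Y] hom1_ob[OF A] unfolding True by (auto simp: hom1_def)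
  then show ?thesis
    using dual_lifting[OF A] A by (simp add: True dual_lift_def dual_ev_lift_def hom1_def)
next
  case False
  then show ?thesis
    using someI_ex[OF ex_right_lifting[OF A D]] A D
    by (simp add: dual_lift_def dual_ev_lift_def hom1_def)
qed

sublocale biclosed: biclosed_bicategory B dual_ext dual_ev_ext dual_lift dual_ev_lift
  using dual_ext_extension dual_lift_lifting by unfold_locales

section \<open>The canonical 2-cells and the cyclic structure\<close>

lemma dual_ext_beta [simp]:
  "A \<in> hom1 B X Y \<Longrightarrow> dual_ext A (\<beta> X) = dual A \<and> dual_ev_ext A (\<beta> X) = ev A"
  by (simp add: dual_ext_def dual_ev_ext_def hom1_def)

lemma dual_lift_beta [simp]:
  "A \<in> hom1 B X Y \<Longrightarrow> dual_lift (\<beta> Y) A = dual A \<and> dual_ev_lift (\<beta> Y) A = lift_ev A"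
  by (simp add: dual_lift_def dual_ev_lift_def hom1_def)

text \<open>\<open>dd A\<close> has the required transposes: for \<open>delta_trg\<close> by the
  definition of \<open>lift_ev\<close>, for \<open>delta_src\<close> by \<open>lift_ev_dual\<close>.
  That one 2-cell serves as both is the content of cyclicity.\<close>

lemma delta_eq_dd:
  assumes A: "A \<in> hom1 B X Y"
  shows "biclosed.delta_trg \<beta> A Y = dd A" and "biclosed.delta_src \<beta> X A = dd A"
proof -
  note dA = dual_hom[OF A] and ob = hom1_ob[OF A]
  show "biclosed.delta_trg \<beta> A Y = dd A"
    unfolding biclosed.delta_trg_def
    by (rule biclosed.ext_transpose_eqI[of _ Y X _ Y])
      (use A dA dd_hom[OF A] ob in \<open>auto simp: beta_hom lift_ev_def\<close>)
  show "biclosed.delta_src \<beta> X A = dd A"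
    unfolding biclosed.delta_src_def
    by (rule biclosed.lift_transpose_eqI[of _ Y X _ X])
      (use A dA dd_hom[OF A] ob in \<open>auto simp: beta_hom lift_ev_dual\<close>)
qed

text \<open>\<open>ev_natural\<close> and \<open>lift_ev_natural\<close> say that
  \<open>dual2 f\<close> has the transpose defining either induced 2-cell. So both ways of dualising
  agree on 2-cells as well, and identities are natural between them.\<close>

lemma beta_map_eq_dual2:
  assumes A: "A \<in> hom1 B X Y" and f: "f \<in> hom2 B A A'"
  shows "biclosed.ext_map f (\<beta> X) = dual2 f" and "biclosed.lift_map (\<beta> Y) f = dual2 f"
proof -
  have A': "A' \<in> hom1 B X Y" using A f hom2_hom1 by blast
  have st: "src2 B f = A" "trg2 B f = A'" using f by (auto simp: hom2_def)
  note dA = dual_hom[OF A] dual_hom[OF A'] and ob = hom1_ob[OF A]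
  show "biclosed.ext_map f (\<beta> X) = dual2 f"
    unfolding biclosed.ext_map_def Let_def st
    by (rule biclosed.ext_transpose_eqI[of _ X Y _ X])
      (use A A' dA dual2_hom[OF A f] ob in \<open>auto simp: beta_hom ev_natural[OF A f]\<close>)
  show "biclosed.lift_map (\<beta> Y) f = dual2 f"
    unfolding biclosed.lift_map_def Let_def st
    by (rule biclosed.lift_transpose_eqI[of _ X Y _ Y])
      (use A A' dA dual2_hom[OF A f] ob in \<open>auto simp: beta_hom lift_ev_natural[OF A f]\<close>)
qed

lemma dual2_vid:
  assumes A: "A \<in> hom1 B X Y"
  shows "dual2 (vid B A) = vid B (dual A)"
proof -
  note dA = dual_hom[OF A] and v = vid_hom[OF hom1_arr1]
  show ?thesis
    using inj_onD[OF bij_betw_imp_inj_on[OF ev_bij[OF A dA]]] ev_natural[OF A v[OF A]]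
      dual2_hom[OF A v[OF A]] v[OF dA] by blast
qed

text \<open>With every \<open>\<theta>\<close> an identity, naturality is the agreement of
  \<open>ext_map\<close> with \<open>lift_map\<close>, and the cyclic equation collapses to
  \<open>delta_src = delta_trg\<close>; invertibility of the canonical 2-cells is that of
  \<open>dd\<close>.\<close>

theorem cyclic_star_autonomous: "cyclic_star_autonomous B"
proof -
  have "biclosed.dualizing \<beta>"
    unfolding biclosed.dualizing_def
    using beta_hom dd_iso
    by (auto simp: delta_eq_dd dual_ext_beta[OF dual_hom] dual_lift_beta[OF dual_hom])
  moreover have "vid B (dual A) \<in> iso2 B (dual_lift (\<beta> Y) A) (dual_ext A (\<beta> X))"
    if "A \<in> hom1 B X Y" for A X Y
    using that vid_iso2[OF hom1_arr1[OF dual_hom[OF that]]] by simp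
  moreover have "vid B (dual A) \<cdot> biclosed.lift_map (\<beta> Y) f = biclosed.ext_map f (\<beta> X) \<cdot> vid B (dual A')"
    if "A \<in> hom1 B X Y" "f \<in> hom2 B A A'" for A A' X Y f
    using vcomp_vid[OF dual2_hom[OF that]] by (simp add: beta_map_eq_dual2[OF that])
  moreover have "vid B (dual (dual_lift (\<beta> Y) A)) \<cdot> biclosed.lift_map (\<beta> X) (vid B (dual A)) \<cdot>
      biclosed.delta_src \<beta> X A = biclosed.delta_trg \<beta> A Y"
    if A: "A \<in> hom1 B X Y" for A X Y
  proof -
    note dA = dual_hom[OF A] and ddA = dual_hom[OF dual_hom[OF A]]
    have "biclosed.lift_map (\<beta> X) (vid B (dual A)) = vid B (dual (dual A))"
      using beta_map_eq_dual2(2)[OF dA vid_hom[OF hom1_arr1[OF dA]]] by (simp add: dual2_vid[OF dA])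
    then show ?thesis
      using A vcomp_vid[OF vid_hom[OF hom1_arr1[OF ddA]]] vcomp_vid[OF dd_hom[OF A]]
      by (simp add: delta_eq_dd)
  qed
  ultimately have "biclosed.cyclic_dualizing \<beta>"
    unfolding biclosed.cyclic_dualizing_def
    by (intro conjI exI[of _ "\<lambda>A. vid B (dual A)"]) blast+
  then show ?thesis
    unfolding cyclic_star_autonomous_def using biclosed.biclosed_bicategory_axioms by blast
qed

end

theorem theorem7p10:
  fixes elts :: "'u \<Rightarrow> 'u set"
  assumes "set_universe elts"
  shows "cyclic_star_autonomous (set_universe.Qtld elts)"
proof -
  interpret set_universe elts by (rule assms)
  have "bicategory_duality Qtld dualizer dual ev_hom dual_hom double_dual"
    unfolding bicategory_duality_def bicategory_duality_axioms_def Qtld_simps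
    using bicategory_Qtld dualizer_hom1 dual_right_extension dual_hom2 ev_hom_natural double_dual_iso2
      double_dual_natural double_dual_triangle
    by simp
  then show ?thesis by (rule bicategory_duality.cyclic_star_autonomous)
qed

end
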